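(* Let $\mathbb{E} = \langle B,t;\,t^{-1}Ht = K,\,\varphi\rangle$ be an HNN-extension such that $H$ and $K$ are normal in $B$ and $L\varphi = L$, where $L = H\cap K$. Let $\mathcal{C}$ be a root class of groups closed under taking quotient groups. If $B$ has a homomorphism $\sigma$ onto a group from $\mathcal{C}$ acting injectively on the subgroup $HK$, then the following statements hold. 1. The condition $\mathfrak{U},\mathfrak{V}\in\mathcal{C}$ is equivalent to the existence of a homomorphism of $\mathbb{E}$ onto a group from $\mathcal{C}$ that extends $\sigma$. 2. If $\mathfrak{U},\mathfrak{V}\in\mathcal{C}$ and $B$ is residually a $\mathcal{C}$-group, then $\mathbb{E}$ is also residually a $\mathcal{C}$-group.
   Context: Classes of groups are closed under isomorphism. Maps are written on the right and composed from left to right. $\mathbb{E} = \langle B,t;\,t^{-1}Ht = K,\,\varphi\rangle$ denotes the HNN-extension of a group $B$ with stable letter $t$ and subgroups $H,K\leqslant B$ associated according to an isomorphism $\varphi\colon H\to K$ (so $t^{-1}ht = h\varphi$ for $h\in H$); $B$ is identified with its image in $\mathbb{E}$. A homomorphism $\tau$ of $\mathbb{E}$ onto a group $G$ extends $\sigma$ if its restriction to $B$ is $\sigma$ followed by an embedding of $\operatorname{Im}\sigma$ into $G$ (with $\operatorname{Im}\sigma$ identified with its image in $G$); equivalently, $\ker\tau\cap B=\ker\sigma$. For a group $X$ with normal subgroup $Y$, $\operatorname{Aut}_X(Y)\leqslant\operatorname{Aut}Y$ is the group of restrictions to $Y$ of all inner automorphisms of $X$; $\operatorname{sgp}\{\cdot\}$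 denotes the generated subgroup. With $H,K$ normal in $B$, $L=H\cap K$ and $L\varphi=L$, put $\mathfrak{H}=\operatorname{Aut}_B(H)$, $\mathfrak{K}=\varphi\operatorname{Aut}_B(K)\varphi^{-1}$, $\mathfrak{U}=\operatorname{sgp}\{\mathfrak{H},\mathfrak{K}\}$ (subgroups of $\operatorname{Aut}H$); and $\mathfrak{L}=\operatorname{Aut}_B(L)$, $\mathfrak{F}=\operatorname{sgp}\{\varphi|_L\}$, $\mathfrak{V}=\operatorname{sgp}\{\mathfrak{L},\mathfrak{F}\}$ (subgroups of $\operatorname{Aut}L$). A group $X$ is residually a $\mathcal{C}$-group if every non-trivial element of $X$ has non-trivial image under some homomorphism of $X$ onto a group from $\mathcal{C}$. A class $\mathcal{C}$ is a root class if it contains non-trivial groups, is closed under taking subgroups, and satisfies any of the following (equivalent) conditions: (1) for every group $X$ and every subnormal series $1\leqslant Z\leqslant Y\leqslant X$ with $X/Y,Y/Z\in\mathcal{C}$ there is a normal subgroup $T$ of $X$ with $X/T\in\mathcal{C}$ and $T\leqslant Z$; (2) $\mathcal{C}$ is closed under unrestricted wreath products; (3) $\mathcal{C}$ is closed under extensions and, for any $X,Y\in\mathcal{C}$, contains the unrestricted direct product $\prod_{y\in Y}X_y$ with each $X_y\cong X$. *)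

theory Defs
  imports "HOL-Algebra.Bij" "HOL-Algebra.Generated_Groups" "HOL-Library.Equipollence"
begin

section \<open>Classes of groups\<close>

text \<open>
  A class of groups is represented by its members with carrier in a universe type \<open>'u\<close>; a group
  over any other type belongs to the class if it is isomorphic to such a member.
  Thus all statements about a class are meaningful for groups of cardinality at most that
  of \<open>'u\<close> only.
\<close>

definition group_class :: "'u monoid set \<Rightarrow> bool" where
  "group_class \<C> \<longleftrightarrow>
     (\<forall>G\<in>\<C>. group G) \<and> (\<forall>G\<in>\<C>. \<forall>G'. group G' \<and> G \<cong> G' \<longrightarrow> G' \<in> \<C>)"

definition in_class :: "('a, 'm) monoid_scheme \<Rightarrow> 'u monoid set \<Rightarrow> bool" where
  "in_class G \<C> \<longleftrightarrow> group G \<and> (\<exists>G'\<in>\<C>. G \<cong> G')"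

definition subgroup_closed :: "'u monoid set \<Rightarrow> bool" where
  "subgroup_closed \<C> \<longleftrightarrow> (\<forall>G\<in>\<C>. \<forall>S. subgroup S G \<longrightarrow> G\<lparr>carrier := S\<rparr> \<in> \<C>)"

definition quotient_closed :: "'u monoid set \<Rightarrow> bool" where
  "quotient_closed \<C> \<longleftrightarrow> (\<forall>G\<in>\<C>. \<forall>N. N \<lhd> G \<longrightarrow> in_class (G Mod N) \<C>)"

text \<open>
  Of the usual equivalent definitions of a root class (via subnormal series, via
  unrestricted wreath products, via extensions and unrestricted direct powers) the first is
  taken: it is the only one that does not lead to groups of larger cardinality. If \<open>'u\<close> is
  infinite, the classes below are exactly the restrictions of root classes to the groups of
  cardinality at most that of \<open>'u\<close>: given such a \<open>\<C>\<close>, the groups all of whose subgroups of at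
  most that cardinality belong to \<open>\<C>\<close> form a root class, which is closed under quotients if \<open>\<C>\<close> is.
\<close>

definition root_class :: "'u monoid set \<Rightarrow> bool" where
  "root_class \<C> \<longleftrightarrow>
     group_class \<C> \<and>
     (\<exists>G\<in>\<C>. carrier G \<noteq> {\<one>\<^bsub>G\<^esub>}) \<and>
     subgroup_closed \<C> \<and>
     (\<forall>(X :: 'u monoid) Y Z.
        group X \<and> Y \<lhd> X \<and> Z \<lhd> X\<lparr>carrier := Y\<rparr> \<and>
        in_class (X Mod Y) \<C> \<and> in_class (X\<lparr>carrier := Y\<rparr> Mod Z) \<C> \<longrightarrow>
        (\<exists>T. T \<lhd> X \<and> T \<subseteq> Z \<and> in_class (X Mod T) \<C>))"

definition residually :: "('a, 'm) monoid_scheme \<Rightarrow> 'u monoid set \<Rightarrow> bool" where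
  "residually X \<C> \<longleftrightarrow>
     (\<forall>x\<in>carrier X. x \<noteq> \<one>\<^bsub>X\<^esub> \<longrightarrow> (\<exists>G\<in>\<C>. \<exists>f\<in>epi X G. f x \<noteq> \<one>\<^bsub>G\<^esub>))"


section \<open>HNN-extensions\<close>

text \<open>
  \<open>HNN B H \<phi>\<close> is the group with presentation \<open>\<langle>B, t; t\<inverse> h t = \<phi> h (h \<in> H)\<rangle>\<close>: words in the
  elements of \<open>B\<close> and the letters \<open>t\<close>, \<open>t\<inverse>\<close>, modulo the congruence generated by the
  multiplication table of \<open>B\<close>, free cancellation of \<open>t\<close>, and the relations
  \<open>t\<inverse> h t = \<phi> h\<close>. The second associated subgroup is \<open>\<phi> ` H\<close>.
\<close>

datatype 'b hnn_letter = Base 'b | Stable | Stable_inv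

definition hnn_words :: "('b, 'm) monoid_scheme \<Rightarrow> 'b hnn_letter list set" where
  "hnn_words B = lists (Base ` carrier B \<union> {Stable, Stable_inv})"

inductive_set hnn_rel ::
    "('b, 'm) monoid_scheme \<Rightarrow> 'b set \<Rightarrow> ('b \<Rightarrow> 'b) \<Rightarrow>
       ('b hnn_letter list \<times> 'b hnn_letter list) set"
  for B :: "('b, 'm) monoid_scheme" and H :: "'b set" and \<phi> :: "'b \<Rightarrow> 'b" where
  refl: "w \<in> hnn_words B \<Longrightarrow> (w, w) \<in> hnn_rel B H \<phi>"
| sym: "(u, v) \<in> hnn_rel B H \<phi> \<Longrightarrow> (v, u) \<in> hnn_rel B H \<phi>"
| trans: "(u, v) \<in> hnn_rel B H \<phi> \<Longrightarrow> (v, w) \<in> hnn_rel B H \<phi> \<Longrightarrow> (u, w) \<in> hnn_rel B H \<phi>"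
| append: "(u, v) \<in> hnn_rel B H \<phi> \<Longrightarrow> (u', v') \<in> hnn_rel B H \<phi> \<Longrightarrow>
    (u @ u', v @ v') \<in> hnn_rel B H \<phi>"
| base_mult: "x \<in> carrier B \<Longrightarrow> y \<in> carrier B \<Longrightarrow>
    ([Base x, Base y], [Base (x \<otimes>\<^bsub>B\<^esub> y)]) \<in> hnn_rel B H \<phi>"
| base_one: "([Base \<one>\<^bsub>B\<^esub>], []) \<in> hnn_rel B H \<phi>"
| stable_right: "([Stable, Stable_inv], []) \<in> hnn_rel B H \<phi>"
| stable_left: "([Stable_inv, Stable], []) \<in> hnn_rel B H \<phi>"
| conj: "h \<in> H \<Longrightarrow> ([Stable_inv, Base h, Stable], [Base (\<phi> h)]) \<in> hnn_rel B H \<phi>"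

definition HNN ::
    "('b, 'm) monoid_scheme \<Rightarrow> 'b set \<Rightarrow> ('b \<Rightarrow> 'b) \<Rightarrow> 'b hnn_letter list set monoid" where
  "HNN B H \<phi> =
     \<lparr>carrier = hnn_words B // hnn_rel B H \<phi>,
      mult = (\<lambda>U V. \<Union>u\<in>U. \<Union>v\<in>V. hnn_rel B H \<phi> `` {u @ v}),
      one = hnn_rel B H \<phi> `` {[]}\<rparr>"

definition hnn_base ::
    "('b, 'm) monoid_scheme \<Rightarrow> 'b set \<Rightarrow> ('b \<Rightarrow> 'b) \<Rightarrow> 'b \<Rightarrow> 'b hnn_letter list set" where
  "hnn_base B H \<phi> b = hnn_rel B H \<phi> `` {[Base b]}"

definition hnn_stable ::
    "('b, 'm) monoid_scheme \<Rightarrow> 'b set \<Rightarrow> ('b \<Rightarrow> 'b) \<Rightarrow> 'b hnn_letter list set" where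
  "hnn_stable B H \<phi> = hnn_rel B H \<phi> `` {[Stable]}"

text \<open>
  \<open>\<tau>\<close> (a homomorphism of the HNN-extension onto \<open>G\<close>) extends \<open>\<sigma>\<close> (a homomorphism of \<open>B\<close> onto
  \<open>S\<close>): on \<open>B\<close>, it is \<open>\<sigma>\<close> followed by an embedding of \<open>S\<close> into \<open>G\<close>.
\<close>

definition hnn_extends ::
    "('b, 'm) monoid_scheme \<Rightarrow> 'b set \<Rightarrow> ('b \<Rightarrow> 'b) \<Rightarrow> ('s, 'n) monoid_scheme \<Rightarrow> ('b \<Rightarrow> 's) \<Rightarrow>
       ('g, 'k) monoid_scheme \<Rightarrow> ('b hnn_letter list set \<Rightarrow> 'g) \<Rightarrow> bool" where
  "hnn_extends B H \<phi> S \<sigma> G \<tau> \<longleftrightarrow>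
     (\<exists>e\<in>mon S G. \<forall>b\<in>carrier B. \<tau> (hnn_base B H \<phi> b) = e (\<sigma> b))"


section \<open>The automorphism groups attached to an HNN-extension\<close>

text \<open>
  Automorphisms are extensional functions, and the product in \<^const>\<open>AutoGroup\<close> is composition
  from right to left. Composing from left to right instead yields the opposite group; it has the
  same subgroups, and inversion is an isomorphism between the two.
\<close>

definition Aut_restr :: "('b, 'm) monoid_scheme \<Rightarrow> 'b set \<Rightarrow> ('b \<Rightarrow> 'b) set" where
  "Aut_restr X Y = {\<lambda>y\<in>Y. inv\<^bsub>X\<^esub> x \<otimes>\<^bsub>X\<^esub> y \<otimes>\<^bsub>X\<^esub> x |x. x \<in> carrier X}"

text \<open>
  In the next definition the second set is \<open>\<phi> Aut\<^sub>B(K) \<phi>\<inverse>\<close> for maps written on the right: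
  first \<open>\<phi> : H \<rightarrow> K\<close>, then an automorphism of \<open>K\<close>, then \<open>\<phi>\<inverse> : K \<rightarrow> H\<close>.
\<close>

definition hnn_U ::
    "('b, 'm) monoid_scheme \<Rightarrow> 'b set \<Rightarrow> 'b set \<Rightarrow> ('b \<Rightarrow> 'b) \<Rightarrow> ('b \<Rightarrow> 'b) monoid" where
  "hnn_U B H K \<phi> =
     subgroup_generated (AutoGroup (B\<lparr>carrier := H\<rparr>))
       (Aut_restr B H \<union> {\<lambda>h\<in>H. inv_into H \<phi> (\<alpha> (\<phi> h)) |\<alpha>. \<alpha> \<in> Aut_restr B K})"

definition hnn_V ::
    "('b, 'm) monoid_scheme \<Rightarrow> 'b set \<Rightarrow> ('b \<Rightarrow> 'b) \<Rightarrow> ('b \<Rightarrow> 'b) monoid" where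
  "hnn_V B L \<phi> =
     subgroup_generated (AutoGroup (B\<lparr>carrier := L\<rparr>))
       (Aut_restr B L \<union> generate (AutoGroup (B\<lparr>carrier := L\<rparr>)) {restrict \<phi> L})"


section \<open>Basic facts about HNN-extensions\<close>

lemma hnn_words_append [simp]:
  "u @ v \<in> hnn_words B \<longleftrightarrow> u \<in> hnn_words B \<and> v \<in> hnn_words B"
  by (simp add: hnn_words_def)

lemma hnn_words_simps [simp]:
  "[] \<in> hnn_words B"
  "a # a' # w \<in> hnn_words B \<longleftrightarrow> [a] \<in> hnn_words B \<and> a' # w \<in> hnn_words B"
  "[Base b] \<in> hnn_words B \<longleftrightarrow> b \<in> carrier B"
  "[Stable] \<in> hnn_words B" "[Stable_inv] \<in> hnn_words B"
  by (auto simp: hnn_words_def)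

lemma hnn_words_Cons:
  "a # w \<in> hnn_words B \<longleftrightarrow> [a] \<in> hnn_words B \<and> w \<in> hnn_words B"
  by (auto simp: hnn_words_def)

locale hnn = group B for B :: "('b, 'm) monoid_scheme" (structure) +
  fixes H :: "'b set" and \<phi> :: "'b \<Rightarrow> 'b"
  assumes sub_H: "subgroup H B"
    and hom_\<phi>: "\<phi> \<in> hom (B\<lparr>carrier := H\<rparr>) B"
begin

lemma H_carrier: "h \<in> H \<Longrightarrow> h \<in> carrier B"
  by (rule subgroup.mem_carrier[OF sub_H])

lemma \<phi>_carrier: "h \<in> H \<Longrightarrow> \<phi> h \<in> carrier B"
  using hom_in_carrier[OF hom_\<phi>] by simp

lemma hnn_rel_words: "(u, v) \<in> hnn_rel B H \<phi> \<Longrightarrow> u \<in> hnn_words B \<and> v \<in> hnn_words B"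
  by (induction rule: hnn_rel.induct) (simp_all add: H_carrier \<phi>_carrier)

lemma hnn_rel_equiv: "equiv (hnn_words B) (hnn_rel B H \<phi>)"
proof (rule equivI)
  show "hnn_rel B H \<phi> \<subseteq> hnn_words B \<times> hnn_words B"
    using hnn_rel_words by auto
  show "refl_on (hnn_words B) (hnn_rel B H \<phi>)"
    by (auto intro!: refl_onI hnn_rel.refl)
  show "Relation.sym (hnn_rel B H \<phi>)" by (auto intro: symI hnn_rel.sym)
  show "Relation.trans (hnn_rel B H \<phi>)" by (auto intro: transI hnn_rel.trans)
qed

lemma hnn_class_eq: "(u, v) \<in> hnn_rel B H \<phi> \<Longrightarrow> hnn_rel B H \<phi> `` {u} = hnn_rel B H \<phi> `` {v}"
  by (rule equiv_class_eq[OF hnn_rel_equiv])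

lemma HNN_carrier_iff:
  "U \<in> carrier (HNN B H \<phi>) \<longleftrightarrow> (\<exists>u\<in>hnn_words B. U = hnn_rel B H \<phi> `` {u})"
  by (auto simp: HNN_def quotient_def)

lemma HNN_mult_class:
  assumes "u \<in> hnn_words B" "v \<in> hnn_words B"
  shows "hnn_rel B H \<phi> `` {u} \<otimes>\<^bsub>HNN B H \<phi>\<^esub> hnn_rel B H \<phi> `` {v} = hnn_rel B H \<phi> `` {u @ v}"
proof -
  have *: "hnn_rel B H \<phi> `` {u' @ v'} = hnn_rel B H \<phi> `` {u @ v}"
    if "u' \<in> hnn_rel B H \<phi> `` {u}" "v' \<in> hnn_rel B H \<phi> `` {v}" for u' v'
  proof -
    have "(u @ v, u' @ v') \<in> hnn_rel B H \<phi>"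
      using that by (intro hnn_rel.append) simp_all
    then show ?thesis by (rule hnn_class_eq[symmetric])
  qed
  have "u \<in> hnn_rel B H \<phi> `` {u}" "v \<in> hnn_rel B H \<phi> `` {v}"
    using assms by (simp_all add: hnn_rel.refl)
  then have "hnn_rel B H \<phi> `` {u} \<noteq> {}" "hnn_rel B H \<phi> `` {v} \<noteq> {}" by blast+
  then have "(\<Union>u'\<in>hnn_rel B H \<phi> `` {u}. \<Union>v'\<in>hnn_rel B H \<phi> `` {v}. hnn_rel B H \<phi> `` {u' @ v'})
      = hnn_rel B H \<phi> `` {u @ v}"
    using * by (intro SUP_eq_const) auto
  then show ?thesis unfolding HNN_def by simp
qed

lemma HNN_one: "\<one>\<^bsub>HNN B H \<phi>\<^esub> = hnn_rel B H \<phi> `` {[]}"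
  by (simp add: HNN_def)

lemma HNN_left_inverse:
  assumes "u \<in> hnn_words B"
  shows "\<exists>v\<in>hnn_words B. (v @ u, []) \<in> hnn_rel B H \<phi>"
  using assms
proof (induction u)
  case Nil
  then show ?case by (auto intro!: bexI[of _ "[]"] hnn_rel.refl)
next
  case (Cons a u)
  then have a: "[a] \<in> hnn_words B" and u: "u \<in> hnn_words B"
    using hnn_words_Cons[of a u] by blast+
  obtain v where v: "v \<in> hnn_words B" "(v @ u, []) \<in> hnn_rel B H \<phi>"
    using Cons.IH[OF u] by blast
  have "\<exists>a'. [a'] \<in> hnn_words B \<and> ([a', a], []) \<in> hnn_rel B H \<phi>"
  proof (cases a)
    case (Base b)
    with a have b: "b \<in> carrier B" by simp
    then have "([Base (inv b), Base b], [Base \<one>]) \<in> hnn_rel B H \<phi>"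
      using hnn_rel.base_mult[of "inv b" B b H \<phi>] by simp
    then have "([Base (inv b), Base b], []) \<in> hnn_rel B H \<phi>"
      using hnn_rel.base_one hnn_rel.trans by metis
    then show ?thesis using Base b by (intro exI[of _ "Base (inv b)"]) auto
  next
    case Stable
    then show ?thesis by (intro exI[of _ Stable_inv]) (simp add: hnn_rel.stable_left)
  next
    case Stable_inv
    then show ?thesis by (intro exI[of _ Stable]) (simp add: hnn_rel.stable_right)
  qed
  then obtain a' where a': "[a'] \<in> hnn_words B" "([a', a], []) \<in> hnn_rel B H \<phi>" by blast
  have "(v @ [a', a] @ u, v @ [] @ u) \<in> hnn_rel B H \<phi>"
    using u v(1) a'(2) by (intro hnn_rel.append hnn_rel.refl)
  then have "((v @ [a']) @ a # u, []) \<in> hnn_rel B H \<phi>"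
    using v(2) hnn_rel.trans by fastforce
  then show ?case
    using v(1) a'(1) by (intro bexI[of _ "v @ [a']"]) simp_all
qed

lemma HNN_group: "group (HNN B H \<phi>)"
proof (rule groupI)
  show "\<one>\<^bsub>HNN B H \<phi>\<^esub> \<in> carrier (HNN B H \<phi>)"
    unfolding HNN_carrier_iff HNN_one using hnn_words_simps(1) by blast
next
  fix x y assume "x \<in> carrier (HNN B H \<phi>)" "y \<in> carrier (HNN B H \<phi>)"
  then obtain u v where "u \<in> hnn_words B" "v \<in> hnn_words B"
    "x = hnn_rel B H \<phi> `` {u}" "y = hnn_rel B H \<phi> `` {v}"
    unfolding HNN_carrier_iff by blast
  then show "x \<otimes>\<^bsub>HNN B H \<phi>\<^esub> y \<in> carrier (HNN B H \<phi>)"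
    unfolding HNN_carrier_iff by (intro bexI[of _ "u @ v"]) (simp_all add: HNN_mult_class)
next
  fix x y z
  assume "x \<in> carrier (HNN B H \<phi>)" "y \<in> carrier (HNN B H \<phi>)" "z \<in> carrier (HNN B H \<phi>)"
  then show "x \<otimes>\<^bsub>HNN B H \<phi>\<^esub> y \<otimes>\<^bsub>HNN B H \<phi>\<^esub> z = x \<otimes>\<^bsub>HNN B H \<phi>\<^esub> (y \<otimes>\<^bsub>HNN B H \<phi>\<^esub> z)"
    unfolding HNN_carrier_iff by (auto simp: HNN_mult_class)
next
  fix x assume "x \<in> carrier (HNN B H \<phi>)"
  then obtain u where u: "u \<in> hnn_words B" "x = hnn_rel B H \<phi> `` {u}"
    unfolding HNN_carrier_iff by blast
  then show "\<one>\<^bsub>HNN B H \<phi>\<^esub> \<otimes>\<^bsub>HNN B H \<phi>\<^esub> x = x"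
    by (simp add: HNN_one HNN_mult_class)
  obtain v where v: "v \<in> hnn_words B" "(v @ u, []) \<in> hnn_rel B H \<phi>"
    using HNN_left_inverse[OF u(1)] by blast
  then have "hnn_rel B H \<phi> `` {v} \<otimes>\<^bsub>HNN B H \<phi>\<^esub> x = \<one>\<^bsub>HNN B H \<phi>\<^esub>"
    using u hnn_class_eq[OF v(2)] by (simp add: HNN_mult_class HNN_one)
  then show "\<exists>y\<in>carrier (HNN B H \<phi>). y \<otimes>\<^bsub>HNN B H \<phi>\<^esub> x = \<one>\<^bsub>HNN B H \<phi>\<^esub>"
    using v(1) HNN_carrier_iff by blast
qed

lemma hnn_base_hom: "hnn_base B H \<phi> \<in> hom B (HNN B H \<phi>)"
proof (rule homI)
  fix x assume "x \<in> carrier B"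
  then show "hnn_base B H \<phi> x \<in> carrier (HNN B H \<phi>)"
    unfolding HNN_carrier_iff hnn_base_def by (intro bexI[of _ "[Base x]"]) simp_all
next
  fix x y assume "x \<in> carrier B" "y \<in> carrier B"
  then show "hnn_base B H \<phi> (x \<otimes> y) = hnn_base B H \<phi> x \<otimes>\<^bsub>HNN B H \<phi>\<^esub> hnn_base B H \<phi> y"
    using hnn_class_eq[OF hnn_rel.base_mult] by (simp add: hnn_base_def HNN_mult_class)
qed

lemma hnn_stable_carrier: "hnn_stable B H \<phi> \<in> carrier (HNN B H \<phi>)"
  unfolding HNN_carrier_iff hnn_stable_def by (intro bexI[of _ "[Stable]"]) simp_all

lemma hnn_stable_inv: "inv\<^bsub>HNN B H \<phi>\<^esub> hnn_stable B H \<phi> = hnn_rel B H \<phi> `` {[Stable_inv]}"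
proof (rule group.inv_equality[OF HNN_group])
  show "hnn_rel B H \<phi> `` {[Stable_inv]} \<otimes>\<^bsub>HNN B H \<phi>\<^esub> hnn_stable B H \<phi> = \<one>\<^bsub>HNN B H \<phi>\<^esub>"
    using hnn_class_eq[OF hnn_rel.stable_left]
    by (simp add: hnn_stable_def HNN_mult_class HNN_one)
  show "hnn_rel B H \<phi> `` {[Stable_inv]} \<in> carrier (HNN B H \<phi>)"
    unfolding HNN_carrier_iff by (intro bexI[of _ "[Stable_inv]"]) simp_all
qed (rule hnn_stable_carrier)

lemma hnn_conj:
  assumes "h \<in> H"
  shows "inv\<^bsub>HNN B H \<phi>\<^esub> hnn_stable B H \<phi> \<otimes>\<^bsub>HNN B H \<phi>\<^esub> hnn_base B H \<phi> h
           \<otimes>\<^bsub>HNN B H \<phi>\<^esub> hnn_stable B H \<phi> = hnn_base B H \<phi> (\<phi> h)"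
proof -
  have "([Stable_inv, Base h, Stable], [Base (\<phi> h)]) \<in> hnn_rel B H \<phi>"
    using assms by (rule hnn_rel.conj)
  note eq = hnn_class_eq[OF this]
  have w: "[Stable_inv] \<in> hnn_words B" "[Base h] \<in> hnn_words B" "[Stable] \<in> hnn_words B"
    "[Stable_inv, Base h] \<in> hnn_words B"
    using H_carrier[OF assms] by simp_all
  note mult = HNN_mult_class[OF w(1,2), unfolded append.simps]
    HNN_mult_class[OF w(4,3), unfolded append.simps]
  show ?thesis
    unfolding hnn_stable_inv unfolding hnn_stable_def hnn_base_def mult
    by (rule eq)
qed

text \<open>The universal property of the presentation.\<close>

lemma HNN_universal:
  fixes G (structure)
  assumes "group G" "f \<in> hom B G" "s \<in> carrier G"
    and conj: "\<And>h. h \<in> H \<Longrightarrow> inv\<^bsub>G\<^esub> s \<otimes>\<^bsub>G\<^esub> f h \<otimes>\<^bsub>G\<^esub> s = f (\<phi> h)"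
  shows "\<exists>\<tau>\<in>hom (HNN B H \<phi>) G.
           (\<forall>b\<in>carrier B. \<tau> (hnn_base B H \<phi> b) = f b) \<and> \<tau> (hnn_stable B H \<phi>) = s"
proof -
  interpret G: group G by fact
  define g where "g = case_hnn_letter f s (inv\<^bsub>G\<^esub> s)"
  define F where "F = (\<lambda>w. foldr (\<lambda>a x. g a \<otimes>\<^bsub>G\<^esub> x) w \<one>\<^bsub>G\<^esub>)"
  have g: "g a \<in> carrier G" if "[a] \<in> hnn_words B" for a
    using that assms by (cases a) (auto simp: g_def hom_def)
  have F_carrier: "F w \<in> carrier G" if "w \<in> hnn_words B" for w
    using that
  proof (induction w)
    case Nil
    then show ?case by (simp add: F_def)
  next
    case (Cons a w)
    then have "[a] \<in> hnn_words B" "w \<in> hnn_words B"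
      using hnn_words_Cons[of a w] by blast+
    then show ?case using Cons.IH g by (simp add: F_def)
  qed
  have F_append: "F (u @ v) = F u \<otimes>\<^bsub>G\<^esub> F v" if "u \<in> hnn_words B" "v \<in> hnn_words B" for u v
    using that(1)
  proof (induction u)
    case Nil
    then show ?case using F_carrier[OF that(2)] by (simp add: F_def)
  next
    case (Cons a u)
    then have *: "[a] \<in> hnn_words B" "u \<in> hnn_words B"
      using hnn_words_Cons[of a u] by blast+
    have "F (a # u @ v) = g a \<otimes>\<^bsub>G\<^esub> (F u \<otimes>\<^bsub>G\<^esub> F v)"
      using Cons.IH[OF *(2)] by (simp add: F_def)
    also have "\<dots> = F (a # u) \<otimes>\<^bsub>G\<^esub> F v"
      using G.m_assoc g F_carrier that(2) * by (simp add: F_def)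
    finally show ?case by simp
  qed
  have f: "f x \<in> carrier G" if "x \<in> carrier B" for x
    using assms(2) that by (auto simp: hom_def)
  have F_rel: "F u = F v" if "(u, v) \<in> hnn_rel B H \<phi>" for u v
    using that
  proof (induction rule: hnn_rel.induct)
    case (append u v u' v')
    then show ?case using F_append hnn_rel_words by metis
  next
    case (base_mult x y)
    then show ?case using assms(2) f by (simp add: F_def g_def hom_def)
  next
    case base_one
    then show ?case
      using assms(2) \<open>group G\<close> is_group by (simp add: F_def g_def hom_one)
  next
    case (conj h)
    then have "inv\<^bsub>G\<^esub> s \<otimes>\<^bsub>G\<^esub> (f h \<otimes>\<^bsub>G\<^esub> s) = f (\<phi> h)"
      using assms(3) assms(4)[OF conj] f[OF H_carrier[OF conj]] by (simp add: G.m_assoc)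
    then show ?case
      using assms(3) f[OF \<phi>_carrier[OF conj]] by (simp add: F_def g_def)
  qed (use assms in \<open>simp_all add: F_def g_def\<close>)
  define \<tau> where "\<tau> = (\<lambda>U. F (SOME u. u \<in> U))"
  have \<tau>: "\<tau> (hnn_rel B H \<phi> `` {u}) = F u" if "u \<in> hnn_words B" for u
  proof -
    have "u \<in> hnn_rel B H \<phi> `` {u}" using that hnn_rel.refl by blast
    then have "(SOME v. v \<in> hnn_rel B H \<phi> `` {u}) \<in> hnn_rel B H \<phi> `` {u}"
      by (rule someI)
    then show ?thesis unfolding \<tau>_def using F_rel by fastforce
  qed
  have "\<tau> \<in> hom (HNN B H \<phi>) G"
  proof (rule homI)
    fix x assume "x \<in> carrier (HNN B H \<phi>)"
    then show "\<tau> x \<in> carrier G" using \<tau> F_carrier HNN_carrier_iff by auto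
  next
    fix x y assume "x \<in> carrier (HNN B H \<phi>)" "y \<in> carrier (HNN B H \<phi>)"
    then show "\<tau> (x \<otimes>\<^bsub>HNN B H \<phi>\<^esub> y) = \<tau> x \<otimes>\<^bsub>G\<^esub> \<tau> y"
      by (auto simp: HNN_carrier_iff HNN_mult_class \<tau> F_append)
  qed
  moreover have "\<forall>b\<in>carrier B. \<tau> (hnn_base B H \<phi> b) = f b"
    using \<tau> f by (simp add: hnn_base_def F_def g_def)
  moreover have "\<tau> (hnn_stable B H \<phi>) = s"
    using \<tau> assms(3) by (simp add: hnn_stable_def F_def g_def)
  ultimately show ?thesis by blast
qed

end

end

theory Submission
  imports Defs "HOL-Algebra.SndIsomorphismGrp"
begin

text \<open>
  Write \<open>L = H \<inter> K\<close>. A homomorphism of the HNN-extension to \<open>G\<close> is a pair \<open>(f, s)\<close> of a homomorphism \<open>f\<close> of \<open>B\<close>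
  and an element \<open>s\<close> with \<open>s\<inverse> \<cdot> f h \<cdot> s = f (\<phi> h)\<close> for \<open>h \<in> H\<close>; it extends \<open>\<sigma>\<close> if and only if \<open>f\<close> and \<open>\<sigma>\<close> have the
  same kernel.

  If such a pair exists in a group \<open>G\<close> of the class, then \<open>f\<close> is injective on \<open>H\<close> and \<open>L\<close>, and all generators of the
  groups \<open>U\<close> and \<open>V\<close> are induced by conjugations in \<open>G\<close>. So \<open>U\<close> and \<open>V\<close> embed into quotients of normalisers of
  \<open>f H\<close> and \<open>f L\<close> and belong to the class (\<open>automorphism_groups_in_class\<close>).

  For the converse all target groups come from one source. In a twisted wreath product of \<open>A\<close> by \<open>Q \<times> W\<close>,
  with \<open>A\<close>, \<open>Q\<close>, \<open>W\<close> in the class, consider a subgroup of admissible size. Its elements trivial in \<open>Q \<times> W\<close>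
  form a normal subgroup, and those which moreover have a trivial coordinate at the identity
  form a normal subgroup of the latter; the Gruenberg condition yields a quotient in the class
  that still detects these data (\<open>gruenberg_twreath\<close>). The proof has three steps of this kind.

  First, \<open>B\<close> acts on \<open>H / L\<close> in two ways, by conjugation on \<open>H\<close> and, through \<open>\<phi>\<close>, by conjugation on \<open>K\<close>. Both
  actions are controlled by \<open>U\<close>, and two copies of \<open>B\<close> can be amalgamated along \<open>H / L\<close>
  inside a group of the class (\<open>normal_amalgam\<close>). Placing the two copies in two coordinates of a
  wreath product and letting \<open>s\<close> translate one coordinate to the other gives a pair whose
  kernel is \<open>L\<close> times the kernel of \<open>\<sigma>\<close> (\<open>extend_modulo_intersection\<close>).

  Secondly, \<open>B\<close> and the stable letter act on \<open>L\<close> through \<open>V\<close>. Over the group \<open>Q\<close> obtained so far, \<open>H\<close> and \<open>K\<close>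
  give two embeddings of \<open>H\<close> into a twisted wreath product of \<open>L\<close> that agree on \<open>L\<close> and modulo the base
  group; since coinduced cocycles are coboundaries, these are conjugate, and the conjugating
  element provides the stable letter (\<open>extend_over_intersection\<close>).

  Thirdly, for the residual property, a non-trivial element is written as a reduced word, and \<open>\<sigma>\<close> is refined so that
  the word stays reduced in the image. The pair \<open>(f, s)\<close> constructed above then turns the word into a path
  without backtracking in the graph of the orbits of \<open>f B\<close> and \<open>f K\<close> on \<open>G\<close>. Wreath products define coverings of
  this graph; each of them labels a single edge and separates two visits of the path to a vertex. After finitely many
  steps no vertex is visited twice, so that the word has a non-trivial image (\<open>separate_reduced_word\<close>).
\<close>

section \<open>Classes of groups and the Gruenberg condition\<close>

lemma hom_image_FactGroup:
  assumes "group G" "group G'" "h \<in> hom G G'"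
  shows "G Mod (kernel G G' h) \<cong> G'\<lparr>carrier := h ` carrier G\<rparr>"
proof -
  interpret group_hom G G' h using assms by (simp add: group_hom_def group_hom_axioms_def)
  have img: "subgroup (h ` carrier G) G'" by (rule img_is_subgroup)
  interpret I: group_hom G "G'\<lparr>carrier := h ` carrier G\<rparr>" h
    using assms subgroup.subgroup_is_group[OF img assms(2)]
    by (auto simp: group_hom_def group_hom_axioms_def hom_def)
  have "kernel G (G'\<lparr>carrier := h ` carrier G\<rparr>) h = kernel G G' h" by (simp add: kernel_def)
  then show ?thesis using I.FactGroup_iso_set by (auto simp: is_iso_def)
qed

lemma in_class_group: "in_class G \<C> \<Longrightarrow> group G"
  by (simp add: in_class_def)

lemma in_class_iso:
  assumes "in_class G \<C>" "group G'" "G \<cong> G'"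
  shows "in_class G' \<C>"
proof -
  interpret group G using assms in_class_group by blast
  show ?thesis using assms iso_sym[OF assms(3)] iso_trans unfolding in_class_def by blast
qed

lemma in_class_member: "group_class \<C> \<Longrightarrow> G \<in> \<C> \<Longrightarrow> in_class G \<C>"
  unfolding in_class_def group_class_def is_iso_def using iso_set_refl by blast

text \<open>
  The Gruenberg condition is available for groups whose carrier fits into the universe of the class.
  It will be applied to generated subgroups of groups that may be larger, and this lemma bounds them:
  the products of at most \<open>2\<^sup>n\<close> generators and inverses of generators fit for each \<open>n\<close>,
  and a countable union of such sets still fits.
\<close>

lemma generate_lepoll:
  fixes G (structure)
  assumes inf: "infinite (UNIV :: 'u set)" and "group G" "S \<subseteq> carrier G" "S \<lesssim> (UNIV :: 'u set)"
  shows "generate G S \<lesssim> (UNIV :: 'u set)"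
proof -
  interpret group G by fact
  let ?U = "UNIV :: 'u set"
  have sq: "?U \<times> ?U \<lesssim> ?U"
    using card_of_Times_same_infinite[OF inf] unfolding eqpoll_iff_card_of_ordIso[symmetric]
    by (rule eqpoll_imp_lepoll)
  have nat: "(UNIV :: nat set) \<lesssim> ?U" using inf infinite_le_lepoll by blast
  have Times: "P \<times> R \<lesssim> ?U" if "P \<lesssim> ?U" "R \<lesssim> ?U" for P :: "'c set" and R :: "'d set"
    by (rule lepoll_trans[OF times_lepoll_mono[OF that] sq])
  define st where "st = rec_nat (insert \<one> (S \<union> m_inv G ` S)) (\<lambda>_ T. (\<lambda>(x,y). x \<otimes> y) ` (T \<times> T))"
  have st0: "st 0 = insert \<one> (S \<union> m_inv G ` S)"
    and stS: "st (Suc n) = (\<lambda>(x,y). x \<otimes> y) ` (st n \<times> st n)" for n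
    by (simp_all add: st_def)
  have "st n \<lesssim> ?U" for n
  proof (induction n)
    case 0
    have "st 0 \<subseteq> (\<lambda>(b,x). case b of 0 \<Rightarrow> x | Suc 0 \<Rightarrow> inv x | _ \<Rightarrow> \<one>) ` ({..<3::nat} \<times> insert \<one> S)"
    proof
      fix y assume "y \<in> st 0"
      then consider "y = \<one>" | "y \<in> S" | x where "x \<in> S" "y = inv x" unfolding st0 by blast
      then show "y \<in> (\<lambda>(b,x). case b of 0 \<Rightarrow> x | Suc 0 \<Rightarrow> inv x | _ \<Rightarrow> \<one>) ` ({..<3::nat} \<times> insert \<one> S)"
      proof cases
        case 1 then show ?thesis by (auto intro!: image_eqI[of _ _ "(0, \<one>)"])
      next
        case 2 then show ?thesis by (auto intro!: image_eqI[of _ _ "(0, y)"])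
      next
        case (3 x) then show ?thesis by (auto intro!: image_eqI[of _ _ "(1, x)"])
      qed
    qed
    moreover have "insert \<one> S \<lesssim> ?U"
    proof (cases "finite S")
      case True
      then show ?thesis using inf by (simp add: finite_lepoll_infinite)
    next
      case False
      then show ?thesis by (rule lepoll_trans[OF infinite_insert_lepoll assms(4)])
    qed
    moreover have "{..<3::nat} \<lesssim> ?U" by (rule lepoll_trans[OF subset_imp_lepoll nat]) simp
    ultimately show ?case by (rule lepoll_trans[OF subset_image_lepoll Times[rotated 1]])
  next
    case (Suc n)
    show ?case unfolding stS by (rule lepoll_trans[OF image_lepoll Times[OF Suc Suc]])
  qed
  then have "\<forall>n. \<exists>g. st n \<subseteq> g ` ?U" unfolding lepoll_iff by blast
  then obtain g where g: "\<And>n. st n \<subseteq> g n ` ?U" by metis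
  have one_st: "\<one> \<in> st n" for n 
  proof (induction n)
    case (Suc n)
    show ?case unfolding stS using Suc.IH by (auto intro!: image_eqI[of _ _ "(\<one>, \<one>)"])
  qed (simp add: st0)
  have car: "st n \<subseteq> carrier G" for n
    by (induction n) (use assms(3) in \<open>auto simp: st0 stS\<close>)
  have suc: "st n \<subseteq> st (Suc n)" for n
  proof
    fix x assume x: "x \<in> st n"
    then have "x \<in> carrier G" using car by blast
    then show "x \<in> st (Suc n)"
      unfolding stS using one_st[of n] x by (auto intro!: image_eqI[of _ _ "(\<one>, x)"])
  qed
  have mono: "st n \<subseteq> st m" if "n \<le> m" for n m
    using suc that by (rule lift_Suc_mono_le[of st])
  have "generate G S \<subseteq> (\<Union>n. st n)"
  proof
    fix x assume "x \<in> generate G S"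
    then show "x \<in> (\<Union>n. st n)"
    proof induction
      case one then show ?case using one_st by auto
    next
      case (incl h) then show ?case by (intro UN_I[of 0]) (simp_all add: st0)
    next
      case (inv h) then show ?case by (intro UN_I[of 0]) (simp_all add: st0)
    next
      case (eng h1 h2)
      then obtain n m where nm: "h1 \<in> st n" "h2 \<in> st m" by blast
      then have "h1 \<in> st (max n m)" "h2 \<in> st (max n m)" using mono[of n "max n m"] mono[of m "max n m"]
        by auto
      then have "h1 \<otimes> h2 \<in> st (Suc (max n m))" unfolding stS
        by (auto intro!: image_eqI[of _ _ "(h1, h2)"])
      then show ?case by blast
    qed
  qed
  also have "\<dots> \<subseteq> (\<lambda>(n,u). g n u) ` (UNIV \<times> ?U)" using g by fast
  finally show ?thesis by (rule lepoll_trans[OF subset_image_lepoll Times[OF nat lepoll_refl]])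
qed

locale quotient_closed_root_class =
  fixes \<C> :: "'u monoid set"
  assumes inf: "infinite (UNIV :: 'u set)" and root: "root_class \<C>" and quot: "quotient_closed \<C>"
begin

lemma iso_closed: "group_class \<C>" using root by (simp add: root_class_def)

lemma in_class_rep:
  assumes "in_class G \<C>"
  obtains G' j where "G' \<in> \<C>" "group G'" "j \<in> iso G G'"
  using assms iso_closed unfolding in_class_def group_class_def is_iso_def by blast

lemma in_class_small:
  assumes "in_class G \<C>"
  shows "carrier G \<lesssim> (UNIV :: 'u set)"
proof -
  obtain G' j where "j \<in> iso G G'" "G' \<in> \<C>" using in_class_rep[OF assms] by metis
  then have "inj_on j (carrier G)" by (simp add: iso_iff)
  then show ?thesis unfolding lepoll_def by blast
qed

lemma in_class_image:
  assumes "in_class G \<C>" "group G'" "h \<in> hom G G'"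
  shows "in_class (G'\<lparr>carrier := h ` carrier G\<rparr>) \<C>"
proof -
  interpret G: group G using assms in_class_group by blast
  obtain G0 j where G0: "G0 \<in> \<C>" "group G0" "j \<in> iso G G0" using in_class_rep[OF assms(1)] .
  interpret G0: group G0 by fact
  define k where "k = inv_into (carrier G) j"
  have k: "k \<in> iso G0 G" using G.iso_set_sym[OF G0(3)] unfolding k_def .
  then have kh: "h \<circ> k \<in> hom G0 G'" using assms(3) hom_compose iso_imp_homomorphism by blast
  interpret K: group_hom G0 G' "h \<circ> k"
    using kh assms(2) G0(2) by (simp add: group_hom_def group_hom_axioms_def)
  have "in_class (G0 Mod kernel G0 G' (h \<circ> k)) \<C>"
    using quot G0(1) K.normal_kernel unfolding quotient_closed_def by blast
  moreover have "(h \<circ> k) ` carrier G0 = h ` carrier G"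
    using k by (simp only: image_comp[symmetric] iso_iff)
  moreover have "group (G'\<lparr>carrier := h ` carrier G\<rparr>)"
    using subgroup.subgroup_is_group[OF K.img_is_subgroup assms(2)] calculation(2) by simp
  ultimately show ?thesis
    using in_class_iso hom_image_FactGroup[OF G0(2) assms(2) kh] by metis
qed

lemma in_class_mono:
  assumes "in_class G' \<C>" "group G" "h \<in> hom G G'" "inj_on h (carrier G)"
  shows "in_class G \<C>"
proof -
  obtain G0 j where G0: "G0 \<in> \<C>" "group G0" "j \<in> iso G' G0" using in_class_rep[OF assms(1)] .
  have j: "j \<in> hom G' G0" "inj_on j (carrier G')" using G0(3) by (auto simp: iso_def bij_betw_def)
  have jh: "j \<circ> h \<in> hom G G0" using hom_compose[OF assms(3) j(1)] .
  interpret J: group_hom G G0 "j \<circ> h"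
    using jh assms G0(2) by (simp add: group_hom_def group_hom_axioms_def)
  have inj: "inj_on (j \<circ> h) (carrier G)"
    using assms(3,4) j(2) by (intro comp_inj_on) (auto intro: inj_on_subset simp: hom_def)
  define G1 where "G1 = G0\<lparr>carrier := (j \<circ> h) ` carrier G\<rparr>"
  have "G1 \<in> \<C>"
    using root G0(1) J.img_is_subgroup unfolding root_class_def subgroup_closed_def G1_def by blast
  moreover have "(j \<circ> h) \<in> iso G G1"
    using inj jh unfolding G1_def iso_def by (auto simp: bij_betw_def hom_def)
  ultimately show ?thesis using assms(2) unfolding in_class_def is_iso_def by blast
qed

lemma in_class_subgroup:
  assumes "in_class G \<C>" "subgroup S G"
  shows "in_class (G\<lparr>carrier := S\<rparr>) \<C>"
proof -
  interpret group G using assms in_class_group by blast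
  show ?thesis
    using assms(2) subgroup.subgroup_is_group[OF assms(2) is_group] subgroup.mem_carrier[OF assms(2)]
    by (intro in_class_mono[OF assms(1), of _ "\<lambda>x. x"]) (auto simp: hom_def)
qed

text \<open>
  The defining condition of a root class, freed from the universe type and from quotient groups.
  The kernel of \<open>r\<close> and the kernel of \<open>\<psi>\<close> inside it form a subnormal series whose factors embed into
  \<open>R\<close> and \<open>D\<close>; the point is that \<open>\<psi>\<close>, although defined on a subgroup only, is still
  controlled by a homomorphism of the whole group onto a member of the class.
\<close>

theorem gruenberg:
  fixes X :: "('x, 'm) monoid_scheme"
  assumes "group X" and card: "carrier X \<lesssim> (UNIV :: 'u set)"
    and r: "r \<in> hom X R" "in_class R \<C>"
    and \<psi>: "\<psi> \<in> hom (X\<lparr>carrier := kernel X R r\<rparr>) D" "in_class D \<C>"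
  shows "\<exists>G\<in>\<C>. \<exists>\<tau>\<in>epi X G. \<forall>x\<in>carrier X. \<tau> x = \<one>\<^bsub>G\<^esub> \<longrightarrow> r x = \<one>\<^bsub>R\<^esub> \<and> \<psi> x = \<one>\<^bsub>D\<^esub>"
proof -
  interpret X: group X by fact
  have R: "group R" and D: "group D" using r \<psi> in_class_group by blast+
  \<comment> \<open>A copy of the group with carrier in the universe type.\<close>
  obtain \<iota> :: "'x \<Rightarrow> 'u" where \<iota>: "inj_on \<iota> (carrier X)" using card
    unfolding lepoll_def by blast
  define k where "k = inv_into (carrier X) \<iota>"
  have k\<iota>: "k (\<iota> x) = x" if "x \<in> carrier X" for x using \<iota> that by (simp add: k_def)
  define X' :: "'u monoid" where
    "X' = \<lparr>carrier = \<iota> ` carrier X, mult = (\<lambda>a b. \<iota> (k a \<otimes>\<^bsub>X\<^esub> k b)), one = \<iota> \<one>\<^bsub>X\<^esub>\<rparr>"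
  have \<iota>iso: "\<iota> \<in> iso X X'"
    using \<iota> k\<iota> by (auto simp: iso_def hom_def X'_def bij_betw_def)
  have X': "group X'"
    using X.iso_imp_img_group[OF \<iota>iso] by (simp add: X'_def)
  interpret X': group X' by fact
  have kiso: "k \<in> iso X' X" using X.iso_set_sym[OF \<iota>iso] by (simp add: k_def)
  have kh: "k \<in> hom X' X" using kiso iso_imp_homomorphism by blast
  define r' where "r' = r \<circ> k"
  have r'h: "r' \<in> hom X' R" unfolding r'_def using kh r(1) hom_compose by blast
  define Y where "Y = kernel X' R r'"
  interpret r': group_hom X' R r' using r'h R X' by (simp add: group_hom_def group_hom_axioms_def)
  have Y: "Y \<lhd> X'" unfolding Y_def by (rule r'.normal_kernel)
  have XY: "in_class (X' Mod Y) \<C>"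
    using in_class_iso[OF in_class_subgroup[OF r(2) r'.img_is_subgroup]] 
      hom_image_FactGroup[OF X' R r'h] normal.factorgroup_is_group[OF Y]
      group.iso_sym[OF normal.factorgroup_is_group[OF Y]] unfolding Y_def by blast
  define X'Y where "X'Y = X'\<lparr>carrier := Y\<rparr>"
  have X'Y: "group X'Y" unfolding X'Y_def
    using Y normal_imp_subgroup subgroup.subgroup_is_group X' by blast
  define \<psi>' where "\<psi>' = \<psi> \<circ> k"
  have kY: "k \<in> hom X'Y (X\<lparr>carrier := kernel X R r\<rparr>)"
    using kh unfolding X'Y_def Y_def by (auto simp: hom_def kernel_def r'_def)
  have \<psi>'h: "\<psi>' \<in> hom X'Y D" unfolding \<psi>'_def using hom_compose[OF kY \<psi>(1)] .
  interpret \<psi>': group_hom X'Y D \<psi>' using \<psi>'h D X'Y by (simp add: group_hom_def group_hom_axioms_def)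
  define Z where "Z = kernel X'Y D \<psi>'"
  have Z: "Z \<lhd> X'Y" unfolding Z_def by (rule \<psi>'.normal_kernel)
  have YZ: "in_class (X'Y Mod Z) \<C>"
    using in_class_iso[OF in_class_subgroup[OF \<psi>(2) \<psi>'.img_is_subgroup]] 
      hom_image_FactGroup[OF X'Y D \<psi>'h] normal.factorgroup_is_group[OF Z]
      group.iso_sym[OF normal.factorgroup_is_group[OF Z]] unfolding Z_def by blast
  obtain T where T: "T \<lhd> X'" "T \<subseteq> Z" "in_class (X' Mod T) \<C>"
    using root X' Y Z XY YZ unfolding root_class_def X'Y_def by blast
  obtain G j where G: "G \<in> \<C>" "group G" "j \<in> iso (X' Mod T) G" using in_class_rep[OF T(3)] .
  interpret T: normal T X' by (rule T(1))
  have p: "(#>\<^bsub>X'\<^esub>) T \<in> epi X' (X' Mod T)"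
    using T.r_coset_hom_Mod by (auto simp: epi_def carrier_FactGroup)
  have "j \<circ> ((#>\<^bsub>X'\<^esub>) T \<circ> \<iota>) \<in> epi X G"
    using epi_compose[OF epi_compose[OF _ p, of \<iota> X], of j G] \<iota>iso G(3)
    by (auto simp: iso_iff_mon_epi comp_assoc)
  moreover have "r x = \<one>\<^bsub>R\<^esub> \<and> \<psi> x = \<one>\<^bsub>D\<^esub>"
    if x: "x \<in> carrier X" and e: "(j \<circ> ((#>\<^bsub>X'\<^esub>) T \<circ> \<iota>)) x = \<one>\<^bsub>G\<^esub>" for x
  proof -
    have \<iota>x: "\<iota> x \<in> carrier X'" using x by (simp add: X'_def)
    have c: "T #>\<^bsub>X'\<^esub> \<iota> x \<in> carrier (X' Mod T)" using \<iota>x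
      by (auto simp: carrier_FactGroup)
    have "j (\<one>\<^bsub>X' Mod T\<^esub>) = \<one>\<^bsub>G\<^esub>"
      using hom_one[OF iso_imp_homomorphism[OF G(3)] T.factorgroup_is_group G(2)] .
    then have "T #>\<^bsub>X'\<^esub> \<iota> x = \<one>\<^bsub>X' Mod T\<^esub>"
      using e inj_onD[of j "carrier (X' Mod T)", OF _ _ c monoid.one_closed[OF group.is_monoid[OF T.factorgroup_is_group]]] G(3)
      by (simp add: iso_iff)
    then have "T #>\<^bsub>X'\<^esub> \<iota> x = T" by simp
    then have "\<iota> x \<in> Z" using X'.coset_join1[OF _ \<iota>x T.subgroup_axioms] T(2) T.subset by blast
    then show ?thesis using x k\<iota> by (simp add: Z_def kernel_def X'Y_def Y_def r'_def \<psi>'_def)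
  qed
  ultimately show ?thesis using G(1) by blast
qed

text \<open>Closure under direct products is the special case of the two projections.\<close>

lemma in_class_DirProd:
  assumes "in_class P \<C>" "in_class Q \<C>"
  shows "in_class (P \<times>\<times> Q) \<C>"
proof -
  have P: "group P" and Q: "group Q" using assms in_class_group by blast+
  interpret P: group P by fact
  interpret Q: group Q by fact
  have g: "group (P \<times>\<times> Q)" using P Q DirProd_group by blast
  have "carrier (P \<times>\<times> Q) \<lesssim> (UNIV :: 'u set)"
    using times_lepoll_mono[OF in_class_small[OF assms(1)] in_class_small[OF assms(2)]]
      card_of_Times_same_infinite[OF inf] unfolding eqpoll_iff_card_of_ordIso[symmetric]
    by (simp add: lepoll_trans2)
  moreover have "fst \<in> hom (P \<times>\<times> Q) P"
    "snd \<in> hom ((P \<times>\<times> Q)\<lparr>carrier := kernel (P \<times>\<times> Q) P fst\<rparr>) Q"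
    by (auto simp: hom_def kernel_def)
  ultimately obtain G \<tau> where G: "G \<in> \<C>" and \<tau>: "\<tau> \<in> epi (P \<times>\<times> Q) G"
    and *: "\<forall>x\<in>carrier (P \<times>\<times> Q). \<tau> x = \<one>\<^bsub>G\<^esub> \<longrightarrow> fst x = \<one>\<^bsub>P\<^esub> \<and> snd x = \<one>\<^bsub>Q\<^esub>"
    using gruenberg[OF g, of fst P snd Q] assms by metis
  have "group G" using G iso_closed by (auto simp: group_class_def)
  then have "inj_on \<tau> (carrier (P \<times>\<times> Q))"
    using g \<tau> * by (subst inj_on_one_iff') (auto simp: epi_def)
  then show ?thesis
    using in_class_mono[OF in_class_member[OF iso_closed G] g] \<tau> by (auto simp: epi_def)
qed

end

section \<open>Twisted wreath products\<close>

lemma auto_D: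
  assumes "w \<in> carrier (AutoGroup A)"
  shows "w \<in> hom A A" "w \<in> extensional (carrier A)" "bij_betw w (carrier A) (carrier A)"
  using assms by (auto simp: AutoGroup_def auto_def Bij_def)

lemma AutoGroup_mult:
  "w \<in> carrier (AutoGroup A) \<Longrightarrow> w' \<in> carrier (AutoGroup A) \<Longrightarrow>
     w \<otimes>\<^bsub>AutoGroup A\<^esub> w' = compose (carrier A) w w'"
  by (simp add: AutoGroup_def auto_def BijGroup_def)

lemma AutoGroup_one: "\<one>\<^bsub>AutoGroup A\<^esub> = (\<lambda>a\<in>carrier A. a)"
  by (simp add: AutoGroup_def BijGroup_def)

lemma AutoGroup_eqI:
  assumes "w \<in> carrier (AutoGroup A)" "w' \<in> carrier (AutoGroup A)"
    "\<And>a. a \<in> carrier A \<Longrightarrow> w a = w' a"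
  shows "w = w'"
  using assms auto_D(2) extensionalityI by metis

text \<open>
  The twisted wreath product of \<open>A\<close> by \<open>Q \<times> W\<close>, where \<open>Q\<close> permutes the coordinates and \<open>W\<close> is a group
  of automorphisms of \<open>A\<close>. The triple \<open>(u, q, w)\<close> stands for the permutation
  \<open>(a, y) \<mapsto> (w a \<cdot> u y, q \<cdot> y)\<close> of \<open>A \<times> Q\<close>, and the product is composition from right to left.
  Through the twist by \<open>W\<close>, left multiplication by \<open>n \<in> A\<close> is the triple
  \<open>(constant n, 1, conjugation by n)\<close>, so that \<open>A\<close> itself sits inside as one and the same subgroup
  for all the embeddings constructed below.
\<close>

definition twreath ::
    "('a, 'm) monoid_scheme \<Rightarrow> ('q, 'n) monoid_scheme \<Rightarrow> ('a \<Rightarrow> 'a) set \<Rightarrow>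
       (('q \<Rightarrow> 'a) \<times> 'q \<times> ('a \<Rightarrow> 'a)) monoid" where
  "twreath A Q W =
     \<lparr>carrier = (carrier Q \<rightarrow>\<^sub>E carrier A) \<times> carrier Q \<times> W,
      mult = (\<lambda>(u, q, w) (v, q', w').
        (\<lambda>y\<in>carrier Q. w (v y) \<otimes>\<^bsub>A\<^esub> u (q' \<otimes>\<^bsub>Q\<^esub> y), q \<otimes>\<^bsub>Q\<^esub> q', w \<otimes>\<^bsub>AutoGroup A\<^esub> w')),
      one = (\<lambda>y\<in>carrier Q. \<one>\<^bsub>A\<^esub>, \<one>\<^bsub>Q\<^esub>, \<one>\<^bsub>AutoGroup A\<^esub>)\<rparr>"

lemma carrier_twreath: "carrier (twreath A Q W) = (carrier Q \<rightarrow>\<^sub>E carrier A) \<times> carrier Q \<times> W"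
  by (simp add: twreath_def)

lemma mult_twreath:
  "(u, q, w) \<otimes>\<^bsub>twreath A Q W\<^esub> (v, q', w') =
     (\<lambda>y\<in>carrier Q. w (v y) \<otimes>\<^bsub>A\<^esub> u (q' \<otimes>\<^bsub>Q\<^esub> y), q \<otimes>\<^bsub>Q\<^esub> q', w \<otimes>\<^bsub>AutoGroup A\<^esub> w')"
  by (simp add: twreath_def)

lemma one_twreath: "\<one>\<^bsub>twreath A Q W\<^esub> = (\<lambda>y\<in>carrier Q. \<one>\<^bsub>A\<^esub>, \<one>\<^bsub>Q\<^esub>, \<one>\<^bsub>AutoGroup A\<^esub>)"
  by (simp add: twreath_def)

locale twisted_wreath = A: group A + Q: group Q
  for A :: "('a, 'm) monoid_scheme" and Q :: "('q, 'n) monoid_scheme" +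
  fixes W :: "('a \<Rightarrow> 'a) set"
  assumes W: "subgroup W (AutoGroup A)"
begin

abbreviation "T \<equiv> twreath A Q W"

lemma W_auto: "w \<in> W \<Longrightarrow> w \<in> carrier (AutoGroup A)"
  using W subgroup.subset by blast

lemma W_hom [simp]:
  assumes "w \<in> W"
  shows "a \<in> carrier A \<Longrightarrow> w a \<in> carrier A"
    and "a \<in> carrier A \<Longrightarrow> b \<in> carrier A \<Longrightarrow> w (a \<otimes>\<^bsub>A\<^esub> b) = w a \<otimes>\<^bsub>A\<^esub> w b"
    and "w \<one>\<^bsub>A\<^esub> = \<one>\<^bsub>A\<^esub>"
    and "a \<in> carrier A \<Longrightarrow> w (inv\<^bsub>A\<^esub> a) = inv\<^bsub>A\<^esub> (w a)"
proof -
  have w: "w \<in> hom A A" using auto_D(1) W_auto assms by blast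
  then interpret group_hom A A w by (simp add: group_hom_def group_hom_axioms_def A.is_group)
  show "a \<in> carrier A \<Longrightarrow> w a \<in> carrier A" by simp
  show "a \<in> carrier A \<Longrightarrow> b \<in> carrier A \<Longrightarrow> w (a \<otimes>\<^bsub>A\<^esub> b) = w a \<otimes>\<^bsub>A\<^esub> w b" by simp
  show "w \<one>\<^bsub>A\<^esub> = \<one>\<^bsub>A\<^esub>" by simp
  show "a \<in> carrier A \<Longrightarrow> w (inv\<^bsub>A\<^esub> a) = inv\<^bsub>A\<^esub> (w a)" by simp
qed

lemma W_mult [simp]:
  "w \<in> W \<Longrightarrow> w' \<in> W \<Longrightarrow> a \<in> carrier A \<Longrightarrow> (w \<otimes>\<^bsub>AutoGroup A\<^esub> w') a = w (w' a)"
  by (simp add: AutoGroup_mult W_auto compose_def)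

lemma W_closed [simp]:
  "w \<in> W \<Longrightarrow> w' \<in> W \<Longrightarrow> w \<otimes>\<^bsub>AutoGroup A\<^esub> w' \<in> W"
  "\<one>\<^bsub>AutoGroup A\<^esub> \<in> W"
  "w \<in> W \<Longrightarrow> inv\<^bsub>AutoGroup A\<^esub> w \<in> W"
  using W subgroup.m_closed subgroup.one_closed subgroup.m_inv_closed by metis+

lemma W_one [simp]: "a \<in> carrier A \<Longrightarrow> \<one>\<^bsub>AutoGroup A\<^esub> a = a"
  by (simp add: AutoGroup_one)

lemma PiE_A [simp]: "u \<in> carrier Q \<rightarrow>\<^sub>E carrier A \<Longrightarrow> y \<in> carrier Q \<Longrightarrow> u y \<in> carrier A"
  by auto

sublocale Aut: group "AutoGroup A" by (rule A.AutoGroup)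

sublocale T: group T
proof (rule groupI)
  fix x y assume "x \<in> carrier T" "y \<in> carrier T"
  then show "x \<otimes>\<^bsub>T\<^esub> y \<in> carrier T"
    by (cases x; cases y) (auto simp: carrier_twreath mult_twreath)
next
  show "\<one>\<^bsub>T\<^esub> \<in> carrier T" by (auto simp: carrier_twreath one_twreath)
next
  fix x y z assume "x \<in> carrier T" "y \<in> carrier T" "z \<in> carrier T"
  then show "x \<otimes>\<^bsub>T\<^esub> y \<otimes>\<^bsub>T\<^esub> z = x \<otimes>\<^bsub>T\<^esub> (y \<otimes>\<^bsub>T\<^esub> z)"
    by (cases x; cases y; cases z)
      (auto simp: carrier_twreath mult_twreath A.m_assoc Q.m_assoc Aut.m_assoc W_auto intro!: restrict_ext)
next
  fix x assume "x \<in> carrier T"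
  then obtain u q w where x: "x = (u, q, w)" "u \<in> carrier Q \<rightarrow>\<^sub>E carrier A" "q \<in> carrier Q"
    "w \<in> W"
    by (cases x) (auto simp: carrier_twreath)
  show "\<one>\<^bsub>T\<^esub> \<otimes>\<^bsub>T\<^esub> x = x"
  proof -
    have "(\<lambda>y\<in>carrier Q. \<one>\<^bsub>AutoGroup A\<^esub> (u y) \<otimes>\<^bsub>A\<^esub> (\<lambda>y\<in>carrier Q. \<one>\<^bsub>A\<^esub>) (q \<otimes>\<^bsub>Q\<^esub> y)) = u"
      using x by (intro extensionalityI[of _ "carrier Q"]) (auto simp: PiE_def)
    then show ?thesis using x by (simp add: one_twreath mult_twreath W_auto)
  qed
  define iw where "iw = inv\<^bsub>AutoGroup A\<^esub> w"
  have iw: "iw \<in> W" "iw \<otimes>\<^bsub>AutoGroup A\<^esub> w = \<one>\<^bsub>AutoGroup A\<^esub>"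
    using x by (simp_all add: iw_def W_auto)
  define v where "v = (\<lambda>y\<in>carrier Q. inv\<^bsub>A\<^esub> (iw (u (inv\<^bsub>Q\<^esub> q \<otimes>\<^bsub>Q\<^esub> y))))"
  have v: "v \<in> carrier Q \<rightarrow>\<^sub>E carrier A" using x iw by (auto simp: v_def)
  have qq: "inv\<^bsub>Q\<^esub> q \<otimes>\<^bsub>Q\<^esub> (q \<otimes>\<^bsub>Q\<^esub> y) = y"
    if "y \<in> carrier Q" for y
    using that x by (simp add: Q.m_assoc[symmetric])
  have "(v, inv\<^bsub>Q\<^esub> q, iw) \<otimes>\<^bsub>T\<^esub> x = \<one>\<^bsub>T\<^esub>"
    using x iw by (auto simp: mult_twreath one_twreath v_def qq intro!: restrict_ext)
  then show "\<exists>y\<in>carrier T. y \<otimes>\<^bsub>T\<^esub> x = \<one>\<^bsub>T\<^esub>"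
    using v iw x by (intro bexI[of _ "(v, inv\<^bsub>Q\<^esub> q, iw)"]) (auto simp: carrier_twreath)
qed

end

context quotient_closed_root_class begin

text \<open>
  In the kernel of the projection to \<open>Q \<times> W\<close> multiplication is coordinatewise and reversed, so
  \<open>u \<mapsto> (u 1)\<inverse>\<close> is a homomorphism into \<open>A\<close>, and the Gruenberg condition applies to every subgroup
  of admissible size. The full twisted wreath product is in general too large for the universe, and
  the passage to a generated subgroup is what makes the argument possible.
  The quotient obtained still determines \<open>q\<close>, \<open>w\<close> and the coordinate of \<open>u\<close> at the identity.
\<close>

lemma gruenberg_twreath:
  fixes A :: "('a, 'm) monoid_scheme" and Q :: "('q, 'n) monoid_scheme"
  assumes A: "in_class A \<C>" and Q: "in_class Q \<C>"
    and WC: "subgroup W (AutoGroup A)" "in_class ((AutoGroup A)\<lparr>carrier := W\<rparr>) \<C>"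
    and S: "S \<subseteq> carrier (twreath A Q W)" "S \<lesssim> (UNIV :: 'u set)"
  shows "\<exists>G\<in>\<C>. \<exists>\<tau>\<in>hom ((twreath A Q W)\<lparr>carrier := generate (twreath A Q W) S\<rparr>) G.
     \<forall>x\<in>generate (twreath A Q W) S. \<forall>y\<in>generate (twreath A Q W) S.
        \<tau> x = \<tau> y \<longrightarrow> snd x = snd y \<and> fst x \<one>\<^bsub>Q\<^esub> = fst y \<one>\<^bsub>Q\<^esub>"
proof -
  interpret twisted_wreath A Q W
    using in_class_group[OF A] in_class_group[OF Q] WC(1)
    by (simp add: twisted_wreath_def twisted_wreath_axioms_def)
  define X where "X = T\<lparr>carrier := generate T S\<rparr>"
  have sub: "subgroup (generate T S) T" using T.generate_is_subgroup S(1) by blast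
  interpret X: group X unfolding X_def using sub T.is_group by (rule subgroup.subgroup_is_group)
  have carX: "carrier X = generate T S" and multX: "x \<otimes>\<^bsub>X\<^esub> y = x \<otimes>\<^bsub>T\<^esub> y"
    and oneX: "\<one>\<^bsub>X\<^esub> = \<one>\<^bsub>T\<^esub>" for x y
    by (simp_all add: X_def)
  have XT: "x \<in> carrier T" if "x \<in> carrier X" for x
    using that sub subgroup.mem_carrier carX by metis
  define R where "R = Q \<times>\<times> ((AutoGroup A)\<lparr>carrier := W\<rparr>)"
  have R: "in_class R \<C>" unfolding R_def using in_class_DirProd Q WC(2) by blast
  have r: "snd \<in> hom X R"
    using XT by (force simp: hom_def R_def multX carrier_twreath mult_twreath)
  define \<psi> where "\<psi> = (\<lambda>x :: ('q \<Rightarrow> 'a) \<times> 'q \<times> ('a \<Rightarrow> 'a). inv\<^bsub>A\<^esub> (fst x \<one>\<^bsub>Q\<^esub>))"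
  have \<psi>: "\<psi> \<in> hom (X\<lparr>carrier := kernel X R snd\<rparr>) A"
  proof (rule homI)
    fix x assume "x \<in> carrier (X\<lparr>carrier := kernel X R snd\<rparr>)"
    then show "\<psi> x \<in> carrier A" using XT[of x] by (auto simp: \<psi>_def kernel_def carrier_twreath)
  next
    fix x y assume xy: "x \<in> carrier (X\<lparr>carrier := kernel X R snd\<rparr>)"
    "y \<in> carrier (X\<lparr>carrier := kernel X R snd\<rparr>)"
    then obtain u v where "x = (u, \<one>\<^bsub>Q\<^esub>, \<one>\<^bsub>AutoGroup A\<^esub>)"
      "y = (v, \<one>\<^bsub>Q\<^esub>, \<one>\<^bsub>AutoGroup A\<^esub>)"
      "u \<in> carrier Q \<rightarrow>\<^sub>E carrier A" "v \<in> carrier Q \<rightarrow>\<^sub>E carrier A"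
      using XT[of x] XT[of y] by (cases x; cases y) (auto simp: kernel_def carrier_twreath R_def)
    then show "\<psi> (x \<otimes>\<^bsub>X\<lparr>carrier := kernel X R snd\<rparr>\<^esub> y) = \<psi> x \<otimes>\<^bsub>A\<^esub> \<psi> y"
      by (simp add: \<psi>_def multX mult_twreath A.inv_mult_group)
  qed
  have "carrier X \<lesssim> (UNIV :: 'u set)"
    unfolding carX using generate_lepoll[OF inf T.is_group S] .
  then obtain G \<tau> where G: "G \<in> \<C>" and \<tau>: "\<tau> \<in> epi X G"
    and *: "\<forall>x\<in>carrier X. \<tau> x = \<one>\<^bsub>G\<^esub> \<longrightarrow> snd x = \<one>\<^bsub>R\<^esub> \<and> \<psi> x = \<one>\<^bsub>A\<^esub>"
    using gruenberg[OF X.is_group _ r R \<psi> A] by blast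
  have \<tau>h: "\<tau> \<in> hom X G" using \<tau> by (simp add: epi_def)
  interpret \<tau>: group_hom X G \<tau>
    using \<tau>h G iso_closed by (auto simp: group_hom_def group_hom_axioms_def group_class_def)
  have "snd x = snd y \<and> fst x \<one>\<^bsub>Q\<^esub> = fst y \<one>\<^bsub>Q\<^esub>"
    if x: "x \<in> carrier X" and y: "y \<in> carrier X" and e: "\<tau> x = \<tau> y" for x y
  proof -
    define m where "m = inv\<^bsub>X\<^esub> y \<otimes>\<^bsub>X\<^esub> x"
    have m: "m \<in> carrier X" "\<tau> m = \<one>\<^bsub>G\<^esub>" "x = y \<otimes>\<^bsub>T\<^esub> m"
      using x y e by (simp_all add: m_def X.m_assoc[symmetric] flip: multX)
    obtain v where v: "m = (v, \<one>\<^bsub>Q\<^esub>, \<one>\<^bsub>AutoGroup A\<^esub>)"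
      "v \<in> carrier Q \<rightarrow>\<^sub>E carrier A"
      using * m XT[of m] by (cases m) (auto simp: carrier_twreath R_def)
    have "\<psi> m = \<one>\<^bsub>A\<^esub>" using * m by blast
    then have "v \<one>\<^bsub>Q\<^esub> = \<one>\<^bsub>A\<^esub>" using v by (simp add: \<psi>_def)
    then have v1: "v \<one>\<^bsub>Q\<^esub> = \<one>\<^bsub>A\<^esub>" .
    obtain u q w where y': "y = (u, q, w)" by (rule prod_cases3)
    have y'': "u \<in> carrier Q \<rightarrow>\<^sub>E carrier A" "q \<in> carrier Q" "w \<in> W"
      using XT[OF y] unfolding y' carrier_twreath by simp_all
    have "x = (u, q, w) \<otimes>\<^bsub>T\<^esub> (v, \<one>\<^bsub>Q\<^esub>, \<one>\<^bsub>AutoGroup A\<^esub>)"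
      using m(3) unfolding v(1) y' .
    then have x': "x = (\<lambda>y\<in>carrier Q. w (v y) \<otimes>\<^bsub>A\<^esub> u (\<one>\<^bsub>Q\<^esub> \<otimes>\<^bsub>Q\<^esub> y), q, w)"
      unfolding mult_twreath using y'' by (simp add: W_auto)
    show ?thesis unfolding x' y' using y'' v1 by simp
  qed
  then show ?thesis using G \<tau>h unfolding carX X_def[symmetric] by blast
qed

end

section \<open>Embeddings into twisted wreath products\<close>

text \<open>
  The data that realise the kernel \<open>N\<close> of \<open>r\<close>, up to the kernel of \<open>\<epsilon>\<close>, inside the group \<open>A\<close>: a
  homomorphism \<open>\<epsilon>\<close> of \<open>N\<close> onto \<open>A\<close> and an action \<open>\<theta>\<close> of \<open>B\<close> on \<open>A\<close> by automorphisms from \<open>W\<close> that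
  extends, along \<open>\<epsilon>\<close>, conjugation of \<open>N\<close> by \<open>B\<close>.
\<close>

definition equivariant_onto ::
  "('b, 'l) monoid_scheme \<Rightarrow> ('q, 'n) monoid_scheme \<Rightarrow> ('b \<Rightarrow> 'q) \<Rightarrow> ('a, 'm) monoid_scheme \<Rightarrow>
     ('a \<Rightarrow> 'a) set \<Rightarrow> ('b \<Rightarrow> 'a) \<Rightarrow> ('b \<Rightarrow> 'a \<Rightarrow> 'a) \<Rightarrow> bool" where
  "equivariant_onto B Q r A W \<epsilon> \<theta> \<longleftrightarrow>
     r \<in> hom B Q \<and> \<epsilon> \<in> epi (B\<lparr>carrier := kernel B Q r\<rparr>) A \<and>
     \<theta> \<in> hom B (AutoGroup A) \<and> \<theta> ` carrier B \<subseteq> W \<and>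
     (\<forall>b\<in>carrier B. \<forall>n\<in>kernel B Q r. \<theta> b (\<epsilon> n) = \<epsilon> (b \<otimes>\<^bsub>B\<^esub> n \<otimes>\<^bsub>B\<^esub> inv\<^bsub>B\<^esub> b))"

context twisted_wreath begin

lemma orbit_representatives:
  assumes "group B" "r \<in> hom B Q"
  obtains p c where
    "\<And>y. y \<in> carrier Q \<Longrightarrow> p y \<in> carrier Q"
    "\<And>y. y \<in> carrier Q \<Longrightarrow> c y \<in> carrier B \<and> y = r (c y) \<otimes>\<^bsub>Q\<^esub> p y"
    "\<And>b y. b \<in> carrier B \<Longrightarrow> y \<in> carrier Q \<Longrightarrow> p (r b \<otimes>\<^bsub>Q\<^esub> y) = p y"
proof -
  interpret r: group_hom B Q r using assms by (simp add: group_hom_def group_hom_axioms_def)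
  define orb where "orb = (\<lambda>y. (\<lambda>b. r b \<otimes>\<^bsub>Q\<^esub> y) ` carrier B)"
  define p where "p = (\<lambda>y. SOME x. x \<in> orb y)"
  define c where "c = (\<lambda>y. SOME b. b \<in> carrier B \<and> y = r b \<otimes>\<^bsub>Q\<^esub> p y)"
  have self: "y \<in> orb y" if "y \<in> carrier Q" for y
    unfolding orb_def using that by (intro image_eqI[of _ _ "\<one>\<^bsub>B\<^esub>"]) auto
  have p_orb: "p y \<in> orb y" if "y \<in> carrier Q" for y
    unfolding p_def using self[OF that] by (rule someI)
  have p_car: "p y \<in> carrier Q" if "y \<in> carrier Q" for y
    using p_orb[OF that] that by (auto simp: orb_def)
  have c: "c y \<in> carrier B \<and> y = r (c y) \<otimes>\<^bsub>Q\<^esub> p y" if y: "y \<in> carrier Q" for y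
  proof -
    obtain b where b: "b \<in> carrier B" "p y = r b \<otimes>\<^bsub>Q\<^esub> y" using p_orb[OF y]
      by (auto simp: orb_def)
    then have "y = r (inv\<^bsub>B\<^esub> b) \<otimes>\<^bsub>Q\<^esub> p y" using y
      by (simp add: Q.m_assoc[symmetric])
    then have ex: "\<exists>b. b \<in> carrier B \<and> y = r b \<otimes>\<^bsub>Q\<^esub> p y" using b(1)
      by (intro exI[of _ "inv\<^bsub>B\<^esub> b"]) simp
    show ?thesis unfolding c_def by (rule someI_ex[OF ex])
  qed
  have "orb (r b \<otimes>\<^bsub>Q\<^esub> y) = orb y" if "b \<in> carrier B" "y \<in> carrier Q" for b y
  proof
    show "orb (r b \<otimes>\<^bsub>Q\<^esub> y) \<subseteq> orb y"
    proof
      fix x assume "x \<in> orb (r b \<otimes>\<^bsub>Q\<^esub> y)"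
      then obtain b' where b': "b' \<in> carrier B"
        "x = r b' \<otimes>\<^bsub>Q\<^esub> (r b \<otimes>\<^bsub>Q\<^esub> y)" by (auto simp: orb_def)
      then have "x = r (b' \<otimes>\<^bsub>B\<^esub> b) \<otimes>\<^bsub>Q\<^esub> y" using that
        by (simp add: Q.m_assoc)
      then show "x \<in> orb y" using b'(1) that(1) unfolding orb_def
        by (intro image_eqI[of _ _ "b' \<otimes>\<^bsub>B\<^esub> b"]) auto
    qed
    show "orb y \<subseteq> orb (r b \<otimes>\<^bsub>Q\<^esub> y)"
    proof
      fix x assume "x \<in> orb y"
      then obtain b' where b': "b' \<in> carrier B" "x = r b' \<otimes>\<^bsub>Q\<^esub> y" by (auto simp: orb_def)
      have "inv\<^bsub>Q\<^esub> r b \<otimes>\<^bsub>Q\<^esub> (r b \<otimes>\<^bsub>Q\<^esub> y) = y"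
        using that by (simp add: Q.m_assoc[symmetric])
      then have "x = r (b' \<otimes>\<^bsub>B\<^esub> inv\<^bsub>B\<^esub> b) \<otimes>\<^bsub>Q\<^esub> (r b \<otimes>\<^bsub>Q\<^esub> y)"
        using that b' by (simp add: Q.m_assoc)
      then show "x \<in> orb (r b \<otimes>\<^bsub>Q\<^esub> y)"
        using b'(1) that(1) unfolding orb_def
        by (intro image_eqI[of _ _ "b' \<otimes>\<^bsub>B\<^esub> inv\<^bsub>B\<^esub> b"]) auto
    qed
  qed
  then have "p (r b \<otimes>\<^bsub>Q\<^esub> y) = p y" if "b \<in> carrier B" "y \<in> carrier Q" for b y
    using that by (simp add: p_def)
  with p_car c that show thesis by blast
qed

text \<open>
  The twisted form of the Krasner--Kaloujnine embedding. With \<open>y = r (c y) \<cdot> p y\<close> for a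
  representative \<open>p y\<close> of the orbit of \<open>y\<close>, the element \<open>b \<cdot> c y \<cdot> c (r b \<cdot> y)\<inverse>\<close> lies in the kernel of
  \<open>r\<close>, and its image under \<open>\<epsilon>\<close> is the coordinate \<open>u b y\<close>. The twist by \<open>\<theta>\<close> makes elements of the kernel
  of \<open>r\<close> constant, whatever the choice of representatives.
\<close>

theorem krasner_kaloujnine:
  assumes B: "group B" and e: "equivariant_onto B Q r A W \<epsilon> \<theta>"
  obtains u where "(\<lambda>b. (u b, r b, \<theta> b)) \<in> hom B T"
    "\<And>n. n \<in> kernel B Q r \<Longrightarrow> u n = (\<lambda>y\<in>carrier Q. \<epsilon> n)"
proof -
  define N where "N = kernel B Q r"
  have r: "r \<in> hom B Q" and \<epsilon>: "\<epsilon> \<in> hom (B\<lparr>carrier := N\<rparr>) A"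
    and \<theta>: "\<theta> \<in> hom B (AutoGroup A)"
      "\<And>b. b \<in> carrier B \<Longrightarrow> \<theta> b \<in> W"
    and rel: "\<And>b n. b \<in> carrier B \<Longrightarrow> n \<in> N \<Longrightarrow> \<theta> b (\<epsilon> n) = \<epsilon> (b \<otimes>\<^bsub>B\<^esub> n \<otimes>\<^bsub>B\<^esub> inv\<^bsub>B\<^esub> b)"
    using e by (auto simp: equivariant_onto_def epi_def N_def)
  interpret r: group_hom B Q r using B r by (simp add: group_hom_def group_hom_axioms_def)
  obtain p c where p: "\<And>y. y \<in> carrier Q \<Longrightarrow> p y \<in> carrier Q"
    and c': "\<And>y. y \<in> carrier Q \<Longrightarrow> c y \<in> carrier B \<and> y = r (c y) \<otimes>\<^bsub>Q\<^esub> p y"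
    and pr: "\<And>b y. b \<in> carrier B \<Longrightarrow> y \<in> carrier Q \<Longrightarrow> p (r b \<otimes>\<^bsub>Q\<^esub> y) = p y"
    using orbit_representatives[OF B r] by blast
  have c [simp]: "c y \<in> carrier B" if "y \<in> carrier Q" for y using c' that by blast
  define d where "d = (\<lambda>b y. b \<otimes>\<^bsub>B\<^esub> c y \<otimes>\<^bsub>B\<^esub> inv\<^bsub>B\<^esub> (c (r b \<otimes>\<^bsub>Q\<^esub> y)))"
  have d: "d b y \<in> N" if b: "b \<in> carrier B" and y: "y \<in> carrier Q" for b y
  proof -
    have ry: "r b \<otimes>\<^bsub>Q\<^esub> y \<in> carrier Q" using b y by simp
    have "r (c (r b \<otimes>\<^bsub>Q\<^esub> y)) \<otimes>\<^bsub>Q\<^esub> p y = r b \<otimes>\<^bsub>Q\<^esub> y"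
      using c'[OF ry] pr[OF b y] by metis
    also have "\<dots> = r b \<otimes>\<^bsub>Q\<^esub> r (c y) \<otimes>\<^bsub>Q\<^esub> p y"
      using c'[OF y] p[OF y] b Q.m_assoc r.hom_closed c[OF y] by metis
    finally have "r (c (r b \<otimes>\<^bsub>Q\<^esub> y)) = r b \<otimes>\<^bsub>Q\<^esub> r (c y)"
      using p y b ry by simp
    then show ?thesis using b y ry by (simp add: d_def N_def kernel_def)
  qed
  define u where "u = (\<lambda>b. \<lambda>y\<in>carrier Q. \<epsilon> (d b y))"
  have \<epsilon>_car: "\<epsilon> n \<in> carrier A" if "n \<in> N" for n
    using \<epsilon> that by (auto simp: hom_def)
  have un: "u n = (\<lambda>y\<in>carrier Q. \<epsilon> n)" if "n \<in> kernel B Q r" for n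
    using that by (auto simp: u_def d_def kernel_def r.G.m_assoc intro!: restrict_ext)
  have conjN: "b \<otimes>\<^bsub>B\<^esub> n \<otimes>\<^bsub>B\<^esub> inv\<^bsub>B\<^esub> b \<in> N"
    if "b \<in> carrier B" "n \<in> N" for b n
    using that by (simp add: N_def kernel_def)
  have "(\<lambda>b. (u b, r b, \<theta> b)) \<in> hom B T"
  proof (rule homI)
    fix b assume "b \<in> carrier B"
    then show "(u b, r b, \<theta> b) \<in> carrier T"
      using \<theta> \<epsilon>_car d by (auto simp: carrier_twreath u_def)
  next
    fix b b' assume b: "b \<in> carrier B" "b' \<in> carrier B"
    have "\<epsilon> (d (b \<otimes>\<^bsub>B\<^esub> b') y) = \<theta> b (\<epsilon> (d b' y)) \<otimes>\<^bsub>A\<^esub> \<epsilon> (d b (r b' \<otimes>\<^bsub>Q\<^esub> y))"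
      if y: "y \<in> carrier Q" for y
    proof -
      have y': "r b' \<otimes>\<^bsub>Q\<^esub> y \<in> carrier Q" using b y by simp
      then have y'': "r b \<otimes>\<^bsub>Q\<^esub> (r b' \<otimes>\<^bsub>Q\<^esub> y) \<in> carrier Q" using b
        by simp
      have "d (b \<otimes>\<^bsub>B\<^esub> b') y = b \<otimes>\<^bsub>B\<^esub> b' \<otimes>\<^bsub>B\<^esub> c y \<otimes>\<^bsub>B\<^esub> inv\<^bsub>B\<^esub> (c (r b \<otimes>\<^bsub>Q\<^esub> (r b' \<otimes>\<^bsub>Q\<^esub> y)))"
        using b y by (simp add: d_def Q.m_assoc)
      also have "\<dots> = (b \<otimes>\<^bsub>B\<^esub> d b' y \<otimes>\<^bsub>B\<^esub> inv\<^bsub>B\<^esub> b) \<otimes>\<^bsub>B\<^esub> d b (r b' \<otimes>\<^bsub>Q\<^esub> y)"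
      proof -
        have [simp]: "inv\<^bsub>B\<^esub> x \<otimes>\<^bsub>B\<^esub> (x \<otimes>\<^bsub>B\<^esub> z) = z"
          if "x \<in> carrier B" "z \<in> carrier B" for x z
          using that by (simp add: r.G.m_assoc[symmetric])
        show ?thesis using b y y' y'' by (simp add: d_def r.G.m_assoc)
      qed
      finally have "\<epsilon> (d (b \<otimes>\<^bsub>B\<^esub> b') y) =
          \<epsilon> (b \<otimes>\<^bsub>B\<^esub> d b' y \<otimes>\<^bsub>B\<^esub> inv\<^bsub>B\<^esub> b) \<otimes>\<^bsub>A\<^esub> \<epsilon> (d b (r b' \<otimes>\<^bsub>Q\<^esub> y))"
        using \<epsilon> conjN[OF b(1) d[OF b(2) y]] d[OF b(1) y'] by (auto simp: hom_def)
      then show ?thesis using rel[OF b(1) d[OF b(2) y]] by simp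
    qed
    then show "(u (b \<otimes>\<^bsub>B\<^esub> b'), r (b \<otimes>\<^bsub>B\<^esub> b'), \<theta> (b \<otimes>\<^bsub>B\<^esub> b')) = (u b, r b, \<theta> b) \<otimes>\<^bsub>T\<^esub> (u b', r b', \<theta> b')"
      using b \<theta>(1) by (auto simp: mult_twreath u_def hom_def intro!: restrict_ext)
  qed
  with un that show thesis by blast
qed

text \<open>
  Two embeddings of a group \<open>H\<close> that agree modulo the base group \<open>A\<^sup>Q\<close>, and on all elements
  that fix the coordinates, differ by a conjugation: their quotient is a cocycle with values in a
  coinduced module, hence a coboundary. Explicitly, \<open>z y = (u1 h y\<^sub>0)\<inverse> \<cdot> u2 h y\<^sub>0\<close> whenever
  \<open>y = r h \<cdot> y\<^sub>0\<close> for the orbit representative \<open>y\<^sub>0\<close>; agreement on the kernel of \<open>r\<close> makes this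
  independent of \<open>h\<close>.
\<close>

lemma conjugate_embeddings:
  assumes H: "group H" and \<eta>1: "\<eta>1 \<in> hom H T" and \<eta>2: "\<eta>2 \<in> hom H T"
    and snd: "\<And>h. h \<in> carrier H \<Longrightarrow> snd (\<eta>1 h) = snd (\<eta>2 h)"
    and ker: "\<And>h. h \<in> carrier H \<Longrightarrow> fst (snd (\<eta>1 h)) = \<one>\<^bsub>Q\<^esub> \<Longrightarrow> \<eta>1 h = \<eta>2 h"
  obtains z where "z \<in> carrier Q \<rightarrow>\<^sub>E carrier A"
    "\<And>h. h \<in> carrier H \<Longrightarrow> \<eta>2 h \<otimes>\<^bsub>T\<^esub> (z, \<one>\<^bsub>Q\<^esub>, \<one>\<^bsub>AutoGroup A\<^esub>) = (z, \<one>\<^bsub>Q\<^esub>, \<one>\<^bsub>AutoGroup A\<^esub>) \<otimes>\<^bsub>T\<^esub> \<eta>1 h"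
proof -
  interpret H: group H by fact
  define r \<theta> u1 u2 where "r = (\<lambda>h. fst (snd (\<eta>1 h)))"
  and "\<theta> = (\<lambda>h. snd (snd (\<eta>1 h)))"
    and "u1 = (\<lambda>h. fst (\<eta>1 h))" and "u2 = (\<lambda>h. fst (\<eta>2 h))"
  note defs = r_def \<theta>_def u1_def u2_def
  have e1: "\<eta>1 h = (u1 h, r h, \<theta> h)" for h by (simp add: defs)
  have e2: "\<eta>2 h = (u2 h, r h, \<theta> h)" if "h \<in> carrier H" for h
    using snd[OF that] by (cases "\<eta>2 h") (simp add: defs)
  have u1 [simp]: "u1 h \<in> carrier Q \<rightarrow>\<^sub>E carrier A"
    and u2 [simp]: "u2 h \<in> carrier Q \<rightarrow>\<^sub>E carrier A"
    and rh [simp]: "r h \<in> carrier Q" and \<theta>h [simp]: "\<theta> h \<in> W" if "h \<in> carrier H" for h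
    using hom_in_carrier[OF \<eta>1 that] hom_in_carrier[OF \<eta>2 that] e1[of h] e2[OF that]
    by (auto simp: carrier_twreath)
  have m1: "(u1 (h \<otimes>\<^bsub>H\<^esub> h'), r (h \<otimes>\<^bsub>H\<^esub> h'), \<theta> (h \<otimes>\<^bsub>H\<^esub> h')) = (u1 h, r h, \<theta> h) \<otimes>\<^bsub>T\<^esub> (u1 h', r h', \<theta> h')"
    and m2: "(u2 (h \<otimes>\<^bsub>H\<^esub> h'), r (h \<otimes>\<^bsub>H\<^esub> h'), \<theta> (h \<otimes>\<^bsub>H\<^esub> h')) = (u2 h, r h, \<theta> h) \<otimes>\<^bsub>T\<^esub> (u2 h', r h', \<theta> h')"
    if h: "h \<in> carrier H" "h' \<in> carrier H" for h h'
    using hom_mult[OF \<eta>1 h] hom_mult[OF \<eta>2 h] e1 e2 h H.m_closed by metis+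
  have r_hom: "r \<in> hom H Q" using m1 by (auto simp: hom_def mult_twreath)
  interpret r: group_hom H Q r using r_hom H by (simp add: group_hom_def group_hom_axioms_def)
  have c1: "u1 (h \<otimes>\<^bsub>H\<^esub> h') y = \<theta> h (u1 h' y) \<otimes>\<^bsub>A\<^esub> u1 h (r h' \<otimes>\<^bsub>Q\<^esub> y)"
    and c2: "u2 (h \<otimes>\<^bsub>H\<^esub> h') y = \<theta> h (u2 h' y) \<otimes>\<^bsub>A\<^esub> u2 h (r h' \<otimes>\<^bsub>Q\<^esub> y)"
    if h: "h \<in> carrier H" "h' \<in> carrier H" and y: "y \<in> carrier Q" for h h' y
    using m1[OF h] m2[OF h] y by (simp_all add: mult_twreath)
  define F where "F = (\<lambda>h y. inv\<^bsub>A\<^esub> (u1 h y) \<otimes>\<^bsub>A\<^esub> u2 h y)"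
  have F_mult: "F (h \<otimes>\<^bsub>H\<^esub> h') y =
      inv\<^bsub>A\<^esub> (u1 h (r h' \<otimes>\<^bsub>Q\<^esub> y)) \<otimes>\<^bsub>A\<^esub> \<theta> h (F h' y) \<otimes>\<^bsub>A\<^esub> u2 h (r h' \<otimes>\<^bsub>Q\<^esub> y)"
    if h: "h \<in> carrier H" "h' \<in> carrier H" and y: "y \<in> carrier Q" for h h' y
  proof -
    have [simp]: "u1 h' y \<in> carrier A" "u2 h' y \<in> carrier A"
      "r h' \<otimes>\<^bsub>Q\<^esub> y \<in> carrier Q"
      "u1 h (r h' \<otimes>\<^bsub>Q\<^esub> y) \<in> carrier A"
      "u2 h (r h' \<otimes>\<^bsub>Q\<^esub> y) \<in> carrier A"
      using h y by (simp_all add: PiE_A[OF u1] PiE_A[OF u2])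
    show ?thesis using h y by (simp add: F_def c1 c2 A.inv_mult_group A.m_assoc)
  qed
  have F_car: "F h y \<in> carrier A" if "h \<in> carrier H" "y \<in> carrier Q" for h y
    using PiE_A[OF u1[OF that(1)] that(2)] PiE_A[OF u2[OF that(1)] that(2)] by (simp add: F_def)
  have F_indep: "F h y = F h' y" if h: "h \<in> carrier H" "h' \<in> carrier H" and y: "y \<in> carrier Q"
    and eq: "r h \<otimes>\<^bsub>Q\<^esub> y = r h' \<otimes>\<^bsub>Q\<^esub> y" for h h' y
  proof -
    define n where "n = inv\<^bsub>H\<^esub> h \<otimes>\<^bsub>H\<^esub> h'"
    have "r h = r h'" using h y eq by simp
    then have n: "n \<in> carrier H" "r n = \<one>\<^bsub>Q\<^esub>" "h' = h \<otimes>\<^bsub>H\<^esub> n"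
      using h by (simp_all add: n_def H.m_assoc[symmetric])
    then have "u1 n = u2 n" using ker[of n] by (simp add: defs)
    then have "F n y = \<one>\<^bsub>A\<^esub>" using PiE_A[OF u1[OF n(1)] y] PiE_A[OF u2[OF n(1)] y]
      by (simp add: F_def)
    then show ?thesis unfolding n(3) using F_mult[OF h(1) n(1) y] n h y PiE_A[OF u1[OF h(1)] y]
      by (simp add: F_def)
  qed
  obtain p c where p: "\<And>y. y \<in> carrier Q \<Longrightarrow> p y \<in> carrier Q"
    and c: "\<And>y. y \<in> carrier Q \<Longrightarrow> c y \<in> carrier H \<and> y = r (c y) \<otimes>\<^bsub>Q\<^esub> p y"
    and pr: "\<And>b y. b \<in> carrier H \<Longrightarrow> y \<in> carrier Q \<Longrightarrow> p (r b \<otimes>\<^bsub>Q\<^esub> y) = p y"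
    using orbit_representatives[OF H r_hom] by blast
  define z where "z = (\<lambda>y\<in>carrier Q. F (c y) (p y))"
  have z: "z \<in> carrier Q \<rightarrow>\<^sub>E carrier A" using F_car c p by (auto simp: z_def)
  have "u1 h y \<otimes>\<^bsub>A\<^esub> z (r h \<otimes>\<^bsub>Q\<^esub> y) = \<theta> h (z y) \<otimes>\<^bsub>A\<^esub> u2 h y"
    if h: "h \<in> carrier H" and y: "y \<in> carrier Q" for h y
  proof -
    have hy: "r h \<otimes>\<^bsub>Q\<^esub> y \<in> carrier Q" using h y by simp
    have cy: "c y \<in> carrier H" "r (c y) \<otimes>\<^bsub>Q\<^esub> p y = y" and py: "p y \<in> carrier Q"
      using c[OF y] p[OF y] by auto
    have "r (c (r h \<otimes>\<^bsub>Q\<^esub> y)) \<otimes>\<^bsub>Q\<^esub> p y = r h \<otimes>\<^bsub>Q\<^esub> y"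
      using c[OF hy] pr[OF h y] by metis
    also have "\<dots> = r (h \<otimes>\<^bsub>H\<^esub> c y) \<otimes>\<^bsub>Q\<^esub> p y"
      using h cy py by (simp add: Q.m_assoc)
    finally have eq: "r (c (r h \<otimes>\<^bsub>Q\<^esub> y)) \<otimes>\<^bsub>Q\<^esub> p y = r (h \<otimes>\<^bsub>H\<^esub> c y) \<otimes>\<^bsub>Q\<^esub> p y" .
    have "F (c (r h \<otimes>\<^bsub>Q\<^esub> y)) (p y) = F (h \<otimes>\<^bsub>H\<^esub> c y) (p y)"
      by (rule F_indep[OF _ _ py eq]) (use c[OF hy] h cy in auto)
    then have "z (r h \<otimes>\<^bsub>Q\<^esub> y) = F (h \<otimes>\<^bsub>H\<^esub> c y) (p y)"
      unfolding z_def using hy pr[OF h y] by simp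
    also have "\<dots> = inv\<^bsub>A\<^esub> (u1 h y) \<otimes>\<^bsub>A\<^esub> \<theta> h (z y) \<otimes>\<^bsub>A\<^esub> u2 h y"
      using F_mult[OF h cy(1) py] cy(2) y by (simp add: z_def)
    finally show ?thesis
      using PiE_A[OF z y] PiE_A[OF u1[OF h] y] PiE_A[OF u2[OF h] y] h
      by (simp add: A.m_assoc[symmetric])
  qed
  then have "\<eta>2 h \<otimes>\<^bsub>T\<^esub> (z, \<one>\<^bsub>Q\<^esub>, \<one>\<^bsub>AutoGroup A\<^esub>) = (z, \<one>\<^bsub>Q\<^esub>, \<one>\<^bsub>AutoGroup A\<^esub>) \<otimes>\<^bsub>T\<^esub> \<eta>1 h"
    if h: "h \<in> carrier H" for h
    using h PiE_A[OF u1[OF h]] unfolding e1 e2[OF h] by (auto simp: mult_twreath W_auto intro!: restrict_ext)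
  with z that show thesis by blast
qed

text \<open>
  Surjectivity of \<open>\<epsilon>\<close> forces the action of the kernel to be inner. This is why embeddings of
  different groups that share \<open>A\<close> agree on it.
\<close>

lemma equivariant_onto_inner:
  assumes B: "group B" and e: "equivariant_onto B Q' r A W \<epsilon> \<theta>" and n: "n \<in> kernel B Q' r"
    and Q': "group Q'"
    and a: "a \<in> carrier A"
  shows "\<theta> n a = \<epsilon> n \<otimes>\<^bsub>A\<^esub> a \<otimes>\<^bsub>A\<^esub> inv\<^bsub>A\<^esub> \<epsilon> n"
proof -
  have "r \<in> hom B Q'" using e by (simp add: equivariant_onto_def)
  interpret r: group_hom B Q' r using B Q' \<open>r \<in> _\<close> by (simp add: group_hom_def group_hom_axioms_def)
  have "group (B\<lparr>carrier := kernel B Q' r\<rparr>)"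
    using subgroup.subgroup_is_group[OF r.subgroup_kernel B] .
  then interpret \<epsilon>: group_hom "B\<lparr>carrier := kernel B Q' r\<rparr>" A \<epsilon>
    using e by (simp add: group_hom_def group_hom_axioms_def equivariant_onto_def epi_def A.is_group)
  have "a \<in> \<epsilon> ` kernel B Q' r" using e a by (simp add: equivariant_onto_def epi_def)
  then obtain m where m: "m \<in> kernel B Q' r" "a = \<epsilon> m" by blast
  have "inv\<^bsub>B\<lparr>carrier := kernel B Q' r\<rparr>\<^esub> n = inv\<^bsub>B\<^esub> n"
    using r.G.m_inv_consistent[OF r.subgroup_kernel n] .
  then have "\<epsilon> (n \<otimes>\<^bsub>B\<^esub> m \<otimes>\<^bsub>B\<^esub> inv\<^bsub>B\<^esub> n) = \<epsilon> n \<otimes>\<^bsub>A\<^esub> \<epsilon> m \<otimes>\<^bsub>A\<^esub> inv\<^bsub>A\<^esub> \<epsilon> n"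
    using \<epsilon>.hom_mult[of "n \<otimes>\<^bsub>B\<^esub> m"
    "inv\<^bsub>B\<^esub> n"] \<epsilon>.hom_mult[of n m] \<epsilon>.hom_inv[of n] n m(1)
      subgroup.m_closed[OF r.subgroup_kernel n m(1)] subgroup.m_inv_closed[OF r.subgroup_kernel n]
    by simp
  then show ?thesis using e n m by (simp add: equivariant_onto_def kernel_def)
qed

end

section \<open>Pairs that define homomorphisms of an HNN-extension\<close>

text \<open>
  By the universal property, a homomorphism of the HNN-extension is given by its restriction \<open>f\<close> to
  the base group and the image \<open>s\<close> of the stable letter. Working with the pairs \<open>(f, s)\<close> keeps words out of
  the constructions.
\<close>

definition hnn_hom ::
    "('b, 'm) monoid_scheme \<Rightarrow> 'b set \<Rightarrow> ('b \<Rightarrow> 'b) \<Rightarrow> ('g, 'k) monoid_scheme \<Rightarrow> ('b \<Rightarrow> 'g) \<Rightarrow> 'g \<Rightarrow> bool" where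
  "hnn_hom B H \<phi> G f s \<longleftrightarrow>
     f \<in> hom B G \<and> s \<in> carrier G \<and> (\<forall>h\<in>H. f h \<otimes>\<^bsub>G\<^esub> s = s \<otimes>\<^bsub>G\<^esub> f (\<phi> h))"

context quotient_closed_root_class begin

lemma member_group: "G \<in> \<C> \<Longrightarrow> group G"
  using iso_closed by (simp add: group_class_def)

lemma small_Un:
  assumes "P \<lesssim> (UNIV :: 'u set)" "R \<lesssim> (UNIV :: 'u set)"
  shows "P \<union> R \<lesssim> (UNIV :: 'u set)"
  using card_of_Un_ordLeq_infinite_Field[of "card_of (UNIV :: 'u set)" P R, OF _ _ _ card_of_Card_order] assms inf
  unfolding lepoll_def card_of_ordLeq by (simp add: Field_card_of)

lemma small_hom_image: "P \<lesssim> (UNIV :: 'u set) \<Longrightarrow> f ` P \<lesssim> (UNIV :: 'u set)"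
  by (rule lepoll_trans[OF image_lepoll])

lemma in_class_trivial:
  assumes "group A"
  shows "in_class (A\<lparr>carrier := {\<one>\<^bsub>A\<^esub>}\<rparr>) \<C>"
proof -
  interpret A: group A by fact
  obtain G where G: "G \<in> \<C>" using root unfolding root_class_def by blast
  interpret G: group G using member_group G .
  have "group (A\<lparr>carrier := {\<one>\<^bsub>A\<^esub>}\<rparr>)"
    using subgroup.subgroup_is_group[OF A.triv_subgroup assms] .
  then show ?thesis
    by (rule in_class_mono[OF in_class_member[OF iso_closed G], of _ "\<lambda>_. \<one>\<^bsub>G\<^esub>"]) (auto simp: hom_def)
qed

text \<open>
  A pair with values in a twisted wreath product is pushed forward to a member of the class. The
  separation property then controls the kernel on the base group.
\<close>

lemma gruenberg_hnn:
  fixes A :: "('a, 'm) monoid_scheme" and Q :: "('q, 'n) monoid_scheme"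
    and B :: "('b, 'l) monoid_scheme"
  assumes A: "in_class A \<C>" and Q: "in_class Q \<C>"
    and WC: "subgroup W (AutoGroup A)" "in_class ((AutoGroup A)\<lparr>carrier := W\<rparr>) \<C>"
    and small: "carrier B \<lesssim> (UNIV :: 'u set)"
    and \<eta>: "hnn_hom B H \<phi> (twreath A Q W) \<eta> t"
      and H: "\<And>h. h \<in> H \<Longrightarrow> h \<in> carrier B \<and> \<phi> h \<in> carrier B"
  shows "\<exists>G\<in>\<C>. \<exists>\<tau> X. hnn_hom B H \<phi> G (\<tau> \<circ> \<eta>) (\<tau> t) \<and>
     subgroup X (twreath A Q W) \<and> \<tau> \<in> hom ((twreath A Q W)\<lparr>carrier := X\<rparr>) G \<and>
     t \<in> X \<and> \<eta> ` carrier B \<subseteq> X \<and>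
     (\<forall>x\<in>X. \<forall>y\<in>X. \<tau> x = \<tau> y \<longrightarrow> snd x = snd y \<and> fst x \<one>\<^bsub>Q\<^esub> = fst y \<one>\<^bsub>Q\<^esub>)"
proof -
  interpret twisted_wreath A Q W
    using in_class_group[OF A] in_class_group[OF Q] WC(1)
    by (simp add: twisted_wreath_def twisted_wreath_axioms_def)
  have \<eta>h: "\<eta> \<in> hom B T" and t: "t \<in> carrier T"
    and c: "\<And>h. h \<in> H \<Longrightarrow> \<eta> h \<otimes>\<^bsub>T\<^esub> t = t \<otimes>\<^bsub>T\<^esub> \<eta> (\<phi> h)"
    using \<eta> by (auto simp: hnn_hom_def)
  define S where "S = \<eta> ` carrier B \<union> {t}"
  have S: "S \<subseteq> carrier T" using \<eta>h t by (auto simp: S_def hom_def)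
  have "{t} \<lesssim> (UNIV :: 'u set)" using inf by (simp add: finite_lepoll_infinite)
  then have "S \<lesssim> (UNIV :: 'u set)" unfolding S_def by (intro small_Un small_hom_image small)
  then obtain G \<tau> where G: "G \<in> \<C>"
    and \<tau>: "\<tau> \<in> hom (T\<lparr>carrier := generate T S\<rparr>) G"
    and sep: "\<forall>x\<in>generate T S. \<forall>y\<in>generate T S. \<tau> x = \<tau> y \<longrightarrow> snd x = snd y \<and> fst x \<one>\<^bsub>Q\<^esub> = fst y \<one>\<^bsub>Q\<^esub>"
    using gruenberg_twreath[OF A Q WC S] by blast
  have X: "t \<in> generate T S" "\<And>b. b \<in> carrier B \<Longrightarrow> \<eta> b \<in> generate T S"
    by (auto simp: S_def intro: generate.incl)
  have \<tau>m: "\<tau> (x \<otimes>\<^bsub>T\<^esub> y) = \<tau> x \<otimes>\<^bsub>G\<^esub> \<tau> y"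
    if "x \<in> generate T S" "y \<in> generate T S" for x y
    using \<tau> that by (auto simp: hom_def)
  have "hnn_hom B H \<phi> G (\<tau> \<circ> \<eta>) (\<tau> t)"
    unfolding hnn_hom_def
  proof (intro conjI ballI)
    show "\<tau> \<circ> \<eta> \<in> hom B G"
      using \<tau> \<tau>m X \<eta>h by (auto simp: hom_def)
    show "\<tau> t \<in> carrier G" using \<tau> X by (auto simp: hom_def)
    show "(\<tau> \<circ> \<eta>) h \<otimes>\<^bsub>G\<^esub> \<tau> t = \<tau> t \<otimes>\<^bsub>G\<^esub> (\<tau> \<circ> \<eta>) (\<phi> h)" if "h \<in> H" for h
      using c[OF that] \<tau>m X H[OF that] by (metis comp_apply)
  qed
  then show ?thesis using G \<tau> sep X T.generate_is_subgroup[OF S] by blast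
qed

lemma equivariant_onto_hom_group:
  "equivariant_onto B Q r A W \<epsilon> \<theta> \<Longrightarrow> kernel B Q' r' = kernel B Q r \<Longrightarrow> r' \<in> hom B Q' \<Longrightarrow>
     equivariant_onto B Q' r' A W \<epsilon> \<theta>"
  by (simp add: equivariant_onto_def)

text \<open>
  If two groups \<open>B1\<close>, \<open>B2\<close> have normal subgroups mapped onto the same group \<open>A\<close>, then
  \<open>B1 / ker \<epsilon>1\<close> and \<open>B2 / ker \<epsilon>2\<close> can be amalgamated along \<open>A\<close> inside a member of the class.
  Both groups embed into the twisted wreath product over \<open>Q1 \<times> Q2\<close>, the first one moving only
  the first coordinate and the second one only the second. The embeddings agree on \<open>A\<close> because
  both of them send an element above \<open>a\<close> to left multiplication by \<open>a\<close>.
\<close>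

theorem normal_amalgam:
  fixes A :: "('a, 'm) monoid_scheme"
    and B1 :: "('b1, 'l1) monoid_scheme" and B2 :: "('b2, 'l2) monoid_scheme"
  assumes A: "in_class A \<C>"
    and WC: "subgroup W (AutoGroup A)" "in_class ((AutoGroup A)\<lparr>carrier := W\<rparr>) \<C>"
    and B1: "group B1" "carrier B1 \<lesssim> (UNIV :: 'u set)" "in_class Q1 \<C>"
      "equivariant_onto B1 Q1 r1 A W \<epsilon>1 \<theta>1"
    and B2: "group B2" "carrier B2 \<lesssim> (UNIV :: 'u set)" "in_class Q2 \<C>"
      "equivariant_onto B2 Q2 r2 A W \<epsilon>2 \<theta>2"
  obtains D \<beta>1 \<beta>2 where "D \<in> \<C>" "\<beta>1 \<in> hom B1 D" "\<beta>2 \<in> hom B2 D"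
    "\<And>m n. m \<in> kernel B1 Q1 r1 \<Longrightarrow> n \<in> kernel B2 Q2 r2 \<Longrightarrow> \<epsilon>1 m = \<epsilon>2 n \<Longrightarrow> \<beta>1 m = \<beta>2 n"
    "\<And>b. b \<in> carrier B1 \<Longrightarrow> \<beta>1 b = \<one>\<^bsub>D\<^esub> \<Longrightarrow> b \<in> kernel B1 Q1 r1 \<and> \<epsilon>1 b = \<one>\<^bsub>A\<^esub>"
    "\<And>b. b \<in> carrier B2 \<Longrightarrow> \<beta>2 b = \<one>\<^bsub>D\<^esub> \<Longrightarrow> b \<in> kernel B2 Q2 r2 \<and> \<epsilon>2 b = \<one>\<^bsub>A\<^esub>"
proof -
  define Q where "Q = Q1 \<times>\<times> Q2"
  have Q: "in_class Q \<C>" unfolding Q_def using in_class_DirProd B1(3) B2(3) .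
  interpret Q1: group Q1 using in_class_group[OF B1(3)] .
  interpret Q2: group Q2 using in_class_group[OF B2(3)] .
  interpret B1: group B1 by fact
  interpret B2: group B2 by fact
  interpret twisted_wreath A Q W
    using in_class_group[OF A] in_class_group[OF Q] WC(1)
    by (simp add: twisted_wreath_def twisted_wreath_axioms_def)
  define r1' r2' where "r1' = (\<lambda>b. (r1 b, \<one>\<^bsub>Q2\<^esub>))"
  and "r2' = (\<lambda>b. (\<one>\<^bsub>Q1\<^esub>, r2 b))"
  have ker1: "kernel B1 Q r1' = kernel B1 Q1 r1" and ker2: "kernel B2 Q r2' = kernel B2 Q2 r2"
    by (simp_all add: kernel_def Q_def r1'_def r2'_def)
  have "r1 \<in> hom B1 Q1" "r2 \<in> hom B2 Q2" using B1(4) B2(4) by (simp_all add: equivariant_onto_def)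
  then have r: "r1' \<in> hom B1 Q" "r2' \<in> hom B2 Q"
    by (auto simp: hom_def Q_def r1'_def r2'_def)
  have e1: "equivariant_onto B1 Q r1' A W \<epsilon>1 \<theta>1"
    and e2: "equivariant_onto B2 Q r2' A W \<epsilon>2 \<theta>2"
    using equivariant_onto_hom_group[OF B1(4) ker1 r(1)] equivariant_onto_hom_group[OF B2(4) ker2 r(2)] .
  obtain u1 where u1: "(\<lambda>b. (u1 b, r1' b, \<theta>1 b)) \<in> hom B1 T"
    "\<And>n. n \<in> kernel B1 Q r1' \<Longrightarrow> u1 n = (\<lambda>y\<in>carrier Q. \<epsilon>1 n)"
    by (rule krasner_kaloujnine[OF B1(1) e1]) blast
  obtain u2 where u2: "(\<lambda>b. (u2 b, r2' b, \<theta>2 b)) \<in> hom B2 T"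
    "\<And>n. n \<in> kernel B2 Q r2' \<Longrightarrow> u2 n = (\<lambda>y\<in>carrier Q. \<epsilon>2 n)"
    by (rule krasner_kaloujnine[OF B2(1) e2]) blast
  define \<eta>1 \<eta>2 where "\<eta>1 = (\<lambda>b. (u1 b, r1' b, \<theta>1 b))"
  and "\<eta>2 = (\<lambda>b. (u2 b, r2' b, \<theta>2 b))"
  have \<eta>h: "\<eta>1 \<in> hom B1 T" "\<eta>2 \<in> hom B2 T" using u1 u2
    by (simp_all add: \<eta>1_def \<eta>2_def)
  define S where "S = \<eta>1 ` carrier B1 \<union> \<eta>2 ` carrier B2"
  have S: "S \<subseteq> carrier T" "S \<lesssim> (UNIV :: 'u set)"
    using \<eta>h B1(2) B2(2) unfolding S_def by (auto simp: hom_def intro: small_Un small_hom_image)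
  obtain D \<tau> where D: "D \<in> \<C>" and \<tau>: "\<tau> \<in> hom (T\<lparr>carrier := generate T S\<rparr>) D"
    and sep: "\<forall>x\<in>generate T S. \<forall>y\<in>generate T S. \<tau> x = \<tau> y \<longrightarrow> snd x = snd y \<and> fst x \<one>\<^bsub>Q\<^esub> = fst y \<one>\<^bsub>Q\<^esub>"
    using gruenberg_twreath[OF A Q WC S] by blast
  have X: "\<And>b. b \<in> carrier B1 \<Longrightarrow> \<eta>1 b \<in> generate T S"
    "\<And>b. b \<in> carrier B2 \<Longrightarrow> \<eta>2 b \<in> generate T S"
    by (auto simp: S_def intro: generate.incl)
  have \<beta>: "\<tau> \<circ> \<eta>1 \<in> hom B1 D" "\<tau> \<circ> \<eta>2 \<in> hom B2 D"
    using \<tau> X \<eta>h by (auto simp: hom_def)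
  have agree: "(\<tau> \<circ> \<eta>1) m = (\<tau> \<circ> \<eta>2) n"
    if m: "m \<in> kernel B1 Q1 r1" and n: "n \<in> kernel B2 Q2 r2" and mn: "\<epsilon>1 m = \<epsilon>2 n" for m n
  proof -
    have mc: "m \<in> carrier B1" and nc: "n \<in> carrier B2" using m n by (auto simp: kernel_def)
    have "\<theta>1 m = \<theta>2 n"
    proof (rule AutoGroup_eqI)
      show "\<theta>1 m \<in> carrier (AutoGroup A)" "\<theta>2 n \<in> carrier (AutoGroup A)"
        using e1 e2 mc nc by (auto simp: equivariant_onto_def hom_def)
      show "\<theta>1 m a = \<theta>2 n a" if "a \<in> carrier A" for a
        using equivariant_onto_inner[OF B1(1) B1(4) m Q1.is_group that]
          equivariant_onto_inner[OF B2(1) B2(4) n Q2.is_group that] mn by simp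
    qed
    moreover have "u1 m = u2 n" using u1(2)[unfolded ker1, OF m] u2(2)[unfolded ker2, OF n] mn by simp
    moreover have "r1' m = r2' n" using m n by (simp add: kernel_def r1'_def r2'_def)
    ultimately show ?thesis by (simp add: \<eta>1_def \<eta>2_def)
  qed
  have D': "group D" using member_group[OF D] .
  have k1: "b \<in> kernel B1 Q1 r1 \<and> \<epsilon>1 b = \<one>\<^bsub>A\<^esub>" if b: "b \<in> carrier B1"
    and 1: "(\<tau> \<circ> \<eta>1) b = \<one>\<^bsub>D\<^esub>" for b
  proof -
    have "\<tau> (\<eta>1 b) = \<tau> (\<eta>1 \<one>\<^bsub>B1\<^esub>)" using 1 hom_one[OF \<beta>(1) B1(1) D']
      by simp
    then have "snd (\<eta>1 b) = snd (\<eta>1 \<one>\<^bsub>B1\<^esub>) \<and> fst (\<eta>1 b) \<one>\<^bsub>Q\<^esub> = fst (\<eta>1 \<one>\<^bsub>B1\<^esub>) \<one>\<^bsub>Q\<^esub>"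
      using sep X b by blast
    then have *: "r1' b = \<one>\<^bsub>Q\<^esub>" "u1 b \<one>\<^bsub>Q\<^esub> = \<one>\<^bsub>A\<^esub>"
      unfolding hom_one[OF \<eta>h(1) B1(1) T.is_group] by (auto simp: \<eta>1_def one_twreath)
    then have "b \<in> kernel B1 Q r1'" using b by (simp add: kernel_def)
    then show ?thesis using u1(2)[of b] * ker1 by simp
  qed
  have k2: "b \<in> kernel B2 Q2 r2 \<and> \<epsilon>2 b = \<one>\<^bsub>A\<^esub>" if b: "b \<in> carrier B2"
    and 1: "(\<tau> \<circ> \<eta>2) b = \<one>\<^bsub>D\<^esub>" for b
  proof -
    have "\<tau> (\<eta>2 b) = \<tau> (\<eta>2 \<one>\<^bsub>B2\<^esub>)" using 1 hom_one[OF \<beta>(2) B2(1) D']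
      by simp
    then have "snd (\<eta>2 b) = snd (\<eta>2 \<one>\<^bsub>B2\<^esub>) \<and> fst (\<eta>2 b) \<one>\<^bsub>Q\<^esub> = fst (\<eta>2 \<one>\<^bsub>B2\<^esub>) \<one>\<^bsub>Q\<^esub>"
      using sep X b by blast
    then have *: "r2' b = \<one>\<^bsub>Q\<^esub>" "u2 b \<one>\<^bsub>Q\<^esub> = \<one>\<^bsub>A\<^esub>"
      unfolding hom_one[OF \<eta>h(2) B2(1) T.is_group] by (auto simp: \<eta>2_def one_twreath)
    then have "b \<in> kernel B2 Q r2'" using b by (simp add: kernel_def)
    then show ?thesis using u2(2)[of b] * ker2 by simp
  qed
  show thesis using that[OF D \<beta> agree k1 k2] .
qed

text \<open>
  Let \<open>\<beta>\<close>, \<open>\<gamma>\<close> be homomorphisms of \<open>B\<close> into \<open>D\<close> such that \<open>\<gamma>\<close> kills \<open>H\<close>, \<open>\<beta>\<close> kills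
  \<open>\<phi> H\<close>, and \<open>\<gamma>\<close> on \<open>\<phi> H\<close> is \<open>\<beta>\<close> on \<open>H\<close>. In the wreath product of \<open>D\<close> by a non-trivial group \<open>Q\<close> of
  the class let \<open>B\<close> act through \<open>\<beta>\<close> in coordinate \<open>1\<close> and through \<open>\<gamma>\<close> in coordinate \<open>s0\<inverse>\<close>,
  with \<open>s0 \<noteq> 1\<close>. Then translation by \<open>s0\<close> serves as stable letter: it moves the only coordinate
  in which \<open>\<phi> h\<close> acts to the only one in which \<open>h\<close> acts. Every root class contains such a group \<open>Q\<close>,
  whatever the orders of its elements are; if \<open>s0\<close> is an involution, the two coordinates are exchanged.
\<close>

lemma hnn_hom_from_slots:
  fixes B :: "('b, 'l) monoid_scheme"
  assumes B: "group B" "carrier B \<lesssim> (UNIV :: 'u set)" and D: "D \<in> \<C>"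
    and \<beta>: "\<beta> \<in> hom B D" and \<gamma>: "\<gamma> \<in> hom B D"
    and H: "\<And>h. h \<in> H \<Longrightarrow> h \<in> carrier B \<and> \<phi> h \<in> carrier B"
    and rel: "\<And>h. h \<in> H \<Longrightarrow> \<gamma> h = \<one>\<^bsub>D\<^esub> \<and> \<beta> (\<phi> h) = \<one>\<^bsub>D\<^esub> \<and> \<gamma> (\<phi> h) = \<beta> h"
  obtains G f s where "G \<in> \<C>" "hnn_hom B H \<phi> G f s"
    "\<And>b. b \<in> carrier B \<Longrightarrow> f b = \<one>\<^bsub>G\<^esub> \<longleftrightarrow> \<beta> b = \<one>\<^bsub>D\<^esub> \<and> \<gamma> b = \<one>\<^bsub>D\<^esub>"
proof -
  obtain Q where Q: "Q \<in> \<C>" "carrier Q \<noteq> {\<one>\<^bsub>Q\<^esub>}" using root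
    unfolding root_class_def by blast
  interpret Q: group Q using member_group Q(1) .
  obtain s0 where s0: "s0 \<in> carrier Q" "s0 \<noteq> \<one>\<^bsub>Q\<^esub>" using Q(2) Q.one_closed by blast
  interpret D: group D using member_group D .
  interpret B: group B by fact
  interpret \<beta>: group_hom B D \<beta> using \<beta> by (simp add: group_hom_def group_hom_axioms_def)
  interpret \<gamma>: group_hom B D \<gamma> using \<gamma> by (simp add: group_hom_def group_hom_axioms_def)
  let ?W = "{\<one>\<^bsub>AutoGroup D\<^esub>}"
  interpret Aut: group "AutoGroup D" by (rule D.AutoGroup)
  interpret twisted_wreath D Q ?W
    using Aut.triv_subgroup by (simp add: twisted_wreath_def twisted_wreath_axioms_def)
  define u where "u = (\<lambda>b. \<lambda>y\<in>carrier Q. if y = \<one>\<^bsub>Q\<^esub> then inv\<^bsub>D\<^esub> \<beta> b else if y = inv\<^bsub>Q\<^esub> s0 then inv\<^bsub>D\<^esub> \<gamma> b else \<one>\<^bsub>D\<^esub>)"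
  define \<eta> where "\<eta> = (\<lambda>b. (u b, \<one>\<^bsub>Q\<^esub>, \<one>\<^bsub>AutoGroup D\<^esub>))"
  define c1 where "c1 = (\<lambda>y\<in>carrier Q. \<one>\<^bsub>D\<^esub>)"
  define t where "t = (c1, s0, \<one>\<^bsub>AutoGroup D\<^esub>)"
  define ti where "ti = (c1, inv\<^bsub>Q\<^esub> s0, \<one>\<^bsub>AutoGroup D\<^esub>)"
  have u_car: "u b \<in> carrier Q \<rightarrow>\<^sub>E carrier D" if "b \<in> carrier B" for b
    using that by (auto simp: u_def)
  have t: "t \<in> carrier T" and ti: "ti \<in> carrier T"
    using s0 by (auto simp: t_def ti_def c1_def carrier_twreath)
  have "ti \<otimes>\<^bsub>T\<^esub> t = \<one>\<^bsub>T\<^esub>"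
    using s0 by (auto simp: t_def ti_def c1_def mult_twreath one_twreath intro!: restrict_ext)
  then have inv_t: "inv\<^bsub>T\<^esub> t = ti" using t ti T.inv_equality by blast
  have \<eta>: "\<eta> \<in> hom B T"
  proof (rule homI)
    fix b assume "b \<in> carrier B"
    then show "\<eta> b \<in> carrier T" using u_car by (simp add: \<eta>_def carrier_twreath)
  next
    fix b b' assume "b \<in> carrier B" "b' \<in> carrier B"
    then show "\<eta> (b \<otimes>\<^bsub>B\<^esub> b') = \<eta> b \<otimes>\<^bsub>T\<^esub> \<eta> b'"
      by (auto simp: \<eta>_def mult_twreath u_def D.inv_mult_group intro!: restrict_ext)
  qed
  have "hnn_hom B H \<phi> T \<eta> t"
    unfolding hnn_hom_def
  proof (intro conjI ballI)
    fix h assume h: "h \<in> H"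
    have "u h (s0 \<otimes>\<^bsub>Q\<^esub> y) = u (\<phi> h) y" if y: "y \<in> carrier Q" for y
    proof -
      have "s0 \<otimes>\<^bsub>Q\<^esub> y = \<one>\<^bsub>Q\<^esub> \<longleftrightarrow> y = inv\<^bsub>Q\<^esub> s0"
        using y s0 by (metis Q.inv_closed Q.l_inv Q.r_inv Q.inv_inv Q.inv_equality)
      then show ?thesis using y s0 rel[OF h] H[OF h] by (auto simp: u_def)
    qed
    then show "\<eta> h \<otimes>\<^bsub>T\<^esub> t = t \<otimes>\<^bsub>T\<^esub> \<eta> (\<phi> h)"
      using s0 u_car H[OF h] by (auto simp: \<eta>_def t_def c1_def mult_twreath intro!: restrict_ext)
  qed (fact \<eta> t)+
  then have hh: "hnn_hom B H \<phi> T \<eta> t" .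
  obtain G \<tau> X where G: "G \<in> \<C>" "hnn_hom B H \<phi> G (\<tau> \<circ> \<eta>) (\<tau> t)"
    and X: "subgroup X T" and \<tau>: "\<tau> \<in> hom (T\<lparr>carrier := X\<rparr>) G"
    and tX: "t \<in> X" and \<eta>X': "\<eta> ` carrier B \<subseteq> X"
    and sep: "\<forall>x\<in>X. \<forall>y\<in>X. \<tau> x = \<tau> y \<longrightarrow> snd x = snd y \<and> fst x \<one>\<^bsub>Q\<^esub> = fst y \<one>\<^bsub>Q\<^esub>"
    using gruenberg_hnn[OF in_class_member[OF iso_closed D] in_class_member[OF iso_closed Q(1)] Aut.triv_subgroup
        in_class_trivial[OF Aut.is_group] B(2) hh H] by blast
  have \<eta>X: "\<eta> b \<in> X" if "b \<in> carrier B" for b using \<eta>X' that by blast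
  interpret G: group G using member_group G(1) .
  have \<tau>m: "\<tau> (x \<otimes>\<^bsub>T\<^esub> y) = \<tau> x \<otimes>\<^bsub>G\<^esub> \<tau> y"
    and \<tau>c: "\<tau> x \<in> carrier G" if "x \<in> X" "y \<in> X" for x y
    using \<tau> that by (auto simp: hom_def)
  have f: "\<tau> \<circ> \<eta> \<in> hom B G" using G(2) by (simp add: hnn_hom_def)
  have tiX: "ti \<in> X" using subgroup.m_inv_closed[OF X tX] inv_t by simp
  have "(\<tau> \<circ> \<eta>) b = \<one>\<^bsub>G\<^esub> \<longleftrightarrow> \<beta> b = \<one>\<^bsub>D\<^esub> \<and> \<gamma> b = \<one>\<^bsub>D\<^esub>" if b: "b \<in> carrier B" for b
  proof
    assume 1: "(\<tau> \<circ> \<eta>) b = \<one>\<^bsub>G\<^esub>"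
    then have "\<tau> (\<eta> b) = \<tau> (\<eta> \<one>\<^bsub>B\<^esub>)" using hom_one[OF f B(1) G.is_group]
      by simp
    then have "fst (\<eta> b) \<one>\<^bsub>Q\<^esub> = fst (\<eta> \<one>\<^bsub>B\<^esub>) \<one>\<^bsub>Q\<^esub>" using sep \<eta>X[OF b] \<eta>X[OF B.one_closed] by blast
    then have "u b \<one>\<^bsub>Q\<^esub> = u \<one>\<^bsub>B\<^esub> \<one>\<^bsub>Q\<^esub>"
      by (simp add: \<eta>_def)
    then have \<beta>1: "\<beta> b = \<one>\<^bsub>D\<^esub>" using b by (simp add: u_def)
    \<comment> \<open>Only the coordinate at the identity is separated; multiplication by \<open>t\<inverse>\<close> brings the
      coordinate \<open>s0\<inverse>\<close> to this place.\<close>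
    have "\<tau> (\<eta> b \<otimes>\<^bsub>T\<^esub> ti) = \<tau> ti"
      using 1 \<tau>m[OF \<eta>X[OF b] tiX] \<tau>c[OF tiX tiX] by simp
    then have "fst (\<eta> b \<otimes>\<^bsub>T\<^esub> ti) \<one>\<^bsub>Q\<^esub> = fst ti \<one>\<^bsub>Q\<^esub>"
      using sep subgroup.m_closed[OF X \<eta>X[OF b] tiX] tiX by blast
    then have "\<gamma> b = \<one>\<^bsub>D\<^esub>"
      using b s0 by (simp add: \<eta>_def ti_def c1_def mult_twreath u_def split: if_splits)
    with \<beta>1 show "\<beta> b = \<one>\<^bsub>D\<^esub> \<and> \<gamma> b = \<one>\<^bsub>D\<^esub>" by blast
  next
    assume "\<beta> b = \<one>\<^bsub>D\<^esub> \<and> \<gamma> b = \<one>\<^bsub>D\<^esub>"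
    then have "\<eta> b = \<eta> \<one>\<^bsub>B\<^esub>" using b
      by (auto simp: \<eta>_def u_def intro!: restrict_ext)
    then show "(\<tau> \<circ> \<eta>) b = \<one>\<^bsub>G\<^esub>" using hom_one[OF f B(1) G.is_group] by simp
  qed
  then show thesis using that G by blast
qed

end

section \<open>HNN-extensions with normal associated subgroups\<close>

lemma carrier_AutoGroupI:
  assumes "w \<in> extensional (carrier A)" "\<And>a. a \<in> carrier A \<Longrightarrow> w a \<in> carrier A"
    "\<And>a b. a \<in> carrier A \<Longrightarrow> b \<in> carrier A \<Longrightarrow> w (a \<otimes>\<^bsub>A\<^esub> b) = w a \<otimes>\<^bsub>A\<^esub> w b"
    "\<And>a. a \<in> carrier A \<Longrightarrow> v a \<in> carrier A \<and> v (w a) = a \<and> w (v a) = a"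
  shows "w \<in> carrier (AutoGroup A)"
proof -
  have "bij_betw w (carrier A) (carrier A)"
    using assms by (intro bij_betw_byWitness[of _ v]) auto
  then show ?thesis using assms by (auto simp: AutoGroup_def auto_def Bij_def hom_def)
qed

context group begin

definition conj_on :: "'a set \<Rightarrow> 'a \<Rightarrow> 'a \<Rightarrow> 'a" where
  "conj_on N b = (\<lambda>y\<in>N. b \<otimes> y \<otimes> inv b)"

lemma conj_on_hom:
  assumes "N \<lhd> G"
  shows "conj_on N \<in> hom G (AutoGroup (G\<lparr>carrier := N\<rparr>))"
proof -
  interpret N: normal N G by fact
  have cl: "b \<otimes> y \<otimes> inv b \<in> N" "inv b \<otimes> y \<otimes> b \<in> N" if "b \<in> carrier G"
    "y \<in> N" for b y
    using that N.inv_op_closed1 N.inv_op_closed2 by blast+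
  have [simp]: "inv b \<otimes> (b \<otimes> z) = z" "b \<otimes> (inv b \<otimes> z) = z" if "b \<in> carrier G"
    "z \<in> carrier G" for b z
    using that by (simp_all add: m_assoc[symmetric])
  have car: "conj_on N b \<in> carrier (AutoGroup (G\<lparr>carrier := N\<rparr>))" if b: "b \<in> carrier G" for b
  proof (rule carrier_AutoGroupI[where v = "\<lambda>y. inv b \<otimes> y \<otimes> b"])
    show "conj_on N b a \<in> carrier (G\<lparr>carrier := N\<rparr>)"
      if "a \<in> carrier (G\<lparr>carrier := N\<rparr>)" for a
      using that b cl by (simp add: conj_on_def)
    show "inv b \<otimes> a \<otimes> b \<in> carrier (G\<lparr>carrier := N\<rparr>) \<and> inv b \<otimes> conj_on N b a \<otimes> b = a \<and> conj_on N b (inv b \<otimes> a \<otimes> b) = a"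
      if "a \<in> carrier (G\<lparr>carrier := N\<rparr>)" for a
      using that b cl by (simp add: conj_on_def m_assoc)
  qed (use b in \<open>auto simp: conj_on_def m_assoc\<close>)
  show ?thesis
  proof (rule homI)
    fix b c assume bc: "b \<in> carrier G" "c \<in> carrier G"
    show "conj_on N (b \<otimes> c) = conj_on N b \<otimes>\<^bsub>AutoGroup (G\<lparr>carrier := N\<rparr>)\<^esub> conj_on N c"
      using bc cl unfolding AutoGroup_mult[OF car car, OF bc]
      by (auto simp: conj_on_def compose_def inv_mult_group m_assoc intro!: restrict_ext)
  qed (fact car)
qed

lemma Aut_restr_conj_on: "Aut_restr G N = conj_on N ` carrier G"
proof
  show "Aut_restr G N \<subseteq> conj_on N ` carrier G"
  proof
    fix a assume "a \<in> Aut_restr G N"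
    then obtain x where "x \<in> carrier G" "a = (\<lambda>y\<in>N. inv x \<otimes> y \<otimes> x)"
      by (auto simp: Aut_restr_def)
    then show "a \<in> conj_on N ` carrier G" by (intro image_eqI[of _ _ "inv x"]) (auto simp: conj_on_def)
  qed
  show "conj_on N ` carrier G \<subseteq> Aut_restr G N"
  proof
    fix a assume "a \<in> conj_on N ` carrier G"
    then obtain x where "x \<in> carrier G" "a = conj_on N x" by blast
    then have "a = (\<lambda>y\<in>N. inv (inv x) \<otimes> y \<otimes> inv x)" "inv x \<in> carrier G"
      by (auto simp: conj_on_def)
    then show "a \<in> Aut_restr G N" unfolding Aut_restr_def by blast
  qed
qed

end

locale normal_hnn = quotient_closed_root_class \<C> + group B
  for \<C> :: "'u monoid set" and B :: "('b, 'm) monoid_scheme" (structure) +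
  fixes H K :: "'b set" and \<phi> :: "'b \<Rightarrow> 'b"
  assumes small: "carrier B \<lesssim> (UNIV :: 'u set)"
    and HN: "H \<lhd> B" and KN: "K \<lhd> B"
    and \<phi>: "\<phi> \<in> iso (B\<lparr>carrier := H\<rparr>) (B\<lparr>carrier := K\<rparr>)"
    and L: "\<phi> ` (H \<inter> K) = H \<inter> K"
begin

lemma sub: "subgroup H B" "subgroup K B"
  using HN KN normal_imp_subgroup by blast+

lemma \<phi>_inj: "inj_on \<phi> H" and \<phi>_image: "\<phi> ` H = K"
  using \<phi> by (auto simp: iso_def bij_betw_def)

lemma \<phi>_mult: "h \<in> H \<Longrightarrow> h' \<in> H \<Longrightarrow> \<phi> (h \<otimes> h') = \<phi> h \<otimes> \<phi> h'"
  using \<phi> by (auto simp: iso_def hom_def)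

lemma H_car [simp]: "h \<in> H \<Longrightarrow> h \<in> carrier B"
  and K_car [simp]: "k \<in> K \<Longrightarrow> k \<in> carrier B"
  using sub subgroup.mem_carrier by metis+

lemma \<phi>_K [simp]: "h \<in> H \<Longrightarrow> \<phi> h \<in> K"
  using \<phi>_image by blast

lemma H_\<phi>_car: "h \<in> H \<Longrightarrow> h \<in> carrier B \<and> \<phi> h \<in> carrier B"
  by simp

lemma LN: "H \<inter> K \<lhd> B"
  using normal_subgroup_intersect[OF HN KN] .

sublocale hnn B H \<phi>
proof (intro hnn.intro hnn_axioms.intro)
  show "\<phi> \<in> hom (B\<lparr>carrier := H\<rparr>) B"
    using \<phi> subgroup.mem_carrier[OF sub(2)] by (auto simp: iso_def hom_def)
qed (use sub in auto)

sublocale \<phi>: group_hom "B\<lparr>carrier := H\<rparr>" B \<phi>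
  using hom_\<phi> subgroup.subgroup_is_group[OF sub(1) is_group]
  by (simp add: group_hom_def group_hom_axioms_def is_group)

lemma \<phi>_one: "\<phi> \<one> = \<one>" using \<phi>.hom_one by simp

lemma \<phi>_inv: "h \<in> H \<Longrightarrow> \<phi> (inv h) = inv (\<phi> h)"
  using \<phi>.hom_inv[of h] m_inv_consistent[OF sub(1), of h] by simp

lemma conj_H: "b \<in> carrier B \<Longrightarrow> h \<in> H \<Longrightarrow> b \<otimes> h \<otimes> inv b \<in> H"
  and conj_K: "b \<in> carrier B \<Longrightarrow> k \<in> K \<Longrightarrow> b \<otimes> k \<otimes> inv b \<in> K"
  using HN KN normal.inv_op_closed2 by metis+

abbreviation "\<psi> \<equiv> inv_into H \<phi>"

lemma \<psi>\<phi> [simp]: "h \<in> H \<Longrightarrow> \<psi> (\<phi> h) = h"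
  using \<phi>_inj by simp

lemma \<phi>\<psi> [simp]: "k \<in> K \<Longrightarrow> \<phi> (\<psi> k) = k"
  and \<psi>_H [simp]: "k \<in> K \<Longrightarrow> \<psi> k \<in> H"
  using \<phi>_image f_inv_into_f[of k \<phi> H] inv_into_into[of k \<phi> H] by auto

lemma \<phi>_L: "l \<in> H \<Longrightarrow> l \<in> K \<Longrightarrow> \<phi> l \<in> H" using L by blast

lemma \<psi>_L: assumes "l \<in> H" "l \<in> K" shows "\<psi> l \<in> K"
proof -
  obtain l' where "l = \<phi> l'" "l' \<in> H" "l' \<in> K" using L assms by blast
  then show ?thesis by simp
qed

end

locale normal_hnn_epi = normal_hnn \<C> B H K \<phi>
  for \<C> :: "'u monoid set" and B :: "('b, 'm) monoid_scheme" (structure) and H K \<phi> +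
  fixes S :: "'u monoid" and \<sigma> :: "'b \<Rightarrow> 'u"
  assumes S: "S \<in> \<C>" and \<sigma>: "\<sigma> \<in> epi B S" and inj: "inj_on \<sigma> (H <#> K)"
begin

sublocale \<sigma>: group_hom B S \<sigma>
  using \<sigma> member_group[OF S] by (simp add: group_hom_def group_hom_axioms_def epi_def is_group)

lemma H_HK: "H \<subseteq> H <#> K" and K_HK: "K \<subseteq> H <#> K"
proof -
  have "\<one> \<in> H" "\<one> \<in> K" using sub subgroup.one_closed by metis+
  then show "H \<subseteq> H <#> K" "K \<subseteq> H <#> K"
    unfolding set_mult_def by (force simp: H_car K_car)+
qed

lemma inj_H: "inj_on \<sigma> H" and inj_K: "inj_on \<sigma> K"
  using inj inj_on_subset H_HK K_HK by blast+

lemma in_class_if_inj_on: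
  assumes "subgroup N B" "inj_on \<sigma> N"
  shows "in_class (B\<lparr>carrier := N\<rparr>) \<C>"
  using in_class_mono[OF in_class_member[OF iso_closed S] subgroup.subgroup_is_group[OF assms(1) is_group], of \<sigma>]
    assms(2) subgroup.mem_carrier[OF assms(1)] by (auto simp: hom_def)

text \<open>
  Suppose that a pair \<open>(f1, s1)\<close> has, on \<open>B\<close>, the kernel of \<open>\<sigma>\<close> enlarged by \<open>L = H \<inter> K\<close>. The group \<open>L\<close>
  is normalised by \<open>B\<close> and by the stable letter, which act on it through \<open>V\<close>, so \<open>B\<close> modulo the
  kernel of \<open>\<sigma>\<close> embeds into the twisted wreath product of \<open>L\<close> by \<open>Q \<times> V\<close>. The element
  \<open>t0 = (1, s1, \<phi>\<inverse>)\<close> is a first candidate for the stable letter; \<open>h \<mapsto> h\<close> and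
  \<open>h \<mapsto> t0 \<phi>(h) t0\<inverse>\<close> are two embeddings of \<open>H\<close> to which \<open>conjugate_embeddings\<close>
  applies, and correcting \<open>t0\<close> by the conjugating element gives the stable letter.
\<close>

theorem extend_over_intersection:
  assumes V: "in_class (hnn_V B (H \<inter> K) \<phi>) \<C>"
    and Q: "Q \<in> \<C>" and f1: "hnn_hom B H \<phi> Q f1 s1"
    and ker1: "\<And>b. b \<in> carrier B \<Longrightarrow> f1 b = \<one>\<^bsub>Q\<^esub> \<longleftrightarrow> \<sigma> b \<in> \<sigma> ` (H \<inter> K)"
  shows "\<exists>G\<in>\<C>. \<exists>f s. hnn_hom B H \<phi> G f s \<and> (\<forall>b\<in>carrier B. f b = \<one>\<^bsub>G\<^esub> \<longleftrightarrow> \<sigma> b = \<one>\<^bsub>S\<^esub>)"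
proof -
  define L' where "L' = H \<inter> K"
  have subL: "subgroup L' B" and LN': "L' \<lhd> B" using LN normal_imp_subgroup unfolding L'_def by blast+
  have Lc [simp]: "l \<in> carrier B" if "l \<in> L'" for l using that by (simp add: L'_def)
  have injL: "inj_on \<sigma> L'" using inj_H inj_on_subset unfolding L'_def by blast
  define A where "A = B\<lparr>carrier := L'\<rparr>"
  have A: "in_class A \<C>" unfolding A_def using in_class_if_inj_on[OF subL injL] .
  interpret A: group A using in_class_group[OF A] .
  interpret Q: group Q using member_group[OF Q] .
  have Acar [simp]: "carrier A = L'" and Amult [simp]: "x \<otimes>\<^bsub>A\<^esub> y = x \<otimes> y"
    and Aone [simp]: "\<one>\<^bsub>A\<^esub> = \<one>" for x y
    by (simp_all add: A_def)
  interpret Aut: group "AutoGroup A" by (rule A.AutoGroup)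
  define gens where "gens = Aut_restr B L' \<union> generate (AutoGroup A) {restrict \<phi> L'}"
  define W where "W = generate (AutoGroup A) (carrier (AutoGroup A) \<inter> gens)"
  have W: "subgroup W (AutoGroup A)" unfolding W_def using Aut.generate_is_subgroup by blast
  have WC: "in_class ((AutoGroup A)\<lparr>carrier := W\<rparr>) \<C>"
    using V by (simp add: hnn_V_def subgroup_generated_def W_def gens_def A_def L'_def)
  interpret twisted_wreath A Q W
    using W by (simp add: twisted_wreath_def twisted_wreath_axioms_def)
  define \<theta> where "\<theta> = conj_on L'"
  have \<theta>: "\<theta> \<in> hom B (AutoGroup A)" unfolding \<theta>_def A_def using conj_on_hom[OF LN'] .
  have \<theta>a: "\<theta> b \<in> carrier (AutoGroup A)" if "b \<in> carrier B" for b using \<theta> that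
    by (auto simp: hom_def)
  have \<theta>W: "\<theta> b \<in> W" if b: "b \<in> carrier B" for b
    unfolding W_def using \<theta>a[OF b] b
    by (intro generate.incl) (auto simp: gens_def Aut_restr_conj_on \<theta>_def)
  define \<phi>L where "\<phi>L = restrict \<phi> L'"
  have \<phi>L': "\<phi> l \<in> L'" "\<psi> l \<in> L'" if "l \<in> L'" for l
    using that \<phi>_L \<psi>_L by (auto simp: L'_def)
  have \<phi>La: "\<phi>L \<in> carrier (AutoGroup A)"
    by (rule carrier_AutoGroupI[where v = \<psi>])
      (use \<phi>L' subgroup.m_closed[OF subL] in \<open>auto simp: \<phi>L_def \<phi>_mult L'_def\<close>)
  define w where "w = inv\<^bsub>AutoGroup A\<^esub> \<phi>L"
  have wa: "w \<in> carrier (AutoGroup A)" unfolding w_def using \<phi>La by simp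
  have wW: "w \<in> W" unfolding W_def
    by (rule generate.incl) (use wa in \<open>auto simp: gens_def w_def \<phi>L_def intro: generate.inv\<close>)
  have w\<phi>: "w (\<phi> l) = l" if "l \<in> L'" for l
  proof -
    have "(w \<otimes>\<^bsub>AutoGroup A\<^esub> \<phi>L) l = l" unfolding w_def using \<phi>La that
      by (simp add: AutoGroup_one)
    then show ?thesis using that by (simp add: AutoGroup_mult wa \<phi>La compose_def) (simp add: \<phi>L_def)
  qed
  have r: "f1 \<in> hom B Q" and s1: "s1 \<in> carrier Q"
    and c1: "\<And>h. h \<in> H \<Longrightarrow> f1 h \<otimes>\<^bsub>Q\<^esub> s1 = s1 \<otimes>\<^bsub>Q\<^esub> f1 (\<phi> h)"
    using f1 by (auto simp: hnn_hom_def)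
  have f1c [simp]: "f1 b \<in> carrier Q" if "b \<in> carrier B" for b using r that by (auto simp: hom_def)
  define N where "N = kernel B Q f1"
  have N: "n \<in> N \<longleftrightarrow> n \<in> carrier B \<and> \<sigma> n \<in> \<sigma> ` L'" for n
    using ker1 by (auto simp: N_def kernel_def L'_def)
  \<comment> \<open>\<open>\<sigma>\<close> maps the kernel of \<open>f1\<close> onto \<open>\<sigma> L\<close>, which is a copy of \<open>L\<close>.\<close>
  define \<epsilon> where "\<epsilon> = (\<lambda>n. inv_into L' \<sigma> (\<sigma> n))"
  have \<epsilon>: "\<epsilon> n \<in> L'" "\<sigma> (\<epsilon> n) = \<sigma> n" if "n \<in> N" for n
    using that inv_into_into[of "\<sigma> n" \<sigma> L'] f_inv_into_f[of "\<sigma> n" \<sigma> L']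
    by (auto simp: N \<epsilon>_def)
  have \<epsilon>_eq: "\<epsilon> n = l" if "l \<in> L'" "\<sigma> n = \<sigma> l" for n l
    using that injL by (simp add: \<epsilon>_def)
  have \<epsilon>l: "\<epsilon> l = l" if "l \<in> L'" for l using \<epsilon>_eq that by blast
  have LNsub: "L' \<subseteq> N" by (auto simp: N)
  have e: "equivariant_onto B Q f1 A W \<epsilon> \<theta>"
    unfolding equivariant_onto_def N_def[symmetric]
  proof (intro conjI ballI)
    have "\<epsilon> (m \<otimes> n) = \<epsilon> m \<otimes> \<epsilon> n" if "m \<in> N" "n \<in> N" for m n
      using that \<epsilon> subgroup.m_closed[OF subL] by (intro \<epsilon>_eq) (auto simp: N)
    moreover have "\<epsilon> ` N = L'" using \<epsilon> \<epsilon>l LNsub by force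
    ultimately show "\<epsilon> \<in> epi (B\<lparr>carrier := N\<rparr>) A" using \<epsilon>
      by (auto simp: epi_def hom_def)
    show "\<theta> ` carrier B \<subseteq> W" using \<theta>W by blast
    fix b n assume b: "b \<in> carrier B" and n: "n \<in> N"
    have "b \<otimes> \<epsilon> n \<otimes> inv b \<in> L'" using LN' b \<epsilon>(1)[OF n] normal.inv_op_closed2
      by metis
    then have "\<epsilon> (b \<otimes> n \<otimes> inv b) = b \<otimes> \<epsilon> n \<otimes> inv b"
      by (rule \<epsilon>_eq) (use b n \<epsilon>[OF n] in \<open>auto simp: N\<close>)
    then show "\<theta> b (\<epsilon> n) = \<epsilon> (b \<otimes> n \<otimes> inv b)" using \<epsilon>[OF n]
      by (simp add: \<theta>_def conj_on_def)
  qed (fact r \<theta>)+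
  obtain u where \<beta>0: "(\<lambda>b. (u b, f1 b, \<theta> b)) \<in> hom B T"
    and un0: "\<And>n. n \<in> kernel B Q f1 \<Longrightarrow> u n = (\<lambda>y\<in>carrier Q. \<epsilon> n)"
    by (rule krasner_kaloujnine[OF is_group e]) blast
  define \<beta> where "\<beta> = (\<lambda>b. (u b, f1 b, \<theta> b))"
  have \<beta>: "\<beta> \<in> hom B T" using \<beta>0 by (simp add: \<beta>_def)
  have un: "u n = (\<lambda>y\<in>carrier Q. \<epsilon> n)" if "n \<in> N" for n using un0 that by (simp add: N_def)
  interpret \<beta>: group_hom B T \<beta> using \<beta> by (simp add: group_hom_def group_hom_axioms_def is_group)
  have u_car: "u b \<in> carrier Q \<rightarrow>\<^sub>E L'" if "b \<in> carrier B" for b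
    using \<beta>.hom_closed[OF that] by (simp add: \<beta>_def carrier_twreath)
  define t0 where "t0 = (\<lambda>y\<in>carrier Q. \<one>\<^bsub>A\<^esub>, s1, w)"
  have t0: "t0 \<in> carrier T" using s1 wW A.one_closed by (auto simp: t0_def carrier_twreath simp del: Aone)
  have w\<theta>: "\<theta> h \<otimes>\<^bsub>AutoGroup A\<^esub> w = w \<otimes>\<^bsub>AutoGroup A\<^esub> \<theta> (\<phi> h)" if h: "h \<in> H" for h
  proof (rule AutoGroup_eqI)
    show "\<theta> h \<otimes>\<^bsub>AutoGroup A\<^esub> w \<in> carrier (AutoGroup A)"
      "w \<otimes>\<^bsub>AutoGroup A\<^esub> \<theta> (\<phi> h) \<in> carrier (AutoGroup A)"
      using h wa \<theta>a by auto
    fix a assume "a \<in> carrier A"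
    then have "a \<in> L'" by simp
    then obtain l where l: "l \<in> L'" "a = \<phi> l" using L unfolding L'_def by blast
    have hl: "h \<otimes> l \<otimes> inv h \<in> L'" using LN' h l normal.inv_op_closed2 H_car by metis
    have lH: "l \<in> H" "inv h \<in> H" "h \<otimes> l \<in> H"
      using l h subgroup.m_closed[OF sub(1)] subgroup.m_inv_closed[OF sub(1)] by (auto simp: L'_def)
    have "(w \<otimes>\<^bsub>AutoGroup A\<^esub> \<theta> (\<phi> h)) a = w (\<phi> (h \<otimes> l \<otimes> inv h))"
      using h l lH \<phi>L' by (simp add: AutoGroup_mult wa \<theta>a compose_def) (simp add: \<theta>_def conj_on_def \<phi>_mult \<phi>_inv)
    also have "\<dots> = h \<otimes> l \<otimes> inv h" using w\<phi>[OF hl] .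
    also have "\<dots> = (\<theta> h \<otimes>\<^bsub>AutoGroup A\<^esub> w) a"
      using h l \<phi>L' w\<phi> by (simp add: AutoGroup_mult wa \<theta>a compose_def) (simp add: \<theta>_def conj_on_def)
    finally show "(\<theta> h \<otimes>\<^bsub>AutoGroup A\<^esub> w) a = (w \<otimes>\<^bsub>AutoGroup A\<^esub> \<theta> (\<phi> h)) a" by simp
  qed
  define \<eta>2 where "\<eta>2 = (\<lambda>h. t0 \<otimes>\<^bsub>T\<^esub> \<beta> (\<phi> h) \<otimes>\<^bsub>T\<^esub> inv\<^bsub>T\<^esub> t0)"
  let ?H = "B\<lparr>carrier := H\<rparr>"
  have gH: "group ?H" using subgroup.subgroup_is_group[OF sub(1) is_group] .
  have \<eta>2c: "\<eta>2 h \<in> carrier T" if "h \<in> H" for h using t0 that by (simp add: \<eta>2_def)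
  have \<eta>2t: "\<eta>2 h \<otimes>\<^bsub>T\<^esub> t0 = t0 \<otimes>\<^bsub>T\<^esub> \<beta> (\<phi> h)"
    if "h \<in> H" for h
    using t0 that by (simp add: \<eta>2_def T.m_assoc)
  have h1: "\<beta> \<in> hom ?H T" using \<beta> by (auto simp: hom_def)
  have h2: "\<eta>2 \<in> hom ?H T"
  proof (rule homI)
    fix x y assume "x \<in> carrier ?H" "y \<in> carrier ?H"
    then have xy: "x \<in> H" "y \<in> H" by auto
    have "\<eta>2 x \<otimes>\<^bsub>T\<^esub> \<eta>2 y = \<eta>2 x \<otimes>\<^bsub>T\<^esub> t0 \<otimes>\<^bsub>T\<^esub> \<beta> (\<phi> y) \<otimes>\<^bsub>T\<^esub> inv\<^bsub>T\<^esub> t0"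
    proof -
      have "inv\<^bsub>T\<^esub> t0 \<otimes>\<^bsub>T\<^esub> (t0 \<otimes>\<^bsub>T\<^esub> c) = c"
        if "c \<in> carrier T" for c
        using that t0 by (simp add: T.m_assoc[symmetric])
      then show ?thesis using xy t0 by (simp add: \<eta>2_def T.m_assoc)
    qed
    also have "\<dots> = \<eta>2 (x \<otimes> y)"
      unfolding \<eta>2t[OF xy(1)] using xy t0 by (simp add: \<eta>2_def \<phi>_mult T.m_assoc)
    finally show "\<eta>2 (x \<otimes>\<^bsub>?H\<^esub> y) = \<eta>2 x \<otimes>\<^bsub>T\<^esub> \<eta>2 y" by simp
  qed (use \<eta>2c in simp)
  have snd: "snd (\<beta> h) = snd (\<eta>2 h)" if "h \<in> carrier ?H" for h
  proof -
    have h: "h \<in> H" using that by simp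
    obtain v q w' where \<eta>h: "\<eta>2 h = (v, q, w')" by (rule prod_cases3)
    have qw: "q \<in> carrier Q" "w' \<in> W" using \<eta>2c[OF h] unfolding \<eta>h carrier_twreath by auto
    have "q \<otimes>\<^bsub>Q\<^esub> s1 = f1 h \<otimes>\<^bsub>Q\<^esub> s1"
      "w' \<otimes>\<^bsub>AutoGroup A\<^esub> w = \<theta> h \<otimes>\<^bsub>AutoGroup A\<^esub> w"
      using \<eta>2t[OF h] unfolding \<eta>h t0_def \<beta>_def mult_twreath w\<theta>[OF h] c1[OF h] by auto
    then have "q = f1 h" "w' = \<theta> h" using qw s1 h wa \<theta>a W_auto by auto
    then show ?thesis unfolding \<eta>h \<beta>_def by simp
  qed
  have ker: "\<beta> h = \<eta>2 h" if "h \<in> carrier ?H" "fst (snd (\<beta> h)) = \<one>\<^bsub>Q\<^esub>" for h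
  proof -
    have h: "h \<in> H" and f1h: "f1 h = \<one>\<^bsub>Q\<^esub>" using that by (simp_all add: \<beta>_def)
    then have "\<sigma> h \<in> \<sigma> ` L'" using ker1 by (simp add: L'_def)
    then obtain l where "l \<in> L'" "\<sigma> h = \<sigma> l" by blast
    then have hL: "h \<in> L'" using inj_onD[OF inj_H, of h l] h by (simp add: L'_def)
    have uh: "u h = (\<lambda>y\<in>carrier Q. h)" "u (\<phi> h) = (\<lambda>y\<in>carrier Q. \<phi> h)"
      using un[of h] un[of "\<phi> h"] \<epsilon>l[OF hL] \<epsilon>l[OF \<phi>L'(1)[OF hL]] LNsub hL \<phi>L'(1)[OF hL] by auto
    have "t0 \<otimes>\<^bsub>T\<^esub> \<beta> (\<phi> h) = \<beta> h \<otimes>\<^bsub>T\<^esub> t0"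
      unfolding t0_def \<beta>_def mult_twreath uh
      using c1[OF h] w\<theta>[OF h] w\<phi>[OF hL] s1 h hL \<theta>W[of h] W_hom(3)[of "\<theta> h"]
      by (auto intro!: restrict_ext)
    then show ?thesis using t0 h by (simp add: \<eta>2_def T.m_assoc)
  qed
  obtain z where z: "z \<in> carrier Q \<rightarrow>\<^sub>E carrier A"
    and zc: "\<And>h. h \<in> carrier ?H \<Longrightarrow> \<eta>2 h \<otimes>\<^bsub>T\<^esub> (z, \<one>\<^bsub>Q\<^esub>, \<one>\<^bsub>AutoGroup A\<^esub>) = (z, \<one>\<^bsub>Q\<^esub>, \<one>\<^bsub>AutoGroup A\<^esub>) \<otimes>\<^bsub>T\<^esub> \<beta> h"
    by (rule conjugate_embeddings[OF gH h1 h2 snd ker]) blast+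
  define Z where "Z = (z, \<one>\<^bsub>Q\<^esub>, \<one>\<^bsub>AutoGroup A\<^esub>)"
  have Z: "Z \<in> carrier T" using z by (simp add: Z_def carrier_twreath)
  define t where "t = inv\<^bsub>T\<^esub> Z \<otimes>\<^bsub>T\<^esub> t0"
  have t: "t \<in> carrier T" using Z t0 by (simp add: t_def)
  have "\<beta> h \<otimes>\<^bsub>T\<^esub> t = t \<otimes>\<^bsub>T\<^esub> \<beta> (\<phi> h)"
    if h: "h \<in> H" for h
  proof -
    have "\<eta>2 h \<otimes>\<^bsub>T\<^esub> Z = Z \<otimes>\<^bsub>T\<^esub> \<beta> h" using zc h
      by (simp add: Z_def)
    then have "\<beta> h = inv\<^bsub>T\<^esub> Z \<otimes>\<^bsub>T\<^esub> \<eta>2 h \<otimes>\<^bsub>T\<^esub> Z"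
      using Z h \<eta>2c[OF h] by (simp add: T.m_assoc) (simp add: T.m_assoc[symmetric])
    moreover have "Z \<otimes>\<^bsub>T\<^esub> t = t0" using Z t0 by (simp add: t_def T.m_assoc[symmetric])
    ultimately have "\<beta> h \<otimes>\<^bsub>T\<^esub> t = inv\<^bsub>T\<^esub> Z \<otimes>\<^bsub>T\<^esub> (\<eta>2 h \<otimes>\<^bsub>T\<^esub> t0)"
      using Z t \<eta>2c[OF h] by (simp add: T.m_assoc)
    also have "\<dots> = inv\<^bsub>T\<^esub> Z \<otimes>\<^bsub>T\<^esub> (t0 \<otimes>\<^bsub>T\<^esub> \<beta> (\<phi> h))"
      using \<eta>2t[OF h] by simp
    also have "\<dots> = t \<otimes>\<^bsub>T\<^esub> \<beta> (\<phi> h)" using Z t0 h by (simp add: t_def T.m_assoc)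
    finally show ?thesis .
  qed
  then have "hnn_hom B H \<phi> T \<beta> t" using \<beta> t by (simp add: hnn_hom_def)
  from gruenberg_hnn[OF A in_class_member[OF iso_closed Q] W WC small this H_\<phi>_car]
  obtain G \<tau> X where G: "G \<in> \<C>" and f: "hnn_hom B H \<phi> G (\<tau> \<circ> \<beta>) (\<tau> t)"
    and \<beta>X: "\<beta> ` carrier B \<subseteq> X"
    and sep: "\<forall>x\<in>X. \<forall>y\<in>X. \<tau> x = \<tau> y \<longrightarrow> snd x = snd y \<and> fst x \<one>\<^bsub>Q\<^esub> = fst y \<one>\<^bsub>Q\<^esub>"
    by blast
  have fh: "\<tau> \<circ> \<beta> \<in> hom B G" using f by (simp add: hnn_hom_def)
  have f1': "(\<tau> \<circ> \<beta>) \<one> = \<one>\<^bsub>G\<^esub>"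
    using hom_one[OF fh is_group member_group[OF G]] .
  have "(\<tau> \<circ> \<beta>) b = \<one>\<^bsub>G\<^esub> \<longleftrightarrow> \<sigma> b = \<one>\<^bsub>S\<^esub>" if b: "b \<in> carrier B" for b
  proof
    assume "(\<tau> \<circ> \<beta>) b = \<one>\<^bsub>G\<^esub>"
    then have "\<tau> (\<beta> b) = \<tau> (\<beta> \<one>)" using f1' by simp
    then have *: "snd (\<beta> b) = snd (\<beta> \<one>)"
      "fst (\<beta> b) \<one>\<^bsub>Q\<^esub> = fst (\<beta> \<one>) \<one>\<^bsub>Q\<^esub>"
      using sep \<beta>X b by blast+
    have "f1 b = \<one>\<^bsub>Q\<^esub>" "u b \<one>\<^bsub>Q\<^esub> = \<one>" using * unfolding \<beta>.hom_one
      by (auto simp: \<beta>_def one_twreath)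
    then have "b \<in> N" using b by (simp add: N_def kernel_def)
    then have "\<epsilon> b = \<one>" "\<sigma> (\<epsilon> b) = \<sigma> b" using un[of b] \<open>u b \<one>\<^bsub>Q\<^esub> = \<one>\<close> \<epsilon>(2)[of b] by simp_all
    then show "\<sigma> b = \<one>\<^bsub>S\<^esub>" using \<sigma>.hom_one by simp
  next
    assume \<sigma>b: "\<sigma> b = \<one>\<^bsub>S\<^esub>"
    have 1: "\<one> \<in> L'" using subgroup.one_closed[OF subL] .
    have eq: "\<sigma> b = \<sigma> \<one>" using \<sigma>b by simp
    have bN: "b \<in> N" "\<one> \<in> N" using b imageI[OF 1, of \<sigma>] eq by (simp_all add: N)
    have "\<epsilon> b = \<one>" "\<epsilon> \<one> = \<one>" using \<epsilon>_eq[OF 1 eq] \<epsilon>_eq[OF 1] by auto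
    then have "u b = u \<one>" using un bN by simp
    moreover have "f1 b = f1 \<one>" using bN by (simp add: N_def kernel_def)
    moreover have "\<theta> b = \<theta> \<one>"
    proof (rule AutoGroup_eqI[OF \<theta>a \<theta>a])
      fix a assume "a \<in> carrier A"
      then have a: "a \<in> L'" by simp
      have "b \<otimes> a \<otimes> inv b \<in> L'" using LN' b a normal.inv_op_closed2 by metis
      moreover have "\<sigma> (b \<otimes> a \<otimes> inv b) = \<sigma> a" using a b \<sigma>b by simp
      ultimately have "b \<otimes> a \<otimes> inv b = a" using a injL by (simp add: inj_on_eq_iff)
      then show "\<theta> b a = \<theta> \<one> a" using a by (simp add: \<theta>_def conj_on_def)
    qed (use b in auto)
    ultimately have "\<beta> b = \<beta> \<one>" by (simp add: \<beta>_def)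
    then show "(\<tau> \<circ> \<beta>) b = \<one>\<^bsub>G\<^esub>" using f1' by simp
  qed
  then show ?thesis using G f by blast
qed

end

section \<open>Extending a homomorphism of the base group\<close>

lemma (in normal) induced_automorphism:
  defines "P \<equiv> {\<alpha> \<in> carrier (AutoGroup G). \<alpha> ` H = H}"
    and "ind \<equiv> (\<lambda>\<alpha>. \<lambda>c\<in>carrier (G Mod H). \<alpha> ` c)"
  shows "subgroup P (AutoGroup G)"
    and "ind \<in> hom ((AutoGroup G)\<lparr>carrier := P\<rparr>) (AutoGroup (G Mod H))"
    and "\<And>\<alpha> x. \<alpha> \<in> P \<Longrightarrow> x \<in> carrier G \<Longrightarrow> ind \<alpha> (H #> x) = H #> \<alpha> x"
proof -
  interpret Aut: group "AutoGroup G" by (rule AutoGroup)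
  have hom: "\<alpha> (x \<otimes> y) = \<alpha> x \<otimes> \<alpha> y" "\<alpha> x \<in> carrier G"
    if "\<alpha> \<in> P" "x \<in> carrier G" "y \<in> carrier G" for \<alpha> x y
    using that auto_D(1)[of \<alpha> G] by (auto simp: P_def hom_def)
  show P: "subgroup P (AutoGroup G)"
  proof (rule Aut.subgroupI)
    show "P \<noteq> {}" using Aut.one_closed subset by (force simp: P_def AutoGroup_one)
    fix \<alpha> assume \<alpha>: "\<alpha> \<in> P"
    then have a: "\<alpha> \<in> carrier (AutoGroup G)" "\<alpha> ` H = H" by (auto simp: P_def)
    have "(inv\<^bsub>AutoGroup G\<^esub> \<alpha>) (\<alpha> x) = x" if "x \<in> carrier G" for x
    proof -
      have "(inv\<^bsub>AutoGroup G\<^esub> \<alpha> \<otimes>\<^bsub>AutoGroup G\<^esub> \<alpha>) x = x"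
        using a that by (simp add: AutoGroup_one)
      then show ?thesis using a that by (simp add: AutoGroup_mult compose_def)
    qed
    then have "(inv\<^bsub>AutoGroup G\<^esub> \<alpha>) ` \<alpha> ` H = H" using subset by (force simp: image_iff)
    then show "inv\<^bsub>AutoGroup G\<^esub> \<alpha> \<in> P" using a by (simp add: P_def)
    fix \<beta> assume "\<beta> \<in> P"
    then have b: "\<beta> \<in> carrier (AutoGroup G)" "\<beta> ` H = H" by (auto simp: P_def)
    have "(\<alpha> \<otimes>\<^bsub>AutoGroup G\<^esub> \<beta>) ` H = (\<lambda>x. \<alpha> (\<beta> x)) ` H"
      using a b subset by (intro image_cong) (auto simp: AutoGroup_mult compose_def)
    also have "\<dots> = H" using a(2) b(2) by (metis image_image)
    finally show "\<alpha> \<otimes>\<^bsub>AutoGroup G\<^esub> \<beta> \<in> P" using a b by (simp add: P_def)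
  qed (auto simp: P_def)
  show img: "ind \<alpha> (H #> x) = H #> \<alpha> x" if \<alpha>: "\<alpha> \<in> P"
    and x: "x \<in> carrier G" for \<alpha> x
  proof -
    have "\<alpha> ` (H #> x) = (\<lambda>h. \<alpha> h \<otimes> \<alpha> x) ` H"
      unfolding r_coset_def using hom[OF \<alpha> _ x] mem_carrier by (auto simp: image_iff)
    also have "\<dots> = (\<lambda>h. h \<otimes> \<alpha> x) ` \<alpha> ` H" by (simp add: image_image)
    also have "\<dots> = H #> \<alpha> x" using \<alpha> by (auto simp: r_coset_def P_def)
    finally show ?thesis using x by (auto simp: ind_def carrier_FactGroup)
  qed
  interpret F: group "G Mod H" by (rule factorgroup_is_group)
  have car: "ind \<alpha> \<in> carrier (AutoGroup (G Mod H))" if \<alpha>: "\<alpha> \<in> P" for \<alpha>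
  proof (rule carrier_AutoGroupI[where v = "ind (inv\<^bsub>AutoGroup G\<^esub> \<alpha>)"])
    have \<alpha>a: "\<alpha> \<in> carrier (AutoGroup G)" using \<alpha> by (simp add: P_def)
    have i: "inv\<^bsub>AutoGroup G\<^esub> \<alpha> \<in> P" using subgroup.m_inv_closed[OF P \<alpha>] .
    have ii: "(inv\<^bsub>AutoGroup G\<^esub> \<alpha>) (\<alpha> x) = x"
      "\<alpha> ((inv\<^bsub>AutoGroup G\<^esub> \<alpha>) x) = x" if x: "x \<in> carrier G" for x
    proof -
      have "(inv\<^bsub>AutoGroup G\<^esub> \<alpha> \<otimes>\<^bsub>AutoGroup G\<^esub> \<alpha>) x = x"
        "(\<alpha> \<otimes>\<^bsub>AutoGroup G\<^esub> inv\<^bsub>AutoGroup G\<^esub> \<alpha>) x = x"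
        using \<alpha>a x by (simp_all add: AutoGroup_one)
      then show "(inv\<^bsub>AutoGroup G\<^esub> \<alpha>) (\<alpha> x) = x"
        "\<alpha> ((inv\<^bsub>AutoGroup G\<^esub> \<alpha>) x) = x"
        using \<alpha>a x by (simp_all add: AutoGroup_mult compose_def)
    qed
    show "ind \<alpha> \<in> extensional (carrier (G Mod H))" by (simp add: ind_def)
    fix a assume "a \<in> carrier (G Mod H)"
    then obtain x where x: "x \<in> carrier G" "a = H #> x" by (auto simp: carrier_FactGroup)
    show "ind \<alpha> a \<in> carrier (G Mod H)"
      using x \<alpha> img hom(2)[OF \<alpha> x(1) x(1)] by (auto simp: carrier_FactGroup)
    show "ind (inv\<^bsub>AutoGroup G\<^esub> \<alpha>) a \<in> carrier (G Mod H) \<and> ind (inv\<^bsub>AutoGroup G\<^esub> \<alpha>) (ind \<alpha> a) = a \<and> ind \<alpha> (ind (inv\<^bsub>AutoGroup G\<^esub> \<alpha>) a) = a"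
      using x \<alpha> i img hom(2)[OF \<alpha> x(1) x(1)] hom(2)[OF i x(1) x(1)] ii by (auto simp: carrier_FactGroup)
    fix b assume "b \<in> carrier (G Mod H)"
    then obtain y where y: "y \<in> carrier G" "b = H #> y" by (auto simp: carrier_FactGroup)
    show "ind \<alpha> (a \<otimes>\<^bsub>G Mod H\<^esub> b) = ind \<alpha> a \<otimes>\<^bsub>G Mod H\<^esub> ind \<alpha> b"
      using x y \<alpha> img hom[OF \<alpha> x(1) y(1)] hom(2)[OF \<alpha> y(1) y(1)] by (simp add: rcos_sum)
  qed
  show "ind \<in> hom ((AutoGroup G)\<lparr>carrier := P\<rparr>) (AutoGroup (G Mod H))"
  proof (rule homI)
    fix \<alpha> \<beta> assume ab: "\<alpha> \<in> carrier ((AutoGroup G)\<lparr>carrier := P\<rparr>)"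
    "\<beta> \<in> carrier ((AutoGroup G)\<lparr>carrier := P\<rparr>)"
    then have ab': "\<alpha> \<in> P" "\<beta> \<in> P" by auto
    have m: "\<alpha> \<otimes>\<^bsub>AutoGroup G\<^esub> \<beta> \<in> P" using subgroup.m_closed[OF P ab'] .
    have "ind (\<alpha> \<otimes>\<^bsub>AutoGroup G\<^esub> \<beta>) = ind \<alpha> \<otimes>\<^bsub>AutoGroup (G Mod H)\<^esub> ind \<beta>"
    proof (rule AutoGroup_eqI)
      show "ind (\<alpha> \<otimes>\<^bsub>AutoGroup G\<^esub> \<beta>) \<in> carrier (AutoGroup (G Mod H))"
        using car m .
      show "ind \<alpha> \<otimes>\<^bsub>AutoGroup (G Mod H)\<^esub> ind \<beta> \<in> carrier (AutoGroup (G Mod H))"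
        using car ab' group.is_monoid[OF F.AutoGroup] monoid.m_closed by metis
      fix a assume "a \<in> carrier (G Mod H)"
      then obtain x where x: "x \<in> carrier G" "a = H #> x" by (auto simp: carrier_FactGroup)
      have "(\<alpha> \<otimes>\<^bsub>AutoGroup G\<^esub> \<beta>) x = \<alpha> (\<beta> x)"
        using ab' x by (simp add: P_def AutoGroup_mult compose_def)
      then show "ind (\<alpha> \<otimes>\<^bsub>AutoGroup G\<^esub> \<beta>) a = (ind \<alpha> \<otimes>\<^bsub>AutoGroup (G Mod H)\<^esub> ind \<beta>) a"
        using x img[OF m x(1)] img[OF ab'(2) x(1)] img[OF ab'(1) hom(2)[OF ab'(2) x(1) x(1)]]
        by (auto simp: AutoGroup_mult car ab' compose_def carrier_FactGroup)
    qed
    then show "ind (\<alpha> \<otimes>\<^bsub>(AutoGroup G)\<lparr>carrier := P\<rparr>\<^esub> \<beta>) = ind \<alpha> \<otimes>\<^bsub>AutoGroup (G Mod H)\<^esub> ind \<beta>" by simp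
  qed (use car in simp)
qed

lemma transport_automorphism:
  assumes "group G" "group G'" "f \<in> iso G G'"
  shows "(\<lambda>\<alpha>. \<lambda>x\<in>carrier G. inv_into (carrier G) f (\<alpha> (f x))) \<in> hom (AutoGroup G') (AutoGroup G)"
proof -
  interpret G: group G by fact
  interpret G': group G' by fact
  interpret Aut: group "AutoGroup G'" by (rule G'.AutoGroup)
  define g where "g = inv_into (carrier G) f"
  have g: "g \<in> iso G' G" unfolding g_def using G.iso_set_sym[OF assms(3)] .
  have fg: "f (g y) = y" "g y \<in> carrier G" if "y \<in> carrier G'" for y
    using assms(3) that by (auto simp: g_def iso_def bij_betw_def f_inv_into_f inv_into_into)
  have gf: "g (f x) = x" "f x \<in> carrier G'" if "x \<in> carrier G" for x
    using assms(3) that by (auto simp: g_def iso_def bij_betw_def)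
  have gm: "g (y \<otimes>\<^bsub>G'\<^esub> y') = g y \<otimes>\<^bsub>G\<^esub> g y'" if "y \<in> carrier G'"
    "y' \<in> carrier G'" for y y'
    using g that by (auto simp: iso_def hom_def)
  have fm: "f (y \<otimes>\<^bsub>G\<^esub> y') = f y \<otimes>\<^bsub>G'\<^esub> f y'" if "y \<in> carrier G"
    "y' \<in> carrier G" for y y'
    using assms(3) that by (auto simp: iso_def hom_def)
  define tr where "tr = (\<lambda>\<alpha>. \<lambda>x\<in>carrier G. g (\<alpha> (f x)))"
  have c: "\<alpha> y \<in> carrier G'" if "\<alpha> \<in> carrier (AutoGroup G')" "y \<in> carrier G'" for \<alpha> y
    using auto_D(1)[OF that(1)] that(2) by (auto simp: hom_def)
  have am: "\<alpha> (y \<otimes>\<^bsub>G'\<^esub> y') = \<alpha> y \<otimes>\<^bsub>G'\<^esub> \<alpha> y'"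
    if "\<alpha> \<in> carrier (AutoGroup G')" "y \<in> carrier G'" "y' \<in> carrier G'" for \<alpha> y y'
    using auto_D(1)[OF that(1)] that(2,3) by (auto simp: hom_def)
  have car: "tr \<alpha> \<in> carrier (AutoGroup G)"
    if \<alpha>: "\<alpha> \<in> carrier (AutoGroup G')" for \<alpha>
  proof (rule carrier_AutoGroupI[where v = "tr (inv\<^bsub>AutoGroup G'\<^esub> \<alpha>)"])
    have i: "inv\<^bsub>AutoGroup G'\<^esub> \<alpha> \<in> carrier (AutoGroup G')" using \<alpha> by simp
    have ii: "(inv\<^bsub>AutoGroup G'\<^esub> \<alpha>) (\<alpha> x) = x"
      "\<alpha> ((inv\<^bsub>AutoGroup G'\<^esub> \<alpha>) x) = x" if x: "x \<in> carrier G'" for x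
    proof -
      have "(inv\<^bsub>AutoGroup G'\<^esub> \<alpha> \<otimes>\<^bsub>AutoGroup G'\<^esub> \<alpha>) x = x"
        "(\<alpha> \<otimes>\<^bsub>AutoGroup G'\<^esub> inv\<^bsub>AutoGroup G'\<^esub> \<alpha>) x = x"
        using \<alpha> x by (simp_all add: AutoGroup_one)
      then show "(inv\<^bsub>AutoGroup G'\<^esub> \<alpha>) (\<alpha> x) = x"
        "\<alpha> ((inv\<^bsub>AutoGroup G'\<^esub> \<alpha>) x) = x"
        using \<alpha> x by (simp_all add: AutoGroup_mult compose_def)
    qed
    show "tr \<alpha> \<in> extensional (carrier G)" by (simp add: tr_def)
    fix a assume a: "a \<in> carrier G"
    show "tr \<alpha> a \<in> carrier G" using a \<alpha> c fg gf by (simp add: tr_def)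
    show "tr (inv\<^bsub>AutoGroup G'\<^esub> \<alpha>) a \<in> carrier G \<and> tr (inv\<^bsub>AutoGroup G'\<^esub> \<alpha>) (tr \<alpha> a) = a \<and> tr \<alpha> (tr (inv\<^bsub>AutoGroup G'\<^esub> \<alpha>) a) = a"
      using a \<alpha> i c fg gf ii by (simp add: tr_def)
    fix b assume b: "b \<in> carrier G"
    show "tr \<alpha> (a \<otimes>\<^bsub>G\<^esub> b) = tr \<alpha> a \<otimes>\<^bsub>G\<^esub> tr \<alpha> b"
      using a b am[OF \<alpha> gf(2)[OF a] gf(2)[OF b]] c[OF \<alpha> gf(2)] gm fm by (simp add: tr_def)
  qed
  have "tr \<in> hom (AutoGroup G') (AutoGroup G)"
  proof (rule homI)
    fix \<alpha> \<beta> assume ab: "\<alpha> \<in> carrier (AutoGroup G')" "\<beta> \<in> carrier (AutoGroup G')"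
    show "tr (\<alpha> \<otimes>\<^bsub>AutoGroup G'\<^esub> \<beta>) = tr \<alpha> \<otimes>\<^bsub>AutoGroup G\<^esub> tr \<beta>"
      unfolding AutoGroup_mult[OF ab] AutoGroup_mult[OF car car, OF ab]
      using ab c fg gf by (auto simp: tr_def compose_def intro!: restrict_ext)
  qed (fact car)
  then show ?thesis by (simp add: tr_def g_def)
qed

context normal_hnn_epi begin

definition "HK_preimage = {n \<in> carrier B. \<sigma> n \<in> \<sigma> ` (H <#> K)}"

text \<open>
  The product \<open>M1 M2\<close> is direct modulo \<open>M1 \<inter> M2\<close>, and \<open>\<sigma>\<close> is injective on \<open>M1 M2\<close>. Hence a homomorphism of \<open>M1\<close>
  that kills \<open>M1 \<inter> M2\<close> extends, by killing \<open>M2\<close> as well, to the preimage under \<open>\<sigma>\<close> of the image of \<open>M1 M2\<close>.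
  It is used for \<open>H, K\<close> and for \<open>K, H\<close>.
\<close>

lemma projection:
  assumes M: "M1 \<lhd> B" "M2 \<lhd> B" "M1 <#> M2 = H <#> K"
    and A: "group A" and E: "E \<in> epi (B\<lparr>carrier := M1\<rparr>) A"
      "\<And>m. m \<in> M1 \<Longrightarrow> m \<in> M2 \<Longrightarrow> E m = \<one>\<^bsub>A\<^esub>"
  obtains \<epsilon> where "\<epsilon> \<in> epi (B\<lparr>carrier := HK_preimage\<rparr>) A"
    "\<And>n m1 m2. m1 \<in> M1 \<Longrightarrow> m2 \<in> M2 \<Longrightarrow> \<sigma> n = \<sigma> (m1 \<otimes> m2) \<Longrightarrow> \<epsilon> n = E m1"
proof -
  interpret M1: normal M1 B by fact
  interpret M2: normal M2 B by fact
  interpret A: group A by fact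
  have g1: "group (B\<lparr>carrier := M1\<rparr>)" using M1.subgroup_is_group is_group by blast
  interpret E: group_hom "B\<lparr>carrier := M1\<rparr>" A E
    using E(1) g1 A by (simp add: group_hom_def group_hom_axioms_def epi_def)
  have Einv: "E (inv m) = inv\<^bsub>A\<^esub> E m" if "m \<in> M1" for m
    using E.hom_inv[of m] m_inv_consistent[OF M1.subgroup_axioms that] that by simp
  have Em: "E (m \<otimes> m') = E m \<otimes>\<^bsub>A\<^esub> E m'" if "m \<in> M1" "m' \<in> M1" for m m'
    using E.hom_mult[of m m'] that by simp
  have Ec [simp]: "E m \<in> carrier A" if "m \<in> M1" for m using E.hom_closed[of m] that by simp
  have HK: "m1 \<otimes> m2 \<in> H <#> K" if "m1 \<in> M1" "m2 \<in> M2" for m1 m2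
    using that M(3) unfolding set_mult_def by blast
  have uniq: "E m1 = E m1'"
    if m: "m1 \<in> M1" "m2 \<in> M2" "m1' \<in> M1" "m2' \<in> M2"
    and eq: "\<sigma> (m1 \<otimes> m2) = \<sigma> (m1' \<otimes> m2')" for m1 m2 m1' m2'
  proof -
    have "m1 \<otimes> m2 = m1' \<otimes> m2'" using inj_onD[OF inj eq HK HK] m by blast
    then have "inv m1' \<otimes> (m1 \<otimes> m2) \<otimes> inv m2 = inv m1' \<otimes> (m1' \<otimes> m2') \<otimes> inv m2" by simp
    moreover have "inv m1' \<otimes> (m1 \<otimes> m2) \<otimes> inv m2 = inv m1' \<otimes> m1"
      "inv m1' \<otimes> (m1' \<otimes> m2') = m2'"
    proof -
      have "m1 \<otimes> m2 \<otimes> inv m2 = m1" using m by (simp add: m_assoc)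
      then show "inv m1' \<otimes> (m1 \<otimes> m2) \<otimes> inv m2 = inv m1' \<otimes> m1" using m
        by (simp add: m_assoc)
      show "inv m1' \<otimes> (m1' \<otimes> m2') = m2'" using m by (simp add: m_assoc[symmetric])
    qed
    ultimately have e: "inv m1' \<otimes> m1 = m2' \<otimes> inv m2" by simp
    have "inv m1' \<otimes> m1 \<in> M1" using m by simp
    moreover have "inv m1' \<otimes> m1 \<in> M2" unfolding e using m by simp
    ultimately have "inv\<^bsub>A\<^esub> E m1' \<otimes>\<^bsub>A\<^esub> E m1 = \<one>\<^bsub>A\<^esub>"
      using E(2) m by (simp flip: Em Einv)
    then show ?thesis using m by (metis A.inv_equality A.inv_inv A.inv_closed Ec)
  qed
  define \<epsilon> where "\<epsilon> = (\<lambda>n. E (SOME m1. m1 \<in> M1 \<and> (\<exists>m2\<in>M2. \<sigma> n = \<sigma> (m1 \<otimes> m2))))"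
  have \<epsilon>: "\<epsilon> n = E m1" if m: "m1 \<in> M1" "m2 \<in> M2"
    "\<sigma> n = \<sigma> (m1 \<otimes> m2)" for n m1 m2
  proof -
    have ex: "\<exists>m1. m1 \<in> M1 \<and> (\<exists>m2\<in>M2. \<sigma> n = \<sigma> (m1 \<otimes> m2))" using m
      by blast
    define p where "p = (SOME m1. m1 \<in> M1 \<and> (\<exists>m2\<in>M2. \<sigma> n = \<sigma> (m1 \<otimes> m2)))"
    have "p \<in> M1 \<and> (\<exists>m2\<in>M2. \<sigma> n = \<sigma> (p \<otimes> m2))" unfolding p_def
      by (rule someI_ex[OF ex])
    then obtain m2' where "p \<in> M1" "m2' \<in> M2" "\<sigma> n = \<sigma> (p \<otimes> m2')" by blast
    then have "E p = E m1" using m by (intro uniq[of p m2' m1 m2]) auto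
    then show ?thesis by (simp add: \<epsilon>_def p_def)
  qed
  have ex: "\<exists>m1\<in>M1. \<exists>m2\<in>M2. \<sigma> n = \<sigma> (m1 \<otimes> m2)"
    if n: "n \<in> HK_preimage" for n
  proof -
    obtain x where "x \<in> M1 <#> M2" "\<sigma> n = \<sigma> x" using n M(3) by (auto simp: HK_preimage_def)
    then show ?thesis unfolding set_mult_def by blast
  qed
  have "\<epsilon> \<in> epi (B\<lparr>carrier := HK_preimage\<rparr>) A"
    unfolding epi_def
  proof (intro CollectI conjI homI)
    fix n assume "n \<in> carrier (B\<lparr>carrier := HK_preimage\<rparr>)"
    then have "n \<in> HK_preimage" by simp
    then obtain m1 m2 where m: "m1 \<in> M1" "m2 \<in> M2" "\<sigma> n = \<sigma> (m1 \<otimes> m2)" using ex by blast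
    then show "\<epsilon> n \<in> carrier A" using \<epsilon>[OF m] by simp
  next
    fix n n' assume "n \<in> carrier (B\<lparr>carrier := HK_preimage\<rparr>)"
    "n' \<in> carrier (B\<lparr>carrier := HK_preimage\<rparr>)"
    then have n: "n \<in> HK_preimage" "n' \<in> HK_preimage" by auto
    then have nc: "n \<in> carrier B" "n' \<in> carrier B" by (auto simp: HK_preimage_def)
    obtain m1 m2 where m: "m1 \<in> M1" "m2 \<in> M2" "\<sigma> n = \<sigma> (m1 \<otimes> m2)" using ex n by blast
    obtain m1' m2' where m': "m1' \<in> M1" "m2' \<in> M2" "\<sigma> n' = \<sigma> (m1' \<otimes> m2')" using ex n
      by blast
    define c where "c = m2 \<otimes> m1' \<otimes> inv m2"
    have c: "c \<in> M1" using m m' M1.inv_op_closed2 by (simp add: c_def)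
    have "m1 \<otimes> m2 \<otimes> (m1' \<otimes> m2') = m1 \<otimes> c \<otimes> (m2 \<otimes> m2')"
    proof -
      have "inv m2 \<otimes> (m2 \<otimes> m2') = m2'" using m m' by (simp add: m_assoc[symmetric])
      then show ?thesis using m m' by (simp add: c_def m_assoc)
    qed
    then have "\<sigma> (n \<otimes> n') = \<sigma> (m1 \<otimes> c \<otimes> (m2 \<otimes> m2'))"
      using m m' nc by (metis M1.mem_carrier M2.mem_carrier \<sigma>.hom_mult m_closed)
    then have "\<epsilon> (n \<otimes> n') = E (m1 \<otimes> c)"
      by (rule \<epsilon>[rotated 2]) (use m m' c in auto)
    moreover have "E c = E m1'"
    proof -
      have "m1' \<otimes> inv m2 \<otimes> inv m1' \<in> M2" using m m' M2.inv_op_closed2 by simp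
      then have "c \<otimes> inv m1' \<in> M2" using m m' by (simp add: c_def m_assoc)
      then have "E c \<otimes>\<^bsub>A\<^esub> inv\<^bsub>A\<^esub> E m1' = \<one>\<^bsub>A\<^esub>"
        using E(2) c m' by (simp flip: Em Einv)
      then show ?thesis using c m' by (metis A.inv_equality A.inv_inv A.inv_closed Ec)
    qed
    ultimately show "\<epsilon> (n \<otimes>\<^bsub>B\<lparr>carrier := HK_preimage\<rparr>\<^esub> n') = \<epsilon> n \<otimes>\<^bsub>A\<^esub> \<epsilon> n'"
      using Em[OF m(1) c] \<epsilon>[OF m] \<epsilon>[OF m'] by simp
  next
    show "\<epsilon> ` carrier (B\<lparr>carrier := HK_preimage\<rparr>) = carrier A"
    proof
      show "\<epsilon> ` carrier (B\<lparr>carrier := HK_preimage\<rparr>) \<subseteq> carrier A"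
      proof
        fix a assume "a \<in> \<epsilon> ` carrier (B\<lparr>carrier := HK_preimage\<rparr>)"
        then obtain n where n: "n \<in> HK_preimage" "a = \<epsilon> n" by auto
        then obtain m1 m2 where m: "m1 \<in> M1" "m2 \<in> M2" "\<sigma> n = \<sigma> (m1 \<otimes> m2)" using ex
          by blast
        then show "a \<in> carrier A" using \<epsilon>[OF m] n by simp
      qed
      show "carrier A \<subseteq> \<epsilon> ` carrier (B\<lparr>carrier := HK_preimage\<rparr>)"
      proof
        fix a assume "a \<in> carrier A"
        then obtain m where m: "m \<in> M1" "a = E m" using E(1) by (auto simp: epi_def)
        then have "\<epsilon> m = a" using \<epsilon>[OF m(1) M2.one_closed, of m] by simp
        moreover have "m \<in> HK_preimage" using HK[OF m(1) M2.one_closed] m(1) by (auto simp: HK_preimage_def)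
        ultimately show "a \<in> \<epsilon> ` carrier (B\<lparr>carrier := HK_preimage\<rparr>)" by auto
      qed
    qed
  qed
  with \<epsilon> that show thesis by blast
qed

lemma hnn_U_alt:
  "hnn_U B H K \<phi> = subgroup_generated (AutoGroup (B\<lparr>carrier := H\<rparr>))
     (conj_on H ` carrier B \<union> (\<lambda>b. \<lambda>h\<in>H. \<psi> (conj_on K b (\<phi> h))) ` carrier B)"
  unfolding hnn_U_def Aut_restr_conj_on by (rule arg_cong[of _ _ "subgroup_generated _"]) auto

text \<open>
  Modulo \<open>L = H \<inter> K\<close> the associated subgroups intersect trivially. The quotient \<open>A = H / L\<close> is an image
  of \<open>H K\<close> in two ways: by killing \<open>K\<close>, and by killing \<open>H\<close> and using \<open>\<phi>\<inverse>\<close> to pass from \<open>K\<close> to \<open>H\<close>. The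
  group \<open>B\<close> acts on \<open>A\<close> compatibly with the first map by conjugation on \<open>H\<close>, and with the second by
  conjugation on \<open>K\<close> transported by \<open>\<phi>\<close>; together these actions generate a quotient of the group \<open>U\<close>. Amalgamating two
  copies of \<open>B\<close> along \<open>A\<close> yields exactly the two homomorphisms that \<open>hnn_hom_from_slots\<close> needs.
\<close>

theorem extend_modulo_intersection:
  assumes U: "in_class (hnn_U B H K \<phi>) \<C>"
  shows "\<exists>Q\<in>\<C>. \<exists>f s. hnn_hom B H \<phi> Q f s \<and>
    (\<forall>b\<in>carrier B. f b = \<one>\<^bsub>Q\<^esub> \<longleftrightarrow> \<sigma> b \<in> \<sigma> ` (H \<inter> K))"
proof -
  define BH BK where "BH = B\<lparr>carrier := H\<rparr>" and "BK = B\<lparr>carrier := K\<rparr>"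
  have gBH: "group BH" and gBK: "group BK"
    unfolding BH_def BK_def using sub subgroup.subgroup_is_group[OF _ is_group] by blast+
  interpret BH: group BH by (rule gBH)
  interpret BK: group BK by (rule gBK)
  define L' where "L' = H \<inter> K"
  have L'N: "L' \<lhd> B" using LN by (simp add: L'_def)
  have "L' \<lhd> BH"
    unfolding BH_def L'_def by (rule normal_restrict_supergroup[OF sub(1) LN]) auto
  then interpret LB: normal L' BH .
  define A where "A = BH Mod L'"
  have gA: "group A" unfolding A_def by (rule LB.factorgroup_is_group)
  have coset: "L' #>\<^bsub>BH\<^esub> x = L' #> x" for x by (simp add: BH_def)
  define E where "E = (\<lambda>h. L' #> h)"
  have E: "E \<in> epi BH A"
    using LB.r_coset_hom_Mod unfolding E_def epi_def A_def by (auto simp: coset carrier_FactGroup)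
  have E1: "E m = \<one>\<^bsub>A\<^esub> \<longleftrightarrow> m \<in> L'" if "m \<in> H" for m
    using that coset_join1[OF _ _ normal_imp_subgroup[OF L'N], of m] coset_join2[OF _ normal_imp_subgroup[OF L'N], of m]
      subgroup.subset[OF normal_imp_subgroup[OF L'N]] by (auto simp: E_def A_def)
  have Ecar: "E h \<in> carrier A" if "h \<in> H" for h using E that by (auto simp: epi_def hom_def BH_def)
  have Eone: "E \<one> = \<one>\<^bsub>A\<^esub>"
    using E1 subgroup.one_closed[OF sub(1)] subgroup.one_closed[OF normal_imp_subgroup[OF L'N]] by blast
  have A: "in_class A \<C>"
  proof -
    have "in_class BH \<C>" unfolding BH_def using in_class_if_inj_on[OF sub(1) inj_H] .
    moreover have "E \<in> hom BH A" "E ` carrier BH = carrier A" using E by (simp_all add: epi_def)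
    ultimately show ?thesis using in_class_image[OF _ gA, of BH E] by simp
  qed
  \<comment> \<open>Automorphisms of \<open>H\<close> that preserve \<open>L\<close> act on \<open>A\<close>; all those from the group \<open>U\<close> do preserve it.\<close>
  define P where "P = {\<alpha> \<in> carrier (AutoGroup BH). \<alpha> ` L' = L'}"
  define ind where "ind = (\<lambda>\<alpha> :: 'b \<Rightarrow> 'b. \<lambda>c\<in>carrier A. \<alpha> ` c)"
  have P: "subgroup P (AutoGroup BH)"
    and ind: "ind \<in> hom ((AutoGroup BH)\<lparr>carrier := P\<rparr>) (AutoGroup A)"
    and ind_E0: "\<And>\<alpha> h. \<alpha> \<in> P \<Longrightarrow> h \<in> carrier BH \<Longrightarrow> ind \<alpha> (L' #>\<^bsub>BH\<^esub> h) = L' #>\<^bsub>BH\<^esub> \<alpha> h"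
    using LB.induced_automorphism unfolding P_def ind_def A_def by blast+
  have ind_E: "ind \<alpha> (E h) = E (\<alpha> h)" if "\<alpha> \<in> P" "h \<in> H" for \<alpha> h
    using ind_E0[OF that(1), of h] that(2) unfolding coset E_def by (simp add: BH_def)
  interpret AutH: group "AutoGroup BH" by (rule BH.AutoGroup)
  have c1h: "conj_on H \<in> hom B (AutoGroup BH)" unfolding BH_def using conj_on_hom[OF HN] .
  define tr where "tr = (\<lambda>\<alpha>. \<lambda>h\<in>H. \<psi> (\<alpha> (\<phi> h)))"
  have tr: "tr \<in> hom (AutoGroup BK) (AutoGroup BH)"
    using transport_automorphism[OF gBH gBK, of \<phi>] \<phi> by (simp add: tr_def BH_def BK_def)
  have "conj_on K \<in> hom B (AutoGroup BK)" unfolding BK_def using conj_on_hom[OF KN] .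
  then have c2h: "tr \<circ> conj_on K \<in> hom B (AutoGroup BH)" using Group.hom_compose[OF _ tr] by blast
  have c1_app: "conj_on H b h = b \<otimes> h \<otimes> inv b" if "h \<in> H" for b h using that
    by (simp add: conj_on_def)
  have c2_app: "(tr \<circ> conj_on K) b h = \<psi> (b \<otimes> \<phi> h \<otimes> inv b)" if "h \<in> H" for b h
    using that by (simp add: conj_on_def tr_def)
  have cL: "b \<otimes> l \<otimes> inv b \<in> L'" if "b \<in> carrier B" "l \<in> L'" for b l
    using that L'N normal.inv_op_closed2 by metis
  have LHK: "l \<in> H \<and> l \<in> K \<and> l \<in> carrier B" if "l \<in> L'" for l using that
    by (simp add: L'_def)
  have \<phi>L': "\<phi> l \<in> L'" "\<psi> l \<in> L'" if "l \<in> L'" for l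
    using that \<phi>_L \<psi>_L by (auto simp: L'_def)
  have img_eq: "\<alpha> ` L' = L'" if "\<And>l. l \<in> L' \<Longrightarrow> \<alpha> l \<in> L'"
    "\<And>l. l \<in> L' \<Longrightarrow> \<exists>l'\<in>L'. \<alpha> l' = l" for \<alpha> :: "'b \<Rightarrow> 'b"
    using that by blast
  have inv_conj: "b \<otimes> (inv b \<otimes> l \<otimes> b) \<otimes> inv b = l" if "b \<in> carrier B"
    "l \<in> carrier B" for b l
  proof -
    have "b \<otimes> (inv b \<otimes> l \<otimes> b) = l \<otimes> b" using that by (simp add: m_assoc[symmetric])
    then show ?thesis using that by (simp add: m_assoc)
  qed
  have cL': "inv b \<otimes> l \<otimes> b \<in> L'" if "b \<in> carrier B" "l \<in> L'" for b l
    using that L'N normal.inv_op_closed1 by metis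
  have c1P: "conj_on H b \<in> P" if b: "b \<in> carrier B" for b
  proof -
    have "conj_on H b ` L' = L'"
    proof (rule img_eq)
      fix l assume l: "l \<in> L'"
      show "conj_on H b l \<in> L'" using l b LHK cL by (simp add: c1_app)
      show "\<exists>l'\<in>L'. conj_on H b l' = l"
        using l b LHK cL' inv_conj by (intro bexI[of _ "inv b \<otimes> l \<otimes> b"]) (simp_all add: c1_app)
    qed
    then show ?thesis using c1h b by (auto simp: P_def hom_def)
  qed
  have c2P: "(tr \<circ> conj_on K) b \<in> P" if b: "b \<in> carrier B" for b
  proof -
    have "(tr \<circ> conj_on K) b ` L' = L'"
    proof (rule img_eq)
      fix l assume l: "l \<in> L'"
      show "(tr \<circ> conj_on K) b l \<in> L'" using l b LHK cL \<phi>L' by (simp add: c2_app del: comp_apply)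
      have "inv b \<otimes> \<phi> l \<otimes> b \<in> L'" using cL'[OF b \<phi>L'(1)[OF l]] .
      then show "\<exists>l'\<in>L'. (tr \<circ> conj_on K) b l' = l"
        using l b LHK \<phi>L' inv_conj
        by (intro bexI[of _ "\<psi> (inv b \<otimes> \<phi> l \<otimes> b)"]) (simp_all add: c2_app del: comp_apply)
    qed
    then show ?thesis using c2h b by (auto simp: P_def hom_def)
  qed
  define UU where "UU = carrier (hnn_U B H K \<phi>)"
  let ?gens = "conj_on H ` carrier B \<union> (tr \<circ> conj_on K) ` carrier B"
  have hU: "hnn_U B H K \<phi> = (AutoGroup BH)\<lparr>carrier := UU\<rparr>"
    by (simp add: UU_def hnn_U_def subgroup_generated_def BH_def)
  have UU: "UU = generate (AutoGroup BH) (carrier (AutoGroup BH) \<inter> ?gens)"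
    by (simp add: UU_def hnn_U_alt carrier_subgroup_generated BH_def tr_def comp_def)
  have gens: "?gens \<subseteq> P" using c1P c2P by blast
  have UP: "UU \<subseteq> P"
    unfolding UU using gens by (intro AutH.generate_subgroup_incl[OF _ P]) blast
  have inU: "conj_on H b \<in> UU" "(tr \<circ> conj_on K) b \<in> UU" if "b \<in> carrier B" for b
    using that c1P c2P unfolding UU P_def by (auto intro!: generate.incl)
  define W where "W = ind ` UU"
  have indU: "ind \<in> hom (hnn_U B H K \<phi>) (AutoGroup A)"
    using ind UP unfolding hU by (auto simp: hom_def)
  interpret ind: group_hom "hnn_U B H K \<phi>" "AutoGroup A" ind
    using in_class_group[OF U] group.AutoGroup[OF gA] indU by (simp add: group_hom_def group_hom_axioms_def)
  have W: "subgroup W (AutoGroup A)" using ind.img_is_subgroup by (simp add: W_def UU_def)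
  have WC: "in_class ((AutoGroup A)\<lparr>carrier := W\<rparr>) \<C>"
    using in_class_image[OF U group.AutoGroup[OF gA] indU] by (simp add: W_def UU_def)
  \<comment> \<open>\<open>B / HK\<close> itself need not belong to the class, but the quotient of \<open>S\<close> by the image of \<open>HK\<close> does.\<close>
  have HKN: "H <#> K \<lhd> B" using normal_subgroup_set_mult_closed[OF HN KN] .
  define M where "M = \<sigma> ` (H <#> K)"
  have MN: "M \<lhd> S" unfolding M_def
    using normal.surj_hom_normal_subgroup[OF HKN \<sigma>.group_hom_axioms] \<sigma> by (simp add: epi_def)
  interpret MN: normal M S by (rule MN)
  have Q: "in_class (S Mod M) \<C>" using quot S MN unfolding quotient_closed_def by blast
  define r where "r = (\<lambda>b. M #>\<^bsub>S\<^esub> \<sigma> b)"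
  have r: "r \<in> hom B (S Mod M)"
    using Group.hom_compose[OF \<sigma>.homh MN.r_coset_hom_Mod] by (simp add: r_def comp_def)
  have ker: "kernel B (S Mod M) r = HK_preimage"
  proof -
    have "M #>\<^bsub>S\<^esub> \<sigma> b = M \<longleftrightarrow> \<sigma> b \<in> M" if "b \<in> carrier B" for b
      using \<sigma>.H.coset_join1[OF _ _ MN.subgroup_axioms] \<sigma>.H.coset_join2[OF _ MN.subgroup_axioms] that MN.subset by auto
    then show ?thesis by (auto simp: kernel_def HK_preimage_def r_def M_def)
  qed
  have KH: "K <#> H = H <#> K" using commut_normal[OF sub(2) HN] .
  obtain \<epsilon>1 where \<epsilon>1: "\<epsilon>1 \<in> epi (B\<lparr>carrier := HK_preimage\<rparr>) A"
    "\<And>n m1 m2. m1 \<in> H \<Longrightarrow> m2 \<in> K \<Longrightarrow> \<sigma> n = \<sigma> (m1 \<otimes> m2) \<Longrightarrow> \<epsilon>1 n = E m1"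
  proof (rule projection[OF HN KN HOL.refl gA])
    show "E \<in> epi (B\<lparr>carrier := H\<rparr>) A" using E by (simp add: BH_def)
    show "E m = \<one>\<^bsub>A\<^esub>" if "m \<in> H" "m \<in> K" for m using E1[OF that(1)] that
      by (simp add: L'_def)
  qed blast
  obtain \<epsilon>2 where \<epsilon>2: "\<epsilon>2 \<in> epi (B\<lparr>carrier := HK_preimage\<rparr>) A"
    "\<And>n m1 m2. m1 \<in> K \<Longrightarrow> m2 \<in> H \<Longrightarrow> \<sigma> n = \<sigma> (m1 \<otimes> m2) \<Longrightarrow> \<epsilon>2 n = (E \<circ> \<psi>) m1"
  proof (rule projection[OF KN HN KH gA])
    have "\<psi> \<in> iso BK BH" using BH.iso_set_sym[of \<phi> BK] \<phi> by (simp add: BH_def BK_def)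
    then have "\<psi> \<in> epi BK BH" using iso_iff_mon_epi by blast
    then show "E \<circ> \<psi> \<in> epi (B\<lparr>carrier := K\<rparr>) A" using epi_compose[OF _ E]
      by (simp add: BK_def)
    show "(E \<circ> \<psi>) m = \<one>\<^bsub>A\<^esub>" if "m \<in> K" "m \<in> H" for m
      using E1[of "\<psi> m"] that \<phi>L'(2)[of m] by (simp add: L'_def)
  qed blast
  have HK_preimage_car: "n \<in> carrier B" if "n \<in> HK_preimage" for n using that by (simp add: HK_preimage_def)
  have dec: "\<exists>h\<in>H. \<exists>k\<in>K. \<sigma> n = \<sigma> (h \<otimes> k)"
    "\<exists>k\<in>K. \<exists>h\<in>H. \<sigma> n = \<sigma> (k \<otimes> h)" if n: "n \<in> HK_preimage" for n
  proof -
    obtain x where x: "x \<in> H <#> K" "\<sigma> n = \<sigma> x" using n by (auto simp: HK_preimage_def)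
    then show "\<exists>h\<in>H. \<exists>k\<in>K. \<sigma> n = \<sigma> (h \<otimes> k)" unfolding set_mult_def
      by blast
    show "\<exists>k\<in>K. \<exists>h\<in>H. \<sigma> n = \<sigma> (k \<otimes> h)" proof -
      have "x \<in> K <#> H" using x(1) KH by simp
      then show ?thesis using x(2) unfolding set_mult_def by blast
    qed
  qed
  have conj_dist: "\<sigma> (b \<otimes> n \<otimes> inv b) = \<sigma> ((b \<otimes> x \<otimes> inv b) \<otimes> (b \<otimes> y \<otimes> inv b))"
    if "b \<in> carrier B" "n \<in> carrier B" "x \<in> carrier B" "y \<in> carrier B"
    "\<sigma> n = \<sigma> (x \<otimes> y)" for b n x y
  proof -
    have "inv b \<otimes> (b \<otimes> (y \<otimes> inv b)) = y \<otimes> inv b" using that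
      by (simp add: m_assoc[symmetric])
    then have "(b \<otimes> x \<otimes> inv b) \<otimes> (b \<otimes> y \<otimes> inv b) = b \<otimes> (x \<otimes> y) \<otimes> inv b"
      using that by (simp add: m_assoc)
    then have "\<sigma> ((b \<otimes> x \<otimes> inv b) \<otimes> (b \<otimes> y \<otimes> inv b)) = \<sigma> b \<otimes>\<^bsub>S\<^esub> \<sigma> (x \<otimes> y) \<otimes>\<^bsub>S\<^esub> \<sigma> (inv b)"
      using that by (metis \<sigma>.hom_mult m_closed inv_closed)
    then show ?thesis using that by simp
  qed
  have indhom: "ind \<circ> c \<in> hom B (AutoGroup A)"
    if "c \<in> hom B (AutoGroup BH)" "\<And>b. b \<in> carrier B \<Longrightarrow> c b \<in> P" for c
  proof -
    have "c \<in> hom B ((AutoGroup BH)\<lparr>carrier := P\<rparr>)" using that by (auto simp: hom_def)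
    then show ?thesis by (rule Group.hom_compose[OF _ ind])
  qed
  define \<theta>1 \<theta>2 where "\<theta>1 = ind \<circ> conj_on H"
  and "\<theta>2 = ind \<circ> (tr \<circ> conj_on K)"
  have e1: "equivariant_onto B (S Mod M) r A W \<epsilon>1 \<theta>1"
    unfolding equivariant_onto_def ker
  proof (intro conjI ballI)
    show "\<theta>1 \<in> hom B (AutoGroup A)" unfolding \<theta>1_def using indhom[OF c1h c1P] .
    show "\<theta>1 ` carrier B \<subseteq> W" using inU by (auto simp: \<theta>1_def W_def)
    fix b n assume b: "b \<in> carrier B" and n: "n \<in> HK_preimage"
    obtain h k where hk: "h \<in> H" "k \<in> K" "\<sigma> n = \<sigma> (h \<otimes> k)" using dec(1)[OF n] by blast
    have "\<epsilon>1 (b \<otimes> n \<otimes> inv b) = E (b \<otimes> h \<otimes> inv b)"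
      by (rule \<epsilon>1(2)[OF conj_H[OF b hk(1)] conj_K[OF b hk(2)]], rule conj_dist) (use b n HK_preimage_car hk in auto)
    then show "\<theta>1 b (\<epsilon>1 n) = \<epsilon>1 (b \<otimes> n \<otimes> inv b)"
      using \<epsilon>1(2)[OF hk] ind_E[OF c1P[OF b] hk(1)] c1_app[OF hk(1)] by (simp add: \<theta>1_def)
  qed (fact r \<epsilon>1(1))+
  have e2: "equivariant_onto B (S Mod M) r A W \<epsilon>2 \<theta>2"
    unfolding equivariant_onto_def ker
  proof (intro conjI ballI)
    show "\<theta>2 \<in> hom B (AutoGroup A)" unfolding \<theta>2_def using indhom[OF c2h c2P] .
    show "\<theta>2 ` carrier B \<subseteq> W" using inU by (auto simp: \<theta>2_def W_def)
    fix b n assume b: "b \<in> carrier B" and n: "n \<in> HK_preimage"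
    obtain k h where hk: "k \<in> K" "h \<in> H" "\<sigma> n = \<sigma> (k \<otimes> h)" using dec(2)[OF n] by blast
    have "\<epsilon>2 (b \<otimes> n \<otimes> inv b) = (E \<circ> \<psi>) (b \<otimes> k \<otimes> inv b)"
      by (rule \<epsilon>2(2)[OF conj_K[OF b hk(1)] conj_H[OF b hk(2)]], rule conj_dist) (use b n HK_preimage_car hk in auto)
    moreover have "\<theta>2 b (E (\<psi> k)) = E (\<psi> (b \<otimes> k \<otimes> inv b))"
      using ind_E[OF c2P[OF b] \<psi>_H[OF hk(1)]] c2_app[OF \<psi>_H[OF hk(1)]] hk(1) by (simp add: \<theta>2_def)
    ultimately show "\<theta>2 b (\<epsilon>2 n) = \<epsilon>2 (b \<otimes> n \<otimes> inv b)"
      using \<epsilon>2(2)[OF hk] by simp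
  qed (fact r \<epsilon>2(1))+
  obtain D \<beta> \<gamma> where D: "D \<in> \<C>" and \<beta>: "\<beta> \<in> hom B D"
    and \<gamma>: "\<gamma> \<in> hom B D"
    and agree: "\<And>m n. m \<in> HK_preimage \<Longrightarrow> n \<in> HK_preimage \<Longrightarrow> \<epsilon>1 m = \<epsilon>2 n \<Longrightarrow> \<beta> m = \<gamma> n"
    and k1: "\<And>b. b \<in> carrier B \<Longrightarrow> \<beta> b = \<one>\<^bsub>D\<^esub> \<Longrightarrow> b \<in> HK_preimage \<and> \<epsilon>1 b = \<one>\<^bsub>A\<^esub>"
    and k2: "\<And>b. b \<in> carrier B \<Longrightarrow> \<gamma> b = \<one>\<^bsub>D\<^esub> \<Longrightarrow> b \<in> HK_preimage \<and> \<epsilon>2 b = \<one>\<^bsub>A\<^esub>"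
    by (rule normal_amalgam[OF A W WC is_group small Q e1 is_group small Q e2, unfolded ker]) blast
  interpret D: group D using member_group[OF D] .
  have \<beta>1: "\<beta> \<one> = \<one>\<^bsub>D\<^esub>" and \<gamma>1: "\<gamma> \<one> = \<one>\<^bsub>D\<^esub>"
    using hom_one[OF \<beta> is_group D.is_group] hom_one[OF \<gamma> is_group D.is_group] .
  have 1: "\<one> \<in> H" "\<one> \<in> K" using sub subgroup.one_closed by blast+
  have H_preimage: "h \<in> HK_preimage" if "h \<in> H" for h using that H_HK by (auto simp: HK_preimage_def)
  have K_preimage: "k \<in> HK_preimage" if "k \<in> K" for k using that K_HK by (auto simp: HK_preimage_def)
  have \<psi>1: "\<psi> \<one> = \<one>" using \<psi>\<phi>[OF 1(1)] \<phi>_one by simp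
  have \<epsilon>1H: "\<epsilon>1 h = E h" and \<epsilon>2H: "\<epsilon>2 h = \<one>\<^bsub>A\<^esub>"
    if "h \<in> H" for h
    using \<epsilon>1(2)[OF that 1(2), of h] \<epsilon>2(2)[OF 1(2) that, of h] that \<psi>1 Eone by auto
  have \<epsilon>1K: "\<epsilon>1 k = \<one>\<^bsub>A\<^esub>" and \<epsilon>2K: "\<epsilon>2 k = E (\<psi> k)"
    if "k \<in> K" for k
    using \<epsilon>1(2)[OF 1(1) that, of k] \<epsilon>2(2)[OF that 1(1), of k] that Eone by auto
  have rel: "\<gamma> h = \<one>\<^bsub>D\<^esub> \<and> \<beta> (\<phi> h) = \<one>\<^bsub>D\<^esub> \<and> \<gamma> (\<phi> h) = \<beta> h" if h: "h \<in> H" for h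
  proof (intro conjI)
    show "\<gamma> h = \<one>\<^bsub>D\<^esub>"
      using agree[OF H_preimage[OF 1(1)] H_preimage[OF h]] \<epsilon>1K[OF 1(2)] \<epsilon>2H[OF h] \<beta>1 by simp
    show "\<beta> (\<phi> h) = \<one>\<^bsub>D\<^esub>"
      using agree[OF K_preimage[OF \<phi>_K[OF h]] H_preimage[OF 1(1)]] \<epsilon>1K[OF \<phi>_K[OF h]] \<epsilon>2H[OF 1(1)] \<gamma>1 by simp
    show "\<gamma> (\<phi> h) = \<beta> h"
      using agree[OF H_preimage[OF h] K_preimage[OF \<phi>_K[OF h]]] \<epsilon>1H[OF h] \<epsilon>2K[OF \<phi>_K[OF h]] h by simp
  qed
  obtain G f s where G: "G \<in> \<C>" "hnn_hom B H \<phi> G f s"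
    and f: "\<And>b. b \<in> carrier B \<Longrightarrow> f b = \<one>\<^bsub>G\<^esub> \<longleftrightarrow> \<beta> b = \<one>\<^bsub>D\<^esub> \<and> \<gamma> b = \<one>\<^bsub>D\<^esub>"
    by (rule hnn_hom_from_slots[OF is_group small D \<beta> \<gamma> H_\<phi>_car rel]) blast+
  have "f b = \<one>\<^bsub>G\<^esub> \<longleftrightarrow> \<sigma> b \<in> \<sigma> ` (H \<inter> K)"
    if b: "b \<in> carrier B" for b
  proof
    assume "f b = \<one>\<^bsub>G\<^esub>"
    then have n: "b \<in> HK_preimage" "\<epsilon>1 b = \<one>\<^bsub>A\<^esub>"
      "\<epsilon>2 b = \<one>\<^bsub>A\<^esub>" using f[OF b] k1[OF b] k2[OF b] by auto
    obtain h k where hk: "h \<in> H" "k \<in> K" "\<sigma> b = \<sigma> (h \<otimes> k)" using dec(1)[OF n(1)]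
      by blast
    have "h \<in> L'" using \<epsilon>1(2)[OF hk] n(2) E1[OF hk(1)] by simp
    then have "h \<otimes> k \<in> K" using hk subgroup.m_closed[OF sub(2)] by (simp add: L'_def)
    then have kK: "h \<otimes> k \<in> K" .
    have "\<epsilon>2 b = E (\<psi> (h \<otimes> k))" using kK \<epsilon>2(2)[OF _ 1(1), of "h \<otimes> k" b] hk
      by simp
    then have "\<psi> (h \<otimes> k) \<in> L'" using E1[OF \<psi>_H[OF kK]] n(3) by simp
    then have "h \<otimes> k \<in> L'" using \<phi>L'(1)[of "\<psi> (h \<otimes> k)"] \<phi>\<psi>[OF kK] by simp
    then show "\<sigma> b \<in> \<sigma> ` (H \<inter> K)" unfolding L'_def hk(3) by blast
  next
    assume "\<sigma> b \<in> \<sigma> ` (H \<inter> K)"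
    then obtain l where l: "l \<in> H" "l \<in> K" "\<sigma> b = \<sigma> l" by blast
    have bN: "b \<in> HK_preimage" using b l H_HK by (auto simp: HK_preimage_def)
    have "\<epsilon>1 b = \<one>\<^bsub>A\<^esub>" using \<epsilon>1(2)[OF 1(1) l(2), of b] l Eone by simp
    then have "\<beta> b = \<one>\<^bsub>D\<^esub>"
      using agree[OF bN H_preimage[OF 1(1)]] \<epsilon>2H[OF 1(1)] \<gamma>1 by simp
    moreover have "\<epsilon>2 b = \<one>\<^bsub>A\<^esub>" using \<epsilon>2(2)[OF 1(2) l(1), of b] l \<psi>1 Eone
      by simp
    then have "\<gamma> b = \<one>\<^bsub>D\<^esub>"
      using agree[OF H_preimage[OF 1(1)] bN] \<epsilon>1K[OF 1(2)] \<beta>1 by simp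
    ultimately show "f b = \<one>\<^bsub>G\<^esub>" using f[OF b] by simp
  qed
  then show ?thesis using G by blast
qed

text \<open>Lifting a pair that is faithful only modulo \<open>L\<close> to one that is faithful on \<open>L\<close> as well.\<close>

theorem extension_exists:
  assumes "in_class (hnn_U B H K \<phi>) \<C>" "in_class (hnn_V B (H \<inter> K) \<phi>) \<C>"
  shows "\<exists>G\<in>\<C>. \<exists>f s. hnn_hom B H \<phi> G f s \<and> (\<forall>b\<in>carrier B. f b = \<one>\<^bsub>G\<^esub> \<longleftrightarrow> \<sigma> b = \<one>\<^bsub>S\<^esub>)"
  using extend_modulo_intersection[OF assms(1)] extend_over_intersection[OF assms(2)] by blast

end

section \<open>Automorphisms induced by conjugation\<close>

context quotient_closed_root_class begin

text \<open>
  If \<open>Y\<close> embeds into \<open>G\<close>, then the automorphisms of \<open>Y\<close> that are induced by conjugations in \<open>G\<close> form a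
  quotient of the normaliser of \<open>Y\<close>, which is a subgroup of \<open>G\<close>.
\<close>

lemma in_class_induced_automorphisms:
  fixes Y :: "('y, 'm) monoid_scheme"
  assumes Y: "group Y" and G: "G \<in> \<C>" and f: "f \<in> hom Y G" "inj_on f (carrier Y)"
  defines "I \<equiv> {\<alpha> \<in> carrier (AutoGroup Y). \<exists>g\<in>carrier G. \<forall>y\<in>carrier Y. f (\<alpha> y) = g \<otimes>\<^bsub>G\<^esub> f y \<otimes>\<^bsub>G\<^esub> inv\<^bsub>G\<^esub> g}"
  shows "subgroup I (AutoGroup Y)" and "in_class ((AutoGroup Y)\<lparr>carrier := I\<rparr>) \<C>"
proof -
  interpret Y: group Y by fact
  interpret G: group G using member_group[OF G] .
  interpret f: group_hom Y G f using f by (simp add: group_hom_def group_hom_axioms_def)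
  interpret Aut: group "AutoGroup Y" by (rule Y.AutoGroup)
  define R where "R = (\<lambda>\<alpha> g. \<forall>y\<in>carrier Y. f (\<alpha> y) = g \<otimes>\<^bsub>G\<^esub> f y \<otimes>\<^bsub>G\<^esub> inv\<^bsub>G\<^esub> g)"
  have c: "\<alpha> y \<in> carrier Y" if "\<alpha> \<in> carrier (AutoGroup Y)" "y \<in> carrier Y" for \<alpha> y
    using auto_D(1)[OF that(1)] that(2) by (auto simp: hom_def)
  have Rm: "R (\<alpha> \<otimes>\<^bsub>AutoGroup Y\<^esub> \<beta>) (g \<otimes>\<^bsub>G\<^esub> k)"
    if a: "\<alpha> \<in> carrier (AutoGroup Y)" "\<beta> \<in> carrier (AutoGroup Y)" and g: "g \<in> carrier G"
    "k \<in> carrier G"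
      and R: "R \<alpha> g" "R \<beta> k" for \<alpha> \<beta> g k
    unfolding R_def
  proof
    fix y assume y: "y \<in> carrier Y"
    have "f (\<alpha> (\<beta> y)) = g \<otimes>\<^bsub>G\<^esub> (k \<otimes>\<^bsub>G\<^esub> f y \<otimes>\<^bsub>G\<^esub> inv\<^bsub>G\<^esub> k) \<otimes>\<^bsub>G\<^esub> inv\<^bsub>G\<^esub> g"
      using R c[OF a(2) y] y by (simp add: R_def)
    then show "f ((\<alpha> \<otimes>\<^bsub>AutoGroup Y\<^esub> \<beta>) y) = g \<otimes>\<^bsub>G\<^esub> k \<otimes>\<^bsub>G\<^esub> f y \<otimes>\<^bsub>G\<^esub> inv\<^bsub>G\<^esub> (g \<otimes>\<^bsub>G\<^esub> k)"
      using a y g by (simp add: AutoGroup_mult compose_def G.m_assoc G.inv_mult_group)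
  qed
  have Ri: "R (inv\<^bsub>AutoGroup Y\<^esub> \<alpha>) (inv\<^bsub>G\<^esub> g)"
    if a: "\<alpha> \<in> carrier (AutoGroup Y)" and g: "g \<in> carrier G" and R: "R \<alpha> g" for \<alpha> g
    unfolding R_def
  proof
    fix y assume y: "y \<in> carrier Y"
    define z where "z = (inv\<^bsub>AutoGroup Y\<^esub> \<alpha>) y"
    have z: "z \<in> carrier Y" unfolding z_def using c a y by blast
    have "(\<alpha> \<otimes>\<^bsub>AutoGroup Y\<^esub> inv\<^bsub>AutoGroup Y\<^esub> \<alpha>) y = y" using a y
      by (simp add: AutoGroup_one)
    then have "\<alpha> z = y" using a y by (simp add: AutoGroup_mult compose_def z_def)
    then have fy: "f y = g \<otimes>\<^bsub>G\<^esub> f z \<otimes>\<^bsub>G\<^esub> inv\<^bsub>G\<^esub> g"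
      using R z by (auto simp: R_def)
    have "inv\<^bsub>G\<^esub> g \<otimes>\<^bsub>G\<^esub> (g \<otimes>\<^bsub>G\<^esub> f z \<otimes>\<^bsub>G\<^esub> inv\<^bsub>G\<^esub> g) = f z \<otimes>\<^bsub>G\<^esub> inv\<^bsub>G\<^esub> g"
      using g z by (simp add: G.m_assoc[symmetric])
    then show "f ((inv\<^bsub>AutoGroup Y\<^esub> \<alpha>) y) = inv\<^bsub>G\<^esub> g \<otimes>\<^bsub>G\<^esub> f y \<otimes>\<^bsub>G\<^esub> inv\<^bsub>G\<^esub> (inv\<^bsub>G\<^esub> g)"
      unfolding fy z_def[symmetric] using g z by (simp add: G.m_assoc)
  qed
  have R1: "R \<one>\<^bsub>AutoGroup Y\<^esub> \<one>\<^bsub>G\<^esub>" by (simp add: R_def AutoGroup_one)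
  have I: "\<alpha> \<in> I \<longleftrightarrow> \<alpha> \<in> carrier (AutoGroup Y) \<and> (\<exists>g\<in>carrier G. R \<alpha> g)" for \<alpha>
    by (simp add: I_def R_def)
  show sI: "subgroup I (AutoGroup Y)"
  proof (rule Aut.subgroupI)
    show "I \<subseteq> carrier (AutoGroup Y)" using I by blast
    show "I \<noteq> {}" using I R1 Aut.one_closed G.one_closed by blast
    show "inv\<^bsub>AutoGroup Y\<^esub> \<alpha> \<in> I" if "\<alpha> \<in> I" for \<alpha>
      using that I Ri Aut.inv_closed G.inv_closed by metis
    show "\<alpha> \<otimes>\<^bsub>AutoGroup Y\<^esub> \<beta> \<in> I" if "\<alpha> \<in> I"
      "\<beta> \<in> I" for \<alpha> \<beta>
      using that I Rm Aut.m_closed G.m_closed by metis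
  qed
  define X where "X = {g \<in> carrier G. \<exists>\<alpha>\<in>carrier (AutoGroup Y). R \<alpha> g}"
  have X: "subgroup X G"
  proof (rule G.subgroupI)
    show "X \<subseteq> carrier G" by (auto simp: X_def)
    show "X \<noteq> {}" using R1 Aut.one_closed G.one_closed by (auto simp: X_def)
    show "inv\<^bsub>G\<^esub> g \<in> X" if "g \<in> X" for g using that Ri Aut.inv_closed unfolding X_def by blast
    show "g \<otimes>\<^bsub>G\<^esub> k \<in> X" if "g \<in> X" "k \<in> X" for g k
      using that Rm Aut.m_closed unfolding X_def by blast
  qed
  have uniq: "\<alpha> = \<beta>" if a: "\<alpha> \<in> carrier (AutoGroup Y)" "\<beta> \<in> carrier (AutoGroup Y)"
    and R: "R \<alpha> g" "R \<beta> g" for \<alpha> \<beta> g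
  proof (rule AutoGroup_eqI[OF a])
    fix y assume y: "y \<in> carrier Y"
    then have "f (\<alpha> y) = f (\<beta> y)" using R by (simp add: R_def)
    then show "\<alpha> y = \<beta> y" using inj_onD[OF f(2)] c a y by blast
  qed
  define m where "m = (\<lambda>g. SOME \<alpha>. \<alpha> \<in> carrier (AutoGroup Y) \<and> R \<alpha> g)"
  have m: "m g \<in> carrier (AutoGroup Y) \<and> R (m g) g" if "g \<in> X" for g
  proof -
    have "\<exists>\<alpha>. \<alpha> \<in> carrier (AutoGroup Y) \<and> R \<alpha> g" using that
      by (auto simp: X_def)
    from someI_ex[OF this] show ?thesis by (simp only: m_def)
  qed
  have m_eq: "m g = \<alpha>" if "g \<in> X" "\<alpha> \<in> carrier (AutoGroup Y)" "R \<alpha> g" for g \<alpha>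
    using uniq m that by blast
  have Xc: "g \<in> carrier G" if "g \<in> X" for g using that by (simp add: X_def)
  have mh: "m \<in> hom (G\<lparr>carrier := X\<rparr>) (AutoGroup Y)"
  proof (rule homI)
    fix g k assume "g \<in> carrier (G\<lparr>carrier := X\<rparr>)" "k \<in> carrier (G\<lparr>carrier := X\<rparr>)"
    then have gk: "g \<in> X" "k \<in> X" by auto
    show "m (g \<otimes>\<^bsub>G\<lparr>carrier := X\<rparr>\<^esub> k) = m g \<otimes>\<^bsub>AutoGroup Y\<^esub> m k"
      using m_eq[OF subgroup.m_closed[OF X gk]] Rm m[OF gk(1)] m[OF gk(2)] Xc gk by simp
  qed (use m in simp)
  have "m ` X = I"
  proof
    show "m ` X \<subseteq> I" using m I Xc by blast
    show "I \<subseteq> m ` X"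
    proof
      fix \<alpha> assume \<alpha>: "\<alpha> \<in> I"
      then obtain g where g: "g \<in> carrier G" "R \<alpha> g" "\<alpha> \<in> carrier (AutoGroup Y)" using I
        by blast
      then have "g \<in> X" by (auto simp: X_def)
      then show "\<alpha> \<in> m ` X" using m_eq[of g \<alpha>] g by blast
    qed
  qed
  then show "in_class ((AutoGroup Y)\<lparr>carrier := I\<rparr>) \<C>"
    using in_class_image[OF in_class_subgroup[OF in_class_member[OF iso_closed G] X] Aut.is_group mh] by simp
qed

lemma in_class_generated_by_induced:
  fixes Y :: "('y, 'm) monoid_scheme"
  assumes Y: "group Y" and I: "subgroup I (AutoGroup Y)" "in_class ((AutoGroup Y)\<lparr>carrier := I\<rparr>) \<C>"
    and P: "carrier (AutoGroup Y) \<inter> P \<subseteq> I"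
  shows "in_class (subgroup_generated (AutoGroup Y) P) \<C>"
proof -
  interpret Aut: group "AutoGroup Y" by (rule group.AutoGroup[OF Y])
  let ?g = "generate (AutoGroup Y) (carrier (AutoGroup Y) \<inter> P)"
  have sub: "subgroup ?g (AutoGroup Y)" by (rule Aut.generate_is_subgroup) blast
  have "?g \<subseteq> I" using Aut.generate_subgroup_incl[OF P I(1)] .
  then have "subgroup ?g ((AutoGroup Y)\<lparr>carrier := I\<rparr>)" using Aut.subgroup_incl[OF sub I(1)] by blast
  then show ?thesis using in_class_subgroup[OF I(2)] by (force simp: subgroup_generated_def)
qed

end

context normal_hnn_epi begin

text \<open>
  Conjugation by \<open>f b\<close> induces the restriction to \<open>H\<close> or \<open>L\<close> of an inner automorphism of \<open>B\<close>, conjugation by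
  \<open>s \<cdot> f b \<cdot> s\<inverse>\<close> induces the transported inner automorphism of \<open>K\<close>, and \<open>s\<inverse>\<close> induces
  \<open>\<phi>\<close> on \<open>L\<close>.
\<close>

theorem automorphism_groups_in_class:
  assumes G: "G \<in> \<C>" and f: "hnn_hom B H \<phi> G f s" and inj_f: "inj_on f (H <#> K)"
  shows "in_class (hnn_U B H K \<phi>) \<C>" and "in_class (hnn_V B (H \<inter> K) \<phi>) \<C>"
proof -
  interpret G: group G using member_group[OF G] .
  have fh: "f \<in> hom B G" and s: "s \<in> carrier G"
    and c: "\<And>h. h \<in> H \<Longrightarrow> f h \<otimes>\<^bsub>G\<^esub> s = s \<otimes>\<^bsub>G\<^esub> f (\<phi> h)"
    using f by (auto simp: hnn_hom_def)
  interpret f: group_hom B G f using fh by (simp add: group_hom_def group_hom_axioms_def is_group)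
  have f\<phi>: "f (\<phi> h) = inv\<^bsub>G\<^esub> s \<otimes>\<^bsub>G\<^esub> f h \<otimes>\<^bsub>G\<^esub> s"
    if h: "h \<in> H" for h
    using c[OF h] s h by (simp add: G.m_assoc) (simp add: G.m_assoc[symmetric])
  have f\<psi>: "f (\<psi> k) = s \<otimes>\<^bsub>G\<^esub> f k \<otimes>\<^bsub>G\<^esub> inv\<^bsub>G\<^esub> s"
    if k: "k \<in> K" for k
    using c[OF \<psi>_H[OF k]] k s by (metis G.inv_solve_right \<phi>\<psi> \<psi>_H H_car K_car f.hom_closed G.m_closed)
  have restr: "\<exists>g\<in>carrier G. \<forall>y\<in>N. f (\<alpha> y) = g \<otimes>\<^bsub>G\<^esub> f y \<otimes>\<^bsub>G\<^esub> inv\<^bsub>G\<^esub> g"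
    if \<alpha>: "\<alpha> \<in> Aut_restr B N" and N: "N \<subseteq> carrier B" for \<alpha> N
  proof -
    obtain b where "b \<in> carrier B" "\<alpha> = conj_on N b" using \<alpha> unfolding Aut_restr_conj_on by blast
    then show ?thesis using N by (intro bexI[of _ "f b"]) (auto simp: conj_on_def)
  qed
  define BH BL where "BH = B\<lparr>carrier := H\<rparr>" and "BL = B\<lparr>carrier := H \<inter> K\<rparr>"
  have gBH: "group BH" and gBL: "group BL"
    unfolding BH_def BL_def using subgroup.subgroup_is_group[OF _ is_group] sub normal_imp_subgroup[OF LN] by blast+
  have fBH: "f \<in> hom BH G" "inj_on f (carrier BH)" and fBL: "f \<in> hom BL G" "inj_on f (carrier BL)"
    using inj_on_subset[OF inj_f H_HK] by (auto simp: BH_def BL_def hom_def intro: inj_on_subset)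
  note IU = in_class_induced_automorphisms[OF gBH G fBH] and IV = in_class_induced_automorphisms[OF gBL G fBL]
  show "in_class (hnn_U B H K \<phi>) \<C>"
    unfolding hnn_U_def BH_def[symmetric]
  proof (rule in_class_generated_by_induced[OF gBH IU], rule subsetI)
    fix \<alpha> assume \<alpha>: "\<alpha> \<in> carrier (AutoGroup BH) \<inter> (Aut_restr B H \<union> {\<lambda>h\<in>H. \<psi> (\<alpha> (\<phi> h)) |\<alpha>. \<alpha> \<in> Aut_restr B K})"
    have "\<exists>g\<in>carrier G. \<forall>y\<in>H. f (\<alpha> y) = g \<otimes>\<^bsub>G\<^esub> f y \<otimes>\<^bsub>G\<^esub> inv\<^bsub>G\<^esub> g"
    proof (cases "\<alpha> \<in> Aut_restr B H")
      case True
      then show ?thesis using restr subgroup.subset[OF sub(1)] by blast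
    next
      case False
      then obtain \<beta> where "\<beta> \<in> Aut_restr B K"
        "\<alpha> = (\<lambda>h\<in>H. \<psi> (\<beta> (\<phi> h)))" using \<alpha> by blast
      then obtain b where b: "b \<in> carrier B" "\<alpha> = (\<lambda>h\<in>H. \<psi> (conj_on K b (\<phi> h)))"
        unfolding Aut_restr_conj_on by blast
      define g where "g = s \<otimes>\<^bsub>G\<^esub> f b \<otimes>\<^bsub>G\<^esub> inv\<^bsub>G\<^esub> s"
      have "f (\<alpha> h) = g \<otimes>\<^bsub>G\<^esub> f h \<otimes>\<^bsub>G\<^esub> inv\<^bsub>G\<^esub> g"
        if h: "h \<in> H" for h
      proof -
        have "f (\<alpha> h) = s \<otimes>\<^bsub>G\<^esub> f (b \<otimes> \<phi> h \<otimes> inv b) \<otimes>\<^bsub>G\<^esub> inv\<^bsub>G\<^esub> s"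
          using h b f\<psi>[OF conj_K[OF b(1) \<phi>_K[OF h]]] by (simp add: conj_on_def)
        also have "\<dots> = s \<otimes>\<^bsub>G\<^esub> (f b \<otimes>\<^bsub>G\<^esub> (inv\<^bsub>G\<^esub> s \<otimes>\<^bsub>G\<^esub> f h \<otimes>\<^bsub>G\<^esub> s) \<otimes>\<^bsub>G\<^esub> inv\<^bsub>G\<^esub> f b) \<otimes>\<^bsub>G\<^esub> inv\<^bsub>G\<^esub> s"
          using h b f\<phi>[OF h] by simp
        also have "\<dots> = g \<otimes>\<^bsub>G\<^esub> f h \<otimes>\<^bsub>G\<^esub> inv\<^bsub>G\<^esub> g"
          using h b s by (simp add: g_def G.m_assoc G.inv_mult_group)
        finally show ?thesis .
      qed
      moreover have "g \<in> carrier G" using s b by (simp add: g_def)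
      ultimately show ?thesis by blast
    qed
    then show "\<alpha> \<in> {\<alpha> \<in> carrier (AutoGroup BH). \<exists>g\<in>carrier G. \<forall>y\<in>carrier BH. f (\<alpha> y) = g \<otimes>\<^bsub>G\<^esub> f y \<otimes>\<^bsub>G\<^esub> inv\<^bsub>G\<^esub> g}"
      using \<alpha> by (simp add: BH_def)
  qed
  let ?I = "{\<alpha> \<in> carrier (AutoGroup BL). \<exists>g\<in>carrier G. \<forall>y\<in>carrier BL. f (\<alpha> y) = g \<otimes>\<^bsub>G\<^esub> f y \<otimes>\<^bsub>G\<^esub> inv\<^bsub>G\<^esub> g}"
  interpret AutL: group "AutoGroup BL" by (rule group.AutoGroup[OF gBL])
  have "restrict \<phi> (H \<inter> K) \<in> carrier (AutoGroup BL)"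
    by (rule carrier_AutoGroupI[where v = \<psi>])
      (use \<phi>_L \<psi>_L subgroup.m_closed[OF sub(1)] subgroup.m_closed[OF sub(2)] in \<open>auto simp: \<phi>_mult BL_def\<close>)
  then have "restrict \<phi> (H \<inter> K) \<in> ?I"
    using f\<phi> s by (auto simp: BL_def intro!: bexI[of _ "inv\<^bsub>G\<^esub> s"])
  then have *: "generate (AutoGroup BL) {restrict \<phi> (H \<inter> K)} \<subseteq> ?I"
    by (intro AutL.generate_subgroup_incl[OF _ IV(1)]) blast
  show "in_class (hnn_V B (H \<inter> K) \<phi>) \<C>"
    unfolding hnn_V_def BL_def[symmetric]
  proof (rule in_class_generated_by_induced[OF gBL IV], rule subsetI)
    fix \<alpha> assume \<alpha>: "\<alpha> \<in> carrier (AutoGroup BL) \<inter> (Aut_restr B (H \<inter> K) \<union> generate (AutoGroup BL) {restrict \<phi> (H \<inter> K)})"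
    show "\<alpha> \<in> ?I"
    proof (cases "\<alpha> \<in> Aut_restr B (H \<inter> K)")
      case True
      then have "\<exists>g\<in>carrier G. \<forall>y\<in>H \<inter> K. f (\<alpha> y) = g \<otimes>\<^bsub>G\<^esub> f y \<otimes>\<^bsub>G\<^esub> inv\<^bsub>G\<^esub> g"
        by (rule restr) auto
      then show ?thesis using \<alpha> by (simp add: BL_def)
    next
      case False
      then show ?thesis using \<alpha> * by blast
    qed
  qed
qed

lemma automorphism_groups_in_class_if_extends:
  assumes G: "G \<in> \<C>" and \<tau>: "\<tau> \<in> epi (HNN B H \<phi>) G"
    and ext: "hnn_extends B H \<phi> S \<sigma> G \<tau>"
  shows "in_class (hnn_U B H K \<phi>) \<C>" and "in_class (hnn_V B (H \<inter> K) \<phi>) \<C>"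
proof -
  interpret E: group "HNN B H \<phi>" by (rule HNN_group)
  interpret \<tau>: group_hom "HNN B H \<phi>" G \<tau>
    using \<tau> member_group[OF G] by (simp add: group_hom_def group_hom_axioms_def epi_def E.is_group)
  define f where "f = \<tau> \<circ> hnn_base B H \<phi>"
  define t where "t = hnn_stable B H \<phi>"
  have t: "t \<in> carrier (HNN B H \<phi>)" unfolding t_def by (rule hnn_stable_carrier)
  have base: "hnn_base B H \<phi> b \<in> carrier (HNN B H \<phi>)" if "b \<in> carrier B" for b
    using hnn_base_hom that by (auto simp: hom_def)
  have f: "hnn_hom B H \<phi> G f (\<tau> t)"
    unfolding hnn_hom_def
  proof (intro conjI ballI)
    show "f \<in> hom B G" unfolding f_def using Group.hom_compose[OF hnn_base_hom \<tau>.homh] .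
    show "\<tau> t \<in> carrier G" using t by simp
    fix h assume h: "h \<in> H"
    have "t \<otimes>\<^bsub>HNN B H \<phi>\<^esub> hnn_base B H \<phi> (\<phi> h) = hnn_base B H \<phi> h \<otimes>\<^bsub>HNN B H \<phi>\<^esub> t"
      unfolding hnn_conj[OF h, symmetric] t_def[symmetric] using t base[of h] h by (simp add: E.m_assoc[symmetric])
    then show "f h \<otimes>\<^bsub>G\<^esub> \<tau> t = \<tau> t \<otimes>\<^bsub>G\<^esub> f (\<phi> h)"
      using t base[of h] base[of "\<phi> h"] h by (simp add: f_def flip: \<tau>.hom_mult)
  qed
  have HKc: "H <#> K \<subseteq> carrier B" using setmult_subset_G subgroup.subset sub by blast
  obtain e where e: "e \<in> mon S G" "\<forall>b\<in>carrier B. \<tau> (hnn_base B H \<phi> b) = e (\<sigma> b)"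
    using ext unfolding hnn_extends_def by blast
  have "inj_on f (H <#> K)"
  proof (rule inj_onI)
    fix x y assume xy: "x \<in> H <#> K" "y \<in> H <#> K" "f x = f y"
    then have "x \<in> carrier B" "y \<in> carrier B" using HKc by auto
    then have "\<sigma> x = \<sigma> y" using xy(3) e inj_onD[of e "carrier S" "\<sigma> x" "\<sigma> y"]
      by (simp add: f_def mon_def)
    then show "x = y" using inj_onD[OF inj] xy by blast
  qed
  from automorphism_groups_in_class[OF G f this]
  show "in_class (hnn_U B H K \<phi>) \<C>" "in_class (hnn_V B (H \<inter> K) \<phi>) \<C>" .
qed

end

section \<open>Reduced words\<close>

text \<open>
  A word \<open>t\<^sup>\<plusminus> b\<^sub>1 t\<^sup>\<plusminus> b\<^sub>2 \<dots>\<close> is a list of syllables, each a sign (true for the stable letter,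
  false for its inverse) followed by an element of the base group. An element of the base group in front of the
  word is kept separately.
\<close>

fun word_value :: "('g, 'k) monoid_scheme \<Rightarrow> ('b \<Rightarrow> 'g) \<Rightarrow> 'g \<Rightarrow> (bool \<times> 'b) list \<Rightarrow> 'g" where
  "word_value G f s [] = \<one>\<^bsub>G\<^esub>"
| "word_value G f s ((e, b) # ws) = (if e then s else inv\<^bsub>G\<^esub> s) \<otimes>\<^bsub>G\<^esub> (f b \<otimes>\<^bsub>G\<^esub> word_value G f s ws)"

definition syllables :: "('b, 'm) monoid_scheme \<Rightarrow> (bool \<times> 'b) list set" where
  "syllables B = lists (UNIV \<times> carrier B)"

lemma syllables_simps [simp]:
  "[] \<in> syllables B" "(e, b) # ws \<in> syllables B \<longleftrightarrow> b \<in> carrier B \<and> ws \<in> syllables B"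
  by (auto simp: syllables_def)

lemma syllables_drop: "ws \<in> syllables B \<Longrightarrow> drop k ws \<in> syllables B"
  unfolding syllables_def lists_eq_set using set_drop_subset[of k ws] by blast

lemma syllables_nth: "ws \<in> syllables B \<Longrightarrow> k < length ws \<Longrightarrow> snd (ws ! k) \<in> carrier B"
  using subsetD[OF _ nth_mem[of k ws], of "UNIV \<times> carrier B"]
  by (auto simp: syllables_def lists_eq_set mem_Times_iff)

lemma word_value_closed:
  assumes "group G" "f \<in> hom B G" "s \<in> carrier G" "ws \<in> syllables B"
  shows "word_value G f s ws \<in> carrier G"
proof -
  interpret group G by fact
  show ?thesis using assms(4)
  proof (induction ws)
    case (Cons a ws)
    then show ?case using assms(2,3) by (cases a) (auto simp: hom_def Pi_iff)
  qed simp
qed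

lemma word_value_hom:
  assumes "group X" "group G" "\<tau> \<in> hom X G" "f \<in> hom B X" "s \<in> carrier X" "ws \<in> syllables B"
  shows "\<tau> (word_value X f s ws) = word_value G (\<tau> \<circ> f) (\<tau> s) ws"
proof -
  interpret group_hom X G \<tau> using assms by (simp add: group_hom_def group_hom_axioms_def)
  show ?thesis using assms(6)
  proof (induction ws)
    case (Cons a ws)
    then obtain e b where a: "a = (e, b)" "b \<in> carrier B" "ws \<in> syllables B" by (cases a) auto
    then have "f b \<in> carrier X" "word_value X f s ws \<in> carrier X"
      using assms(4) word_value_closed[OF assms(1,4,5)] by (auto simp: hom_def)
    then show ?case using Cons.IH a assms(5) by simp
  qed simp
qed

lemma word_value_drop:
  "k < length ws \<Longrightarrow> word_value G f s (drop k ws) =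
     (if fst (ws ! k) then s else inv\<^bsub>G\<^esub> s) \<otimes>\<^bsub>G\<^esub> (f (snd (ws ! k)) \<otimes>\<^bsub>G\<^esub> word_value G f s (drop (Suc k) ws))"
  by (cases "ws ! k") (simp add: Cons_nth_drop_Suc[symmetric])

context normal_hnn begin

lemma hnn_hom_conj:
  assumes "group G" "hnn_hom B H \<phi> G f s"
  shows "h \<in> H \<Longrightarrow> inv\<^bsub>G\<^esub> s \<otimes>\<^bsub>G\<^esub> (f h \<otimes>\<^bsub>G\<^esub> s) = f (\<phi> h)"
    and "k \<in> K \<Longrightarrow> s \<otimes>\<^bsub>G\<^esub> (f k \<otimes>\<^bsub>G\<^esub> inv\<^bsub>G\<^esub> s) = f (\<psi> k)"
proof -
  interpret G: group G by fact
  have fh: "f \<in> hom B G" and s: "s \<in> carrier G"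
    and c: "\<And>h. h \<in> H \<Longrightarrow> f h \<otimes>\<^bsub>G\<^esub> s = s \<otimes>\<^bsub>G\<^esub> f (\<phi> h)"
    using assms(2) by (auto simp: hnn_hom_def)
  have fc: "f b \<in> carrier G" if "b \<in> carrier B" for b using fh that by (auto simp: hom_def)
  show "inv\<^bsub>G\<^esub> s \<otimes>\<^bsub>G\<^esub> (f h \<otimes>\<^bsub>G\<^esub> s) = f (\<phi> h)"
    if h: "h \<in> H"
    unfolding c[OF h] using s fc[of "\<phi> h"] h by (simp add: G.m_assoc[symmetric])
  show "s \<otimes>\<^bsub>G\<^esub> (f k \<otimes>\<^bsub>G\<^esub> inv\<^bsub>G\<^esub> s) = f (\<psi> k)"
    if k: "k \<in> K"
  proof -
    have "s \<otimes>\<^bsub>G\<^esub> f k = f (\<psi> k) \<otimes>\<^bsub>G\<^esub> s" using c[OF \<psi>_H[OF k]] k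
      by simp
    then have "s \<otimes>\<^bsub>G\<^esub> f k \<otimes>\<^bsub>G\<^esub> inv\<^bsub>G\<^esub> s = f (\<psi> k)"
      using s fc[of "\<psi> k"] k by (simp add: G.m_assoc)
    then show ?thesis using s fc[of k] k by (simp add: G.m_assoc)
  qed
qed

text \<open>No subword \<open>t k t\<inverse>\<close> with \<open>k \<in> K\<close> or \<open>t\<inverse> h t\<close> with \<open>h \<in> H\<close>.\<close>

definition reduced :: "(bool \<times> 'b) list \<Rightarrow> bool" where
  "reduced ws \<longleftrightarrow> (\<forall>i. Suc i < length ws \<longrightarrow> fst (ws ! i) \<noteq> fst (ws ! Suc i) \<longrightarrow>
     snd (ws ! i) \<notin> (if fst (ws ! i) then K else H))"

lemma shorten_unreduced:
  assumes G: "group G" and f: "hnn_hom B H \<phi> G f s"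
  shows "ws \<in> syllables B \<Longrightarrow> Suc i < length ws \<Longrightarrow> fst (ws ! i) \<noteq> fst (ws ! Suc i) \<Longrightarrow>
     snd (ws ! i) \<in> (if fst (ws ! i) then K else H) \<Longrightarrow> b \<in> carrier B \<Longrightarrow>
     \<exists>b'\<in>carrier B. \<exists>ws'\<in>syllables B. length ws' < length ws \<and> f b \<otimes>\<^bsub>G\<^esub> word_value G f s ws = f b' \<otimes>\<^bsub>G\<^esub> word_value G f s ws'"
proof (induction i arbitrary: ws b)
  case 0
  interpret G: group G by fact
  have fh: "f \<in> hom B G" and s: "s \<in> carrier G" using f by (auto simp: hnn_hom_def)
  have fc: "f b \<in> carrier G" if "b \<in> carrier B" for b using fh that by (auto simp: hom_def)
  have fm: "f (x \<otimes> y) = f x \<otimes>\<^bsub>G\<^esub> f y" if "x \<in> carrier B"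
    "y \<in> carrier B" for x y using fh that by (auto simp: hom_def)
  obtain e c e' c' zs where ws: "ws = (e, c) # (e', c') # zs"
    using 0(2) by (cases ws; cases "tl ws") auto
  have c: "c \<in> carrier B" "c' \<in> carrier B" "zs \<in> syllables B" and e: "e' = (\<not> e)"
    and cK: "c \<in> (if e then K else H)" using 0 ws by auto
  define d where "d = (if e then \<psi> c else \<phi> c)"
  have d: "d \<in> carrier B" using cK c by (auto simp: d_def split: if_splits)
  have v: "word_value G f s zs \<in> carrier G" using word_value_closed[OF G fh s c(3)] .
  let ?p = "if e then s else inv\<^bsub>G\<^esub> s" and ?q = "if e then inv\<^bsub>G\<^esub> s else s"
  have pcq: "?p \<otimes>\<^bsub>G\<^esub> (f c \<otimes>\<^bsub>G\<^esub> ?q) = f d"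
    using cK hnn_hom_conj[OF G f] by (auto simp: d_def split: if_splits)
  have "word_value G f s ws = ?p \<otimes>\<^bsub>G\<^esub> (f c \<otimes>\<^bsub>G\<^esub> ?q) \<otimes>\<^bsub>G\<^esub> (f c' \<otimes>\<^bsub>G\<^esub> word_value G f s zs)"
    using s fc c v by (auto simp: ws e G.m_assoc)
  then have "f b \<otimes>\<^bsub>G\<^esub> word_value G f s ws = f (b \<otimes> d \<otimes> c') \<otimes>\<^bsub>G\<^esub> word_value G f s zs"
    unfolding pcq using 0(5) d c fc v by (simp add: fm G.m_assoc)
  then show ?case using 0(5) d c ws by (intro bexI[of _ "b \<otimes> d \<otimes> c'"] bexI[of _ zs]) auto
next
  case (Suc i)
  obtain e c zs where ws: "ws = (e, c) # zs" using Suc.prems(2) by (cases ws) auto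
  have c: "c \<in> carrier B" "zs \<in> syllables B" using Suc.prems ws by auto
  obtain b' ws' where "b' \<in> carrier B" "ws' \<in> syllables B" "length ws' < length zs"
    "f c \<otimes>\<^bsub>G\<^esub> word_value G f s zs = f b' \<otimes>\<^bsub>G\<^esub> word_value G f s ws'"
    using Suc.IH[OF c(2) _ _ _ c(1)] Suc.prems ws by auto
  then show ?case using Suc.prems(5) ws by (intro bexI[of _ b] bexI[of _ "(e, b') # ws'"]) auto
qed

lemma HNN_hnn_hom: "hnn_hom B H \<phi> (HNN B H \<phi>) (hnn_base B H \<phi>) (hnn_stable B H \<phi>)"
  unfolding hnn_hom_def
proof (intro conjI ballI)
  interpret E: group "HNN B H \<phi>" by (rule HNN_group)
  fix h assume h: "h \<in> H"
  have "hnn_base B H \<phi> h \<in> carrier (HNN B H \<phi>)" using hnn_base_hom h by (auto simp: hom_def)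
  then show "hnn_base B H \<phi> h \<otimes>\<^bsub>HNN B H \<phi>\<^esub> hnn_stable B H \<phi> = hnn_stable B H \<phi> \<otimes>\<^bsub>HNN B H \<phi>\<^esub> hnn_base B H \<phi> (\<phi> h)"
    unfolding hnn_conj[OF h, symmetric] using hnn_stable_carrier by (simp add: E.m_assoc[symmetric])
qed (fact hnn_base_hom hnn_stable_carrier)+

lemma HNN_syllables:
  assumes "x \<in> carrier (HNN B H \<phi>)"
  shows "\<exists>b\<in>carrier B. \<exists>ws\<in>syllables B.
     x = hnn_base B H \<phi> b \<otimes>\<^bsub>HNN B H \<phi>\<^esub> word_value (HNN B H \<phi>) (hnn_base B H \<phi>) (hnn_stable B H \<phi>) ws"
proof -
  interpret E: group "HNN B H \<phi>" by (rule HNN_group)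
  let ?s = "hnn_stable B H \<phi>" and ?f = "hnn_base B H \<phi>"
  let ?v = "word_value (HNN B H \<phi>) ?f ?s"
  have f: "?f b \<in> carrier (HNN B H \<phi>)" if "b \<in> carrier B" for b using hnn_base_hom that
    by (auto simp: hom_def)
  have f1: "?f \<one> = \<one>\<^bsub>HNN B H \<phi>\<^esub>" using hom_one[OF hnn_base_hom is_group E.is_group] .
  have v: "?v ws \<in> carrier (HNN B H \<phi>)" if "ws \<in> syllables B" for ws
    using word_value_closed[OF E.is_group hnn_base_hom hnn_stable_carrier that] .
  obtain u where u: "u \<in> hnn_words B" "x = hnn_rel B H \<phi> `` {u}" using assms HNN_carrier_iff by blast
  have "\<exists>b\<in>carrier B. \<exists>ws\<in>syllables B. hnn_rel B H \<phi> `` {u} = ?f b \<otimes>\<^bsub>HNN B H \<phi>\<^esub> ?v ws"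
    using u(1)
  proof (induction u)
    case Nil
    then show ?case using f1 by (intro bexI[of _ \<one>] bexI[of _ "[]"]) (simp_all add: HNN_one[symmetric])
  next
    case (Cons a u)
    then have a: "[a] \<in> hnn_words B" and u: "u \<in> hnn_words B" using hnn_words_Cons[of a u] by blast+
    obtain b ws where b: "b \<in> carrier B" "ws \<in> syllables B"
      and eq: "hnn_rel B H \<phi> `` {u} = ?f b \<otimes>\<^bsub>HNN B H \<phi>\<^esub> ?v ws" using Cons.IH[OF u]
        by blast
    have m: "hnn_rel B H \<phi> `` {a # u} = hnn_rel B H \<phi> `` {[a]} \<otimes>\<^bsub>HNN B H \<phi>\<^esub> (?f b \<otimes>\<^bsub>HNN B H \<phi>\<^esub> ?v ws)"
      using HNN_mult_class[OF a u] eq by simp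
    show ?case
    proof (cases a)
      case (Base c)
      then have c: "c \<in> carrier B" using a by simp
      have "?f (c \<otimes> b) = ?f c \<otimes>\<^bsub>HNN B H \<phi>\<^esub> ?f b" using hnn_base_hom b c
        by (auto simp: hom_def)
      then have "hnn_rel B H \<phi> `` {a # u} = ?f (c \<otimes> b) \<otimes>\<^bsub>HNN B H \<phi>\<^esub> ?v ws"
        unfolding m using Base f b c v by (simp add: hnn_base_def[symmetric] E.m_assoc)
      then show ?thesis using b c by blast
    next
      case Stable
      have "hnn_rel B H \<phi> `` {a # u} = ?f \<one> \<otimes>\<^bsub>HNN B H \<phi>\<^esub> ?v ((True, b) # ws)"
        unfolding m f1 using Stable f b v hnn_stable_carrier by (simp add: hnn_stable_def[symmetric])
      then show ?thesis using b by (intro bexI[of _ \<one>] bexI[of _ "(True, b) # ws"]) auto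
    next
      case Stable_inv
      have "hnn_rel B H \<phi> `` {a # u} = ?f \<one> \<otimes>\<^bsub>HNN B H \<phi>\<^esub> ?v ((False, b) # ws)"
        unfolding m f1 using Stable_inv f b v hnn_stable_carrier by (simp add: hnn_stable_inv[symmetric])
      then show ?thesis using b by (intro bexI[of _ \<one>] bexI[of _ "(False, b) # ws"]) auto
    qed
  qed
  then show ?thesis using u(2) by simp
qed

text \<open>A shortest expression is reduced, since a violation can be replaced by an element of the base group.\<close>

lemma HNN_reduced_form:
  assumes "x \<in> carrier (HNN B H \<phi>)"
  obtains b ws where "b \<in> carrier B" "ws \<in> syllables B" "reduced ws"
     "x = hnn_base B H \<phi> b \<otimes>\<^bsub>HNN B H \<phi>\<^esub> word_value (HNN B H \<phi>) (hnn_base B H \<phi>) (hnn_stable B H \<phi>) ws"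
proof -
  define rep where "rep = (\<lambda>(b, ws). b \<in> carrier B \<and> ws \<in> syllables B \<and>
    x = hnn_base B H \<phi> b \<otimes>\<^bsub>HNN B H \<phi>\<^esub> word_value (HNN B H \<phi>) (hnn_base B H \<phi>) (hnn_stable B H \<phi>) ws)"
  obtain p0 where "rep p0" using HNN_syllables[OF assms] by (auto simp: rep_def)
  then obtain p where p: "rep p" "\<And>q. rep q \<Longrightarrow> length (snd p) \<le> length (snd q)"
    using ex_has_least_nat[of rep p0 "length \<circ> snd"] by auto
  obtain b ws where bw: "p = (b, ws)" by (cases p)
  have "reduced ws"
  proof (rule ccontr)
    assume "\<not> reduced ws"
    then obtain i where "Suc i < length ws" "fst (ws ! i) \<noteq> fst (ws ! Suc i)"
      "snd (ws ! i) \<in> (if fst (ws ! i) then K else H)" unfolding reduced_def by blast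
    then obtain b' ws' where "rep (b', ws')" "length ws' < length ws"
      using shorten_unreduced[OF HNN_group HNN_hnn_hom, of ws i b] p(1) unfolding bw rep_def by auto
    then show False using p(2)[of "(b', ws')"] by (simp add: bw)
  qed
  then show thesis using that[of b ws] p(1) unfolding bw rep_def by simp
qed

lemma HNN_hom_ex:
  assumes "group G" "hnn_hom B H \<phi> G f s"
  obtains \<tau> where "\<tau> \<in> hom (HNN B H \<phi>) G"
    "\<And>b. b \<in> carrier B \<Longrightarrow> \<tau> (hnn_base B H \<phi> b) = f b"
    "\<And>b ws. b \<in> carrier B \<Longrightarrow> ws \<in> syllables B \<Longrightarrow>
       \<tau> (hnn_base B H \<phi> b \<otimes>\<^bsub>HNN B H \<phi>\<^esub> word_value (HNN B H \<phi>) (hnn_base B H \<phi>) (hnn_stable B H \<phi>) ws) = f b \<otimes>\<^bsub>G\<^esub> word_value G f s ws"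
proof -
  interpret G: group G by fact
  have fh: "f \<in> hom B G" and s: "s \<in> carrier G" using assms(2) by (auto simp: hnn_hom_def)
  have fc: "f b \<in> carrier G" if "b \<in> carrier B" for b using fh that by (auto simp: hom_def)
  have "inv\<^bsub>G\<^esub> s \<otimes>\<^bsub>G\<^esub> f h \<otimes>\<^bsub>G\<^esub> s = f (\<phi> h)"
    if h: "h \<in> H" for h
    using hnn_hom_conj(1)[OF assms h] s fc[of h] h by (simp add: G.m_assoc)
  from HNN_universal[OF assms(1) fh s this] obtain \<tau> where \<tau>: "\<tau> \<in> hom (HNN B H \<phi>) G"
    and b: "\<forall>b\<in>carrier B. \<tau> (hnn_base B H \<phi> b) = f b"
      and t: "\<tau> (hnn_stable B H \<phi>) = s" by blast
  have cong: "word_value G (\<tau> \<circ> hnn_base B H \<phi>) s ws = word_value G f s ws"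
    if "ws \<in> syllables B" for ws
    using that by (induction ws) (use b in \<open>auto\<close>)
  have "\<tau> (hnn_base B H \<phi> c \<otimes>\<^bsub>HNN B H \<phi>\<^esub> word_value (HNN B H \<phi>) (hnn_base B H \<phi>) (hnn_stable B H \<phi>) ws) = f c \<otimes>\<^bsub>G\<^esub> word_value G f s ws"
    if c: "c \<in> carrier B" and ws: "ws \<in> syllables B" for c ws
  proof -
    have "hnn_base B H \<phi> c \<in> carrier (HNN B H \<phi>)" using hnn_base_hom c by (auto simp: hom_def)
    moreover have "word_value (HNN B H \<phi>) (hnn_base B H \<phi>) (hnn_stable B H \<phi>) ws \<in> carrier (HNN B H \<phi>)"
      using word_value_closed[OF HNN_group hnn_base_hom hnn_stable_carrier ws] .
    ultimately show ?thesis
      using hom_mult[OF \<tau>] b c t cong[OF ws] word_value_hom[OF HNN_group assms(1) \<tau> hnn_base_hom hnn_stable_carrier ws] by simp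
  qed
  then show thesis using that \<tau> b by blast
qed

end

section \<open>Separating reduced words\<close>

context normal_hnn begin

text \<open>
  A pair \<open>(f, s)\<close> with values in \<open>G\<close> defines a graph: its vertices are the orbits of \<open>f B\<close> on \<open>G\<close> under
  left multiplication, its edges are the orbits of \<open>f K\<close>, and the edge of \<open>x\<close> leads from the vertex of \<open>x\<close> to
  the vertex of \<open>s \<cdot> x\<close>. The suffixes of a word, evaluated in \<open>G\<close>, describe a path in this graph, and a
  coincidence is a vertex that this path visits twice.
\<close>

definition coincidences :: "('g, 'k) monoid_scheme \<Rightarrow> ('b \<Rightarrow> 'g) \<Rightarrow> 'g \<Rightarrow> (bool \<times> 'b) list \<Rightarrow> (nat \<times> nat) set" where
  "coincidences G f s ws = {(i, j). i < j \<and> j \<le> length ws \<and>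
     (\<exists>b\<in>carrier B. word_value G f s (drop i ws) = f b \<otimes>\<^bsub>G\<^esub> word_value G f s (drop j ws))}"

lemma finite_coincidences: "finite (coincidences G f s ws)"
  by (rule finite_subset[of _ "{..length ws} \<times> {..length ws}"]) (auto simp: coincidences_def)

text \<open>
  The word stays reduced modulo \<open>N\<close>, the kernel of \<open>f\<close> on the base group; phrased through the kernel alone, the
  property is inherited by all pairs with the same kernel.
\<close>

definition reduced_mod :: "('b \<Rightarrow> bool) \<Rightarrow> (bool \<times> 'b) list \<Rightarrow> bool" where
  "reduced_mod N ws \<longleftrightarrow> (\<forall>i. Suc i < length ws \<longrightarrow> fst (ws ! i) \<noteq> fst (ws ! Suc i) \<longrightarrow>
     (\<forall>c\<in>(if fst (ws ! i) then K else H). \<not> N (c \<otimes> snd (ws ! i))))"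

text \<open>
  A reduced word describes a path without backtracking. Choose a coincidence \<open>(i, j)\<close> with \<open>j - i\<close> minimal.
  Then the closed path between its two visits does not traverse the edge of its syllable \<open>i\<close> a second
  time: a repetition with the same or with the opposite orientation would give a closer coincidence or a
  backtracking. Labelling this one edge by \<open>a0 \<noteq> 1\<close> in a member \<open>A\<close> of the class, and all others trivially, turns \<open>s\<close>
  into an element of the wreath product of \<open>A\<close> by \<open>G\<close>; this amounts to passing to a covering of the graph.
  The label collected along the closed path is \<open>a0\<close> or its inverse, so the chosen coincidence
  disappears, and no new one appears because \<open>G\<close> is recovered from the new pair.
\<close>

lemma separate_coincidence:
  assumes G: "G \<in> \<C>" and f: "hnn_hom B H \<phi> G f s" and ws: "ws \<in> syllables B"
    and red: "reduced_mod (\<lambda>b. f b = \<one>\<^bsub>G\<^esub>) ws" and ne: "coincidences G f s ws \<noteq> {}"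
  shows "\<exists>G'\<in>\<C>. \<exists>f' s'. hnn_hom B H \<phi> G' f' s' \<and> (\<forall>b\<in>carrier B. f' b = \<one>\<^bsub>G'\<^esub> \<longleftrightarrow> f b = \<one>\<^bsub>G\<^esub>) \<and>
     coincidences G' f' s' ws \<subset> coincidences G f s ws"
proof -
  interpret G: group G using member_group[OF G] .
  have fh: "f \<in> hom B G" and s [simp]: "s \<in> carrier G"
    and c: "\<And>h. h \<in> H \<Longrightarrow> f h \<otimes>\<^bsub>G\<^esub> s = s \<otimes>\<^bsub>G\<^esub> f (\<phi> h)"
    using f by (auto simp: hnn_hom_def)
  interpret f: group_hom B G f using fh by (simp add: group_hom_def group_hom_axioms_def is_group)
  define v where "v = (\<lambda>k. word_value G f s (drop k ws))"
  define y where "y = (\<lambda>k. f (snd (ws ! k)) \<otimes>\<^bsub>G\<^esub> v (Suc k))"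
  have v_car [simp]: "v k \<in> carrier G" for k
    unfolding v_def using word_value_closed[OF G.is_group fh s syllables_drop[OF ws]] .
  have bk [simp]: "snd (ws ! k) \<in> carrier B" if "k < length ws" for k using syllables_nth[OF ws that] .
  have y_car [simp]: "y k \<in> carrier G" if "k < length ws" for k using that by (simp add: y_def)
  have vy: "v k = (if fst (ws ! k) then s else inv\<^bsub>G\<^esub> s) \<otimes>\<^bsub>G\<^esub> y k"
    if "k < length ws" for k
    unfolding v_def y_def using word_value_drop[OF that] .
  have coI: "(p, q) \<in> coincidences G f s ws" if "p < q" "q \<le> length ws" "b \<in> carrier B"
    "v p = f b \<otimes>\<^bsub>G\<^esub> v q" for p q b
    using that by (auto simp: coincidences_def v_def)
  have swap: "x' = f (inv b) \<otimes>\<^bsub>G\<^esub> x" if "b \<in> carrier B" "x' \<in> carrier G"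
    "x = f b \<otimes>\<^bsub>G\<^esub> x'" for b x x'
    using that by (simp add: G.m_assoc[symmetric])
  obtain p0 where p0: "p0 \<in> coincidences G f s ws" using ne by blast
  obtain p where p: "p \<in> coincidences G f s ws"
    and p_min: "\<And>q. q \<in> coincidences G f s ws \<Longrightarrow> snd p - fst p \<le> snd q - fst q"
    using ex_has_least_nat[of "\<lambda>p. p \<in> coincidences G f s ws" p0 "\<lambda>p. snd p - fst p"] p0 by auto
  obtain i j where ij: "p = (i, j)" by (cases p)
  have i: "i < j" "j \<le> length ws" using p by (auto simp: ij coincidences_def)
  have min: False if "(i', j') \<in> coincidences G f s ws" "j' - i' < j - i" for i' j'
    using p_min[OF that(1)] that(2) by (simp add: ij)
  \<comment> \<open>Syllable \<open>k\<close> leads from the vertex of \<open>y k\<close> to that of \<open>v k\<close>. The origin of its edge is a point of the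
    former for a positive sign, and of the latter for a negative one.\<close>
  define pt where "pt = (\<lambda>k. if fst (ws ! k) then y k else v k)"
  have pt_car [simp]: "pt k \<in> carrier G" if "k < length ws" for k using that by (simp add: pt_def)
  have new_edge: False if k: "i < k" "k < j" and \<kappa>: "\<kappa> \<in> K"
    and eq: "pt k = f \<kappa> \<otimes>\<^bsub>G\<^esub> pt i" for k \<kappa>
  proof -
    have il: "i < length ws" and kl: "k < length ws" using i k by auto
    have \<kappa>c: "\<kappa> \<in> carrier B" and \<psi>c: "\<psi> \<kappa> \<in> carrier B" using \<kappa> by auto
    have s\<kappa>: "s \<otimes>\<^bsub>G\<^esub> f \<kappa> = f (\<psi> \<kappa>) \<otimes>\<^bsub>G\<^esub> s"
      using c[OF \<psi>_H[OF \<kappa>]] \<kappa> by simp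
    have far: "v k = f d \<otimes>\<^bsub>G\<^esub> v (Suc i) \<Longrightarrow> d \<in> carrier B \<Longrightarrow> k = Suc i" for d
    proof (rule ccontr)
      assume d: "v k = f d \<otimes>\<^bsub>G\<^esub> v (Suc i)" "d \<in> carrier B" and "k \<noteq> Suc i"
      then have "Suc i < k" using k by simp
      moreover have "v (Suc i) = f (inv d) \<otimes>\<^bsub>G\<^esub> v k" using swap[OF d(2) _ d(1)] by simp
      ultimately have "(Suc i, k) \<in> coincidences G f s ws" using kl d by (intro coI[of _ _ "inv d"]) auto
      then show False using min k by force
    qed
    have bt: "f d = \<one>\<^bsub>G\<^esub>" if "v k = f d \<otimes>\<^bsub>G\<^esub> v (Suc i)"
      "d \<in> carrier B" for d
      using far[OF that] that by (metis G.r_cancel_one' f.hom_closed v_car)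
    show False
    proof (cases "fst (ws ! i)"; cases "fst (ws ! k)")
      assume e: "fst (ws ! i)" "fst (ws ! k)"
      define d where "d = inv (snd (ws ! k)) \<otimes> \<kappa> \<otimes> snd (ws ! i)"
      have d: "d \<in> carrier B" using il kl \<kappa>c by (simp add: d_def)
      have "f (snd (ws ! k)) \<otimes>\<^bsub>G\<^esub> v (Suc k) = f (\<kappa> \<otimes> snd (ws ! i)) \<otimes>\<^bsub>G\<^esub> v (Suc i)"
        using eq e il \<kappa>c by (simp add: pt_def y_def G.m_assoc)
      then have "v (Suc k) = f (inv (snd (ws ! k))) \<otimes>\<^bsub>G\<^esub> (f (\<kappa> \<otimes> snd (ws ! i)) \<otimes>\<^bsub>G\<^esub> v (Suc i))"
        using swap[of "snd (ws ! k)" "v (Suc k)"] kl by simp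
      then have "v (Suc k) = f d \<otimes>\<^bsub>G\<^esub> v (Suc i)" using il kl \<kappa>c
        by (simp add: d_def G.m_assoc)
      then have "v (Suc i) = f (inv d) \<otimes>\<^bsub>G\<^esub> v (Suc k)" using swap[OF d] by simp
      then have "(Suc i, Suc k) \<in> coincidences G f s ws" using k kl d by (intro coI[of _ _ "inv d"]) auto
      then show False using min k by force
    next
      assume e: "\<not> fst (ws ! i)" "\<not> fst (ws ! k)"
      then have "v k = f \<kappa> \<otimes>\<^bsub>G\<^esub> v i" using eq by (simp add: pt_def)
      then have "v i = f (inv \<kappa>) \<otimes>\<^bsub>G\<^esub> v k" using swap[OF \<kappa>c] by simp
      then have "(i, k) \<in> coincidences G f s ws" using k kl \<kappa>c by (intro coI[of _ _ "inv \<kappa>"]) auto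
      then show False using min k by force
    next
      assume e: "fst (ws ! i)" "\<not> fst (ws ! k)"
      have vk: "v k = f (\<kappa> \<otimes> snd (ws ! i)) \<otimes>\<^bsub>G\<^esub> v (Suc i)"
        using eq e il \<kappa>c by (simp add: pt_def y_def G.m_assoc)
      have "\<kappa> \<otimes> snd (ws ! i) \<in> carrier B" using il \<kappa>c by simp
      then have "k = Suc i" "f (\<kappa> \<otimes> snd (ws ! i)) = \<one>\<^bsub>G\<^esub>"
        using far[OF vk] bt[OF vk] by auto
      then show False using red kl e \<kappa> unfolding reduced_mod_def by auto
    next
      assume e: "\<not> fst (ws ! i)" "fst (ws ! k)"
      have "v k = s \<otimes>\<^bsub>G\<^esub> (f \<kappa> \<otimes>\<^bsub>G\<^esub> v i)" using vy[OF kl] eq e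
        by (simp add: pt_def)
      also have "\<dots> = f (\<psi> \<kappa>) \<otimes>\<^bsub>G\<^esub> s \<otimes>\<^bsub>G\<^esub> v i"
        using \<kappa>c by (simp add: s\<kappa>[symmetric] G.m_assoc)
      also have "\<dots> = f (\<psi> \<kappa>) \<otimes>\<^bsub>G\<^esub> y i"
      proof -
        have "s \<otimes>\<^bsub>G\<^esub> v i = y i" unfolding vy[OF il] using e il
          by (simp add: G.m_assoc[symmetric])
        then show ?thesis using \<psi>c by (simp add: G.m_assoc)
      qed
      finally have vk: "v k = f (\<psi> \<kappa> \<otimes> snd (ws ! i)) \<otimes>\<^bsub>G\<^esub> v (Suc i)"
        using il \<psi>c by (simp add: y_def G.m_assoc)
      have "\<psi> \<kappa> \<otimes> snd (ws ! i) \<in> carrier B" using il \<psi>c by simp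
      then have "k = Suc i" "f (\<psi> \<kappa> \<otimes> snd (ws ! i)) = \<one>\<^bsub>G\<^esub>"
        using far[OF vk] bt[OF vk] by auto
      then show False using red kl e \<psi>_H[OF \<kappa>] unfolding reduced_mod_def by auto
    qed
  qed
  obtain A where A: "A \<in> \<C>" "carrier A \<noteq> {\<one>\<^bsub>A\<^esub>}" using root
    unfolding root_class_def by blast
  interpret A: group A using member_group[OF A(1)] .
  obtain a0 where a0: "a0 \<in> carrier A" "a0 \<noteq> \<one>\<^bsub>A\<^esub>" using A(2) A.one_closed by blast
  interpret Aut: group "AutoGroup A" by (rule A.AutoGroup)
  let ?W = "{\<one>\<^bsub>AutoGroup A\<^esub>}"
  interpret twisted_wreath A G ?W
    using Aut.triv_subgroup by (simp add: twisted_wreath_def twisted_wreath_axioms_def)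
  define \<nu> where "\<nu> = (\<lambda>x\<in>carrier G. if \<exists>\<kappa>\<in>K. x = f \<kappa> \<otimes>\<^bsub>G\<^esub> pt i then a0 else \<one>\<^bsub>A\<^esub>)"
  have \<nu>_car: "\<nu> \<in> carrier G \<rightarrow>\<^sub>E carrier A" using a0 by (auto simp: \<nu>_def)
  have il: "i < length ws" using i by simp
  have \<nu>_inv: "\<nu> (f \<kappa> \<otimes>\<^bsub>G\<^esub> x) = \<nu> x" if \<kappa>: "\<kappa> \<in> K"
    and x: "x \<in> carrier G" for \<kappa> x
  proof -
    have "(\<exists>\<kappa>'\<in>K. f \<kappa> \<otimes>\<^bsub>G\<^esub> x = f \<kappa>' \<otimes>\<^bsub>G\<^esub> pt i) \<longleftrightarrow> (\<exists>\<kappa>'\<in>K. x = f \<kappa>' \<otimes>\<^bsub>G\<^esub> pt i)"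
    proof
      assume "\<exists>\<kappa>'\<in>K. f \<kappa> \<otimes>\<^bsub>G\<^esub> x = f \<kappa>' \<otimes>\<^bsub>G\<^esub> pt i"
      then obtain \<kappa>' where k': "\<kappa>' \<in> K"
        "f \<kappa> \<otimes>\<^bsub>G\<^esub> x = f \<kappa>' \<otimes>\<^bsub>G\<^esub> pt i" by blast
      then have "x = f (inv \<kappa>) \<otimes>\<^bsub>G\<^esub> (f \<kappa>' \<otimes>\<^bsub>G\<^esub> pt i)"
        using swap[of \<kappa> x] \<kappa> x by simp
      then have "x = f (inv \<kappa> \<otimes> \<kappa>') \<otimes>\<^bsub>G\<^esub> pt i" using \<kappa> k' il
        by (simp add: G.m_assoc)
      moreover have "inv \<kappa> \<otimes> \<kappa>' \<in> K"
        using \<kappa> k' subgroup.m_closed[OF sub(2)] subgroup.m_inv_closed[OF sub(2)] by blast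
      ultimately show "\<exists>\<kappa>'\<in>K. x = f \<kappa>' \<otimes>\<^bsub>G\<^esub> pt i" by blast
    next
      assume "\<exists>\<kappa>'\<in>K. x = f \<kappa>' \<otimes>\<^bsub>G\<^esub> pt i"
      then obtain \<kappa>' where k': "\<kappa>' \<in> K" "x = f \<kappa>' \<otimes>\<^bsub>G\<^esub> pt i" by blast
      then have "f \<kappa> \<otimes>\<^bsub>G\<^esub> x = f (\<kappa> \<otimes> \<kappa>') \<otimes>\<^bsub>G\<^esub> pt i" using \<kappa> il by (simp add: G.m_assoc)
      moreover have "\<kappa> \<otimes> \<kappa>' \<in> K" using \<kappa> k' subgroup.m_closed[OF sub(2)] by blast
      ultimately show "\<exists>\<kappa>'\<in>K. f \<kappa> \<otimes>\<^bsub>G\<^esub> x = f \<kappa>' \<otimes>\<^bsub>G\<^esub> pt i" by blast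
    qed
    then show ?thesis using \<kappa> x by (simp add: \<nu>_def)
  qed
  define c1 where "c1 = (\<lambda>y\<in>carrier G. \<one>\<^bsub>A\<^esub>)"
  have c1: "c1 \<in> carrier G \<rightarrow>\<^sub>E carrier A" by (auto simp: c1_def)
  define \<eta> where "\<eta> = (\<lambda>b. (c1, f b, \<one>\<^bsub>AutoGroup A\<^esub>))"
  define t where "t = (\<nu>, s, \<one>\<^bsub>AutoGroup A\<^esub>)"
  define ti where "ti = (\<lambda>x\<in>carrier G. inv\<^bsub>A\<^esub> \<nu> (inv\<^bsub>G\<^esub> s \<otimes>\<^bsub>G\<^esub> x), inv\<^bsub>G\<^esub> s, \<one>\<^bsub>AutoGroup A\<^esub>)"
  have t: "t \<in> carrier T" using \<nu>_car by (simp add: t_def carrier_twreath)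
  have ti: "ti \<in> carrier T" using PiE_A[OF \<nu>_car] by (auto simp: ti_def carrier_twreath)
  have "inv\<^bsub>G\<^esub> s \<otimes>\<^bsub>G\<^esub> (s \<otimes>\<^bsub>G\<^esub> x) = x"
    if "x \<in> carrier G" for x using that by (simp add: G.m_assoc[symmetric])
  then have "ti \<otimes>\<^bsub>T\<^esub> t = \<one>\<^bsub>T\<^esub>"
    using PiE_A[OF \<nu>_car] by (auto simp: ti_def t_def mult_twreath one_twreath intro!: restrict_ext)
  then have inv_t: "inv\<^bsub>T\<^esub> t = ti" using T.inv_equality t ti by blast
  have \<eta>c: "\<eta> b \<in> carrier T" if "b \<in> carrier B" for b using c1 that
    by (simp add: \<eta>_def carrier_twreath)
  have \<eta>: "\<eta> \<in> hom B T"
    by (rule homI) (use \<eta>c in \<open>auto simp: \<eta>_def mult_twreath c1_def intro!: restrict_ext\<close>)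
  have \<eta>t: "hnn_hom B H \<phi> T \<eta> t"
    unfolding hnn_hom_def
  proof (intro conjI ballI)
    fix h assume h: "h \<in> H"
    show "\<eta> h \<otimes>\<^bsub>T\<^esub> t = t \<otimes>\<^bsub>T\<^esub> \<eta> (\<phi> h)"
      using c[OF h] \<nu>_inv[OF \<phi>_K[OF h]] PiE_A[OF \<nu>_car] h
      by (auto simp: \<eta>_def t_def c1_def mult_twreath intro!: restrict_ext)
  qed (fact \<eta> t)+
  obtain G' \<tau> X where G': "G' \<in> \<C>" and f': "hnn_hom B H \<phi> G' (\<tau> \<circ> \<eta>) (\<tau> t)"
    and X: "subgroup X T"
    and \<tau>: "\<tau> \<in> hom (T\<lparr>carrier := X\<rparr>) G'" and tX: "t \<in> X"
      and \<eta>X': "\<eta> ` carrier B \<subseteq> X"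
    and sep: "\<forall>x\<in>X. \<forall>y\<in>X. \<tau> x = \<tau> y \<longrightarrow> snd x = snd y \<and> fst x \<one>\<^bsub>G\<^esub> = fst y \<one>\<^bsub>G\<^esub>"
    using gruenberg_hnn[OF in_class_member[OF iso_closed A(1)] in_class_member[OF iso_closed G] Aut.triv_subgroup
        in_class_trivial[OF Aut.is_group] small \<eta>t H_\<phi>_car] by blast
  have \<eta>X: "\<eta> b \<in> X" if "b \<in> carrier B" for b using \<eta>X' that by blast
  interpret G': group G' using member_group[OF G'] .
  have gX: "group (T\<lparr>carrier := X\<rparr>)" using subgroup.subgroup_is_group[OF X T.is_group] .
  \<comment> \<open>The word is evaluated before \<open>\<tau>\<close> is applied; \<open>\<alpha> k\<close> is the label collected by the suffix from \<open>k\<close> on.\<close>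
  define V where "V = (\<lambda>k. word_value T \<eta> t (drop k ws))"
  have V_word: "word_value (T\<lparr>carrier := X\<rparr>) \<eta> t us = word_value T \<eta> t us" for us
    using T.m_inv_consistent[OF X tX]
    by (induction us rule: word_value.induct[of _ T \<eta> t]) (auto simp: one_twreath)
  have \<eta>hX: "\<eta> \<in> hom B (T\<lparr>carrier := X\<rparr>)" using \<eta> \<eta>X by (auto simp: hom_def)
  have VX: "V k \<in> X" for k
    using word_value_closed[OF gX \<eta>hX _ syllables_drop[OF ws], of t k] tX by (simp add: V_word V_def)
  have \<tau>V: "word_value G' (\<tau> \<circ> \<eta>) (\<tau> t) (drop k ws) = \<tau> (V k)" for k
    using word_value_hom[OF gX G'.is_group \<tau> \<eta>hX _ syllables_drop[OF ws], of t k] tX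
    by (simp add: V_word V_def)
  have V_car: "V k \<in> carrier T" for k using VX subgroup.mem_carrier[OF X] by blast
  have V_snd: "snd (V k) = (v k, \<one>\<^bsub>AutoGroup A\<^esub>)" for k
  proof -
    have "fst \<circ> snd \<in> hom T G" by (auto simp: hom_def carrier_twreath mult_twreath)
    then have "(fst \<circ> snd) (word_value T \<eta> t (drop k ws)) = word_value G (fst \<circ> snd \<circ> \<eta>) ((fst \<circ> snd) t) (drop k ws)"
      by (rule word_value_hom[OF T.is_group G.is_group _ \<eta> t syllables_drop[OF ws]])
    moreover have "fst \<circ> snd \<circ> \<eta> = f" "(fst \<circ> snd) t = s" by (auto simp: \<eta>_def t_def)
    ultimately have "fst (snd (V k)) = v k" by (simp add: V_def v_def)
    moreover have "snd (snd (V k)) = \<one>\<^bsub>AutoGroup A\<^esub>" using V_car[of k]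
      by (auto simp: carrier_twreath)
    ultimately show ?thesis by (simp add: prod_eq_iff)
  qed
  define \<alpha> where "\<alpha> = (\<lambda>k. fst (V k) \<one>\<^bsub>G\<^esub>)"
  have V_fst: "fst (V k) \<in> carrier G \<rightarrow>\<^sub>E carrier A" for k using V_car[of k]
    by (auto simp: carrier_twreath)
  have \<alpha>_car: "\<alpha> k \<in> carrier A" for k using PiE_A[OF V_fst] by (simp add: \<alpha>_def)
  have V_eq: "V k = (fst (V k), v k, \<one>\<^bsub>AutoGroup A\<^esub>)" for k using V_snd[of k]
    by (simp add: prod_eq_iff)
  have \<eta>V: "\<eta> b \<otimes>\<^bsub>T\<^esub> V k = (fst (V k), f b \<otimes>\<^bsub>G\<^esub> v k, \<one>\<^bsub>AutoGroup A\<^esub>)" if b: "b \<in> carrier B" for b k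
  proof -
    have "(\<lambda>y\<in>carrier G. \<one>\<^bsub>AutoGroup A\<^esub> (fst (V k) y) \<otimes>\<^bsub>A\<^esub> c1 (v k \<otimes>\<^bsub>G\<^esub> y)) = fst (V k)"
      using PiE_A[OF V_fst] V_fst[of k] by (intro extensionalityI[of _ "carrier G"]) (auto simp: c1_def PiE_def)
    then show ?thesis unfolding \<eta>_def by (subst V_eq) (simp add: mult_twreath)
  qed
  have \<alpha>_step: "\<alpha> k = \<alpha> (Suc k) \<otimes>\<^bsub>A\<^esub> (if fst (ws ! k) then \<nu> (pt k) else inv\<^bsub>A\<^esub> \<nu> (pt k))" if k: "k < length ws" for k
  proof -
    have Vk: "V k = (if fst (ws ! k) then t else ti) \<otimes>\<^bsub>T\<^esub> (fst (V (Suc k)), y k, \<one>\<^bsub>AutoGroup A\<^esub>)"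
      unfolding V_def word_value_drop[OF k] inv_t using \<eta>V[OF bk[OF k], of "Suc k"] by (simp add: V_def y_def)
    have [simp]: "fst (V (Suc k)) \<one>\<^bsub>G\<^esub> \<in> carrier A" using PiE_A[OF V_fst] by simp
    show ?thesis
    proof (cases "fst (ws ! k)")
      case True
      then have "fst (V k) \<one>\<^bsub>G\<^esub> = fst (V (Suc k)) \<one>\<^bsub>G\<^esub> \<otimes>\<^bsub>A\<^esub> \<nu> (y k)"
        unfolding Vk using k by (simp add: t_def mult_twreath)
      then show ?thesis using True by (simp add: \<alpha>_def pt_def)
    next
      case False
      then have "fst (V k) \<one>\<^bsub>G\<^esub> = fst (V (Suc k)) \<one>\<^bsub>G\<^esub> \<otimes>\<^bsub>A\<^esub> inv\<^bsub>A\<^esub> \<nu> (inv\<^bsub>G\<^esub> s \<otimes>\<^bsub>G\<^esub> y k)"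
        unfolding Vk using k by (simp add: ti_def mult_twreath)
      then show ?thesis using False vy[OF k] by (simp add: \<alpha>_def pt_def)
    qed
  qed
  have \<nu>_1: "\<nu> (pt k) = \<one>\<^bsub>A\<^esub>" if "i < k" "k < j" for k
    using new_edge[OF that] that i by (auto simp: \<nu>_def)
  have "\<alpha> (Suc i) = \<alpha> j"
  proof -
    have "Suc i + d \<le> j \<Longrightarrow> \<alpha> (Suc i + d) = \<alpha> (Suc i)" for d
    proof (induction d)
      case (Suc d)
      have "\<alpha> (Suc i + d) = \<alpha> (Suc (Suc i + d))"
        using \<alpha>_step[of "Suc i + d"] \<nu>_1[of "Suc i + d"] Suc.prems i \<alpha>_car[of "Suc (Suc i + d)"]
        by simp
      then show ?case using Suc by simp
    qed simp
    from this[of "j - Suc i"] show ?thesis using i by simp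
  qed
  moreover have "\<nu> (pt i) = a0"
  proof -
    have "\<one> \<in> K" using subgroup.one_closed[OF sub(2)] .
    then have "\<exists>\<kappa>\<in>K. pt i = f \<kappa> \<otimes>\<^bsub>G\<^esub> pt i" using il
      by (intro bexI[of _ \<one>]) auto
    then show ?thesis using il by (simp add: \<nu>_def)
  qed
  ultimately have \<alpha>ij: "\<alpha> i \<noteq> \<alpha> j"
    using \<alpha>_step[OF il] a0 \<alpha>_car[of j] by auto
  have desc: "(\<exists>b\<in>carrier B. v p = f b \<otimes>\<^bsub>G\<^esub> v q) \<and> \<alpha> p = \<alpha> q"
    if b: "b \<in> carrier B" and eq: "\<tau> (V p) = (\<tau> \<circ> \<eta>) b \<otimes>\<^bsub>G'\<^esub> \<tau> (V q)" for b p q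
  proof -
    have "\<tau> (V p) = \<tau> (\<eta> b \<otimes>\<^bsub>T\<^esub> V q)" using eq \<tau> \<eta>X[OF b] VX
      by (auto simp: hom_def)
    then have "snd (V p) = snd (\<eta> b \<otimes>\<^bsub>T\<^esub> V q) \<and> fst (V p) \<one>\<^bsub>G\<^esub> = fst (\<eta> b \<otimes>\<^bsub>T\<^esub> V q) \<one>\<^bsub>G\<^esub>"
      using sep VX subgroup.m_closed[OF X \<eta>X[OF b] VX] by blast
    then show ?thesis using b V_snd unfolding \<eta>V[OF b] \<alpha>_def by auto
  qed
  have co': "(p, q) \<in> coincidences G' (\<tau> \<circ> \<eta>) (\<tau> t) ws \<Longrightarrow> (p, q) \<in> coincidences G f s ws \<and> \<alpha> p = \<alpha> q" for p q
    unfolding coincidences_def \<tau>V using desc[of _ p q] by (auto simp: v_def)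
  then have "coincidences G' (\<tau> \<circ> \<eta>) (\<tau> t) ws \<subseteq> coincidences G f s ws" by auto
  moreover have "(i, j) \<notin> coincidences G' (\<tau> \<circ> \<eta>) (\<tau> t) ws" using co' \<alpha>ij by blast
  ultimately have "coincidences G' (\<tau> \<circ> \<eta>) (\<tau> t) ws \<subset> coincidences G f s ws" using p ij
    by blast
  moreover have "(\<tau> \<circ> \<eta>) b = \<one>\<^bsub>G'\<^esub> \<longleftrightarrow> f b = \<one>\<^bsub>G\<^esub>" if b: "b \<in> carrier B" for b
  proof -
    have f'h: "\<tau> \<circ> \<eta> \<in> hom B G'" using f' by (simp add: hnn_hom_def)
    have f'1: "(\<tau> \<circ> \<eta>) \<one> = \<one>\<^bsub>G'\<^esub>" using hom_one[OF f'h is_group G'.is_group] .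
    show ?thesis
    proof
      assume "(\<tau> \<circ> \<eta>) b = \<one>\<^bsub>G'\<^esub>"
      then have "\<tau> (\<eta> b) = \<tau> (\<eta> \<one>)" using f'1 by simp
      then have "snd (\<eta> b) = snd (\<eta> \<one>)" using sep \<eta>X[OF b] \<eta>X[OF one_closed] by blast
      then show "f b = \<one>\<^bsub>G\<^esub>" by (simp add: \<eta>_def)
    next
      assume "f b = \<one>\<^bsub>G\<^esub>"
      then have "\<eta> b = \<eta> \<one>" by (simp add: \<eta>_def)
      then show "(\<tau> \<circ> \<eta>) b = \<one>\<^bsub>G'\<^esub>" using f'1 by simp
    qed
  qed
  ultimately show ?thesis using G' f' by blast
qed

text \<open>
  Repeated separation ends with a path that visits no vertex twice. In particular it does not return
  to its starting vertex, so the word is not mapped into the image of the base group.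
\<close>

theorem separate_reduced_word:
  assumes "G \<in> \<C>" "hnn_hom B H \<phi> G f s" "ws \<in> syllables B" "ws \<noteq> []" "b \<in> carrier B"
    "reduced_mod (\<lambda>b. f b = \<one>\<^bsub>G\<^esub>) ws"
  shows "\<exists>G'\<in>\<C>. \<exists>f' s'. hnn_hom B H \<phi> G' f' s' \<and> f' b \<otimes>\<^bsub>G'\<^esub> word_value G' f' s' ws \<noteq> \<one>\<^bsub>G'\<^esub>"
  using assms
proof (induction "card (coincidences G f s ws)" arbitrary: G f s rule: less_induct)
  case less
  interpret G: group G using member_group less.prems(1) .
  have fh: "f \<in> hom B G" and s: "s \<in> carrier G" using less.prems(2) by (auto simp: hnn_hom_def)
  interpret f: group_hom B G f using fh by (simp add: group_hom_def group_hom_axioms_def is_group)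
  show ?case
  proof (cases "coincidences G f s ws = {}")
    case True
    have "f b \<otimes>\<^bsub>G\<^esub> word_value G f s ws \<noteq> \<one>\<^bsub>G\<^esub>"
    proof
      assume 1: "f b \<otimes>\<^bsub>G\<^esub> word_value G f s ws = \<one>\<^bsub>G\<^esub>"
      have "word_value G f s ws \<in> carrier G" using word_value_closed[OF G.is_group fh s less.prems(3)] .
      then have "word_value G f s ws = f (inv b)"
        using 1 less.prems(5) by (metis G.inv_equality G.inv_inv f.hom_closed f.hom_inv)
      then have "word_value G f s (drop 0 ws) = f (inv b) \<otimes>\<^bsub>G\<^esub> word_value G f s (drop (length ws) ws)"
        using less.prems(5) by simp
      then have "(0, length ws) \<in> coincidences G f s ws"
        using less.prems(4,5) unfolding coincidences_def by blast
      then show False using True by blast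
    qed
    then show ?thesis using less.prems by blast
  next
    case False
    obtain G' f' s' where G': "G' \<in> \<C>" "hnn_hom B H \<phi> G' f' s'"
      "\<forall>b\<in>carrier B. f' b = \<one>\<^bsub>G'\<^esub> \<longleftrightarrow> f b = \<one>\<^bsub>G\<^esub>"
      "coincidences G' f' s' ws \<subset> coincidences G f s ws"
      using separate_coincidence[OF less.prems(1-3,6) False] by blast
    have "reduced_mod (\<lambda>b. f' b = \<one>\<^bsub>G'\<^esub>) ws"
      using less.prems(6) G'(3) syllables_nth[OF less.prems(3)] unfolding reduced_mod_def by (auto split: if_splits)
    then show ?thesis
      using less.hyps[OF psubset_card_mono[OF finite_coincidences G'(4)] G'(1,2) less.prems(3-5)] by blast
  qed
qed

end

section \<open>Residual properties and the theorem\<close>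

lemma (in group_hom) hom_eq_iff:
  assumes "x \<in> carrier G" "y \<in> carrier G"
  shows "h x = h y \<longleftrightarrow> h (x \<otimes> inv y) = \<one>\<^bsub>H\<^esub>"
proof
  assume "h (x \<otimes> inv y) = \<one>\<^bsub>H\<^esub>"
  then have "h (x \<otimes> inv y) \<otimes>\<^bsub>H\<^esub> h y = h y" using assms by simp
  then show "h x = h y" using assms by (simp add: H.m_assoc)
qed (use assms in simp)

context quotient_closed_root_class begin

lemma common_refinement:
  fixes B :: "('b, 'm) monoid_scheme"
  assumes B: "group B" and S1: "S1 \<in> \<C>" "\<sigma>1 \<in> hom B S1" and S2: "S2 \<in> \<C>"
    "\<sigma>2 \<in> hom B S2"
  obtains S \<sigma> where "S \<in> \<C>" "\<sigma> \<in> epi B S"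
    "\<And>b. b \<in> carrier B \<Longrightarrow> \<sigma> b = \<one>\<^bsub>S\<^esub> \<longleftrightarrow> \<sigma>1 b = \<one>\<^bsub>S1\<^esub> \<and> \<sigma>2 b = \<one>\<^bsub>S2\<^esub>"
proof -
  define P where "P = S1 \<times>\<times> S2"
  have P: "in_class P \<C>" "group P"
    unfolding P_def using in_class_DirProd[OF in_class_member[OF iso_closed S1(1)] in_class_member[OF iso_closed S2(1)]]
      DirProd_group member_group S1(1) S2(1) by blast+
  define p where "p = (\<lambda>b. (\<sigma>1 b, \<sigma>2 b))"
  have p: "p \<in> hom B P" using S1(2) S2(2) by (auto simp: hom_def p_def P_def)
  interpret p: group_hom B P p using B P(2) p by (simp add: group_hom_def group_hom_axioms_def)
  define I where "I = P\<lparr>carrier := p ` carrier B\<rparr>"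
  have I: "in_class I \<C>" unfolding I_def by (rule in_class_subgroup[OF P(1) p.img_is_subgroup])
  interpret I: group I using in_class_group[OF I] .
  obtain S j where S: "S \<in> \<C>" "group S" "j \<in> iso I S" using in_class_rep[OF I] .
  have pI: "p \<in> epi B I" using p by (auto simp: epi_def hom_def I_def)
  have jp: "j \<circ> p \<in> epi B S" using epi_compose[OF pI] S(3) iso_iff_mon_epi by blast
  have j1: "j x = \<one>\<^bsub>S\<^esub> \<longleftrightarrow> x = \<one>\<^bsub>I\<^esub>"
    if x: "x \<in> carrier I" for x
  proof -
    have "j \<one>\<^bsub>I\<^esub> = \<one>\<^bsub>S\<^esub>"
      using hom_one[OF iso_imp_homomorphism[OF S(3)] I.is_group S(2)] .
    moreover have "inj_on j (carrier I)" using S(3) by (simp add: iso_iff)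
    ultimately show ?thesis using x by (metis I.one_closed inj_onD)
  qed
  have "(j \<circ> p) b = \<one>\<^bsub>S\<^esub> \<longleftrightarrow> \<sigma>1 b = \<one>\<^bsub>S1\<^esub> \<and> \<sigma>2 b = \<one>\<^bsub>S2\<^esub>" if b: "b \<in> carrier B" for b
    using j1[of "p b"] b by (simp add: I_def p_def P_def)
  then show thesis using that S(1) jp by blast
qed

lemma residual_image:
  assumes "group X" "\<And>x. x \<in> carrier X \<Longrightarrow> x \<noteq> \<one>\<^bsub>X\<^esub> \<Longrightarrow> \<exists>G\<in>\<C>. \<exists>f\<in>hom X G. f x \<noteq> \<one>\<^bsub>G\<^esub>"
  shows "residually X \<C>"
  unfolding residually_def
proof (intro ballI impI)
  fix x assume "x \<in> carrier X" "x \<noteq> \<one>\<^bsub>X\<^esub>"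
  then obtain G f where G: "G \<in> \<C>" "f \<in> hom X G" "f x \<noteq> \<one>\<^bsub>G\<^esub>" using assms(2)
    by blast
  interpret f: group_hom X G f using assms(1) member_group[OF G(1)] G(2)
  by (simp add: group_hom_def group_hom_axioms_def)
  have "G\<lparr>carrier := f ` carrier X\<rparr> \<in> \<C>"
    using root G(1) f.img_is_subgroup unfolding root_class_def subgroup_closed_def by blast
  moreover have "f \<in> epi X (G\<lparr>carrier := f ` carrier X\<rparr>)" using G(2) by (auto simp: epi_def hom_def)
  ultimately show "\<exists>G\<in>\<C>. \<exists>f\<in>epi X G. f x \<noteq> \<one>\<^bsub>G\<^esub>"
    using G(3) by (intro bexI[of _ "G\<lparr>carrier := f ` carrier X\<rparr>"] bexI[of _ f]) simp_all
qed

end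

context normal_hnn_epi begin

text \<open>
  Subsets \<open>J\<close> of \<open>HK\<close> are closed in the topology defined by the class. If \<open>\<sigma>\<close> does not separate \<open>b\<close> from
  \<open>J\<close>, then, being injective on \<open>HK\<close>, it identifies \<open>b\<close> with exactly one \<open>x \<in> J\<close>, and it suffices to refine \<open>\<sigma>\<close>
  by one homomorphism that does not kill \<open>b x\<inverse>\<close>.
\<close>

lemma separate_from_subsets:
  assumes res: "residually B \<C>" and fin: "finite F"
    and F: "\<And>J b. (J, b) \<in> F \<Longrightarrow> J \<subseteq> H <#> K \<and> b \<in> carrier B \<and> b \<notin> J"
  shows "\<exists>S'\<in>\<C>. \<exists>\<sigma>'\<in>epi B S'. (\<forall>b\<in>carrier B. \<sigma>' b = \<one>\<^bsub>S'\<^esub> \<longrightarrow> \<sigma> b = \<one>\<^bsub>S\<^esub>) \<and>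
     (\<forall>(J, b)\<in>F. \<sigma>' b \<notin> \<sigma>' ` J)"
  using fin F
proof (induction F rule: finite_induct)
  case empty
  then show ?case using S \<sigma> by auto
next
  case (insert p F)
  obtain J b where p: "p = (J, b)" by (cases p)
  have J: "J \<subseteq> H <#> K" "b \<in> carrier B" "b \<notin> J" using insert.prems p by auto
  have HKc: "x \<in> carrier B" if "x \<in> H <#> K" for x using that setmult_subset_G subgroup.subset sub by blast
  obtain S1 \<sigma>1 where S1: "S1 \<in> \<C>" "\<sigma>1 \<in> epi B S1"
    and le1: "\<And>b. b \<in> carrier B \<Longrightarrow> \<sigma>1 b = \<one>\<^bsub>S1\<^esub> \<Longrightarrow> \<sigma> b = \<one>\<^bsub>S\<^esub>"
    and F1: "\<forall>(J, b)\<in>F. \<sigma>1 b \<notin> \<sigma>1 ` J" using insert by blast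
  show ?case
  proof (cases "\<sigma>1 b \<in> \<sigma>1 ` J")
    case False
    then show ?thesis using S1 le1 F1 p by auto
  next
    case True
    then obtain x where x: "x \<in> J" "\<sigma>1 b = \<sigma>1 x" by blast
    have xc: "x \<in> carrier B" using x J HKc by blast
    have "b \<otimes> inv x \<noteq> \<one>"
    proof
      assume "b \<otimes> inv x = \<one>"
      then have "b \<otimes> inv x \<otimes> x = x" using xc by simp
      then have "b = x" using J(2) xc by (simp add: m_assoc)
      then show False using x J by blast
    qed
    then obtain R \<rho> where R: "R \<in> \<C>" "\<rho> \<in> epi B R"
      "\<rho> (b \<otimes> inv x) \<noteq> \<one>\<^bsub>R\<^esub>"
      using res J(2) xc unfolding residually_def by blast
    have h: "\<sigma>1 \<in> hom B S1" "\<rho> \<in> hom B R" using S1 R by (simp_all add: epi_def)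
    obtain S2 \<sigma>2 where S2: "S2 \<in> \<C>" "\<sigma>2 \<in> epi B S2"
      and k: "\<And>b. b \<in> carrier B \<Longrightarrow> \<sigma>2 b = \<one>\<^bsub>S2\<^esub> \<longleftrightarrow> \<sigma>1 b = \<one>\<^bsub>S1\<^esub> \<and> \<rho> b = \<one>\<^bsub>R\<^esub>"
      by (rule common_refinement[OF is_group S1(1) h(1) R(1) h(2)]) blast
    interpret \<sigma>1: group_hom B S1 \<sigma>1 using h member_group[OF S1(1)]
    by (simp add: group_hom_def group_hom_axioms_def is_group)
    interpret \<sigma>2: group_hom B S2 \<sigma>2 using S2 member_group[OF S2(1)]
    by (simp add: group_hom_def group_hom_axioms_def is_group epi_def)
    have eq1: "\<sigma>1 u = \<sigma>1 w" and eq\<rho>: "\<rho> (u \<otimes> inv w) = \<one>\<^bsub>R\<^esub>"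
      if "u \<in> carrier B" "w \<in> carrier B" "\<sigma>2 u = \<sigma>2 w" for u w
      using that k[of "u \<otimes> inv w"] \<sigma>1.hom_eq_iff[OF that(1,2)] \<sigma>2.hom_eq_iff[OF that(1,2)]
      by auto
    have "\<sigma>2 b \<notin> \<sigma>2 ` J"
    proof
      assume "\<sigma>2 b \<in> \<sigma>2 ` J"
      then obtain w where w: "w \<in> J" "\<sigma>2 b = \<sigma>2 w" by blast
      have wc: "w \<in> carrier B" using w J HKc by blast
      have "\<sigma>1 x = \<sigma>1 w" using eq1[OF J(2) wc w(2)] x by simp
      then have "\<sigma> x = \<sigma> w"
        using le1[of "x \<otimes> inv w"] xc wc \<sigma>1.hom_eq_iff[OF xc wc] \<sigma>.hom_eq_iff[OF xc wc] by blast
      then have "x = w" using inj_onD[OF inj] x w J by blast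
      then show False using eq\<rho>[OF J(2) wc w(2)] R(3) by simp
    qed
    moreover have "\<sigma>2 b' \<notin> \<sigma>2 ` J'" if "(J', b') \<in> F" for J' b'
    proof
      assume "\<sigma>2 b' \<in> \<sigma>2 ` J'"
      then obtain w where w: "w \<in> J'" "\<sigma>2 b' = \<sigma>2 w" by blast
      have "b' \<in> carrier B" "w \<in> carrier B" using insert.prems that w HKc by blast+
      then show False using eq1[OF _ _ w(2)] F1 that w(1) by blast
    qed
    ultimately show ?thesis using S2 k le1 p by (intro bexI[of _ S2] bexI[of _ \<sigma>2]) auto
  qed
qed

text \<open>
  For a reduced word there is a refinement of \<open>\<sigma>\<close> under which the word stays reduced; as the refinement is again
  injective on \<open>HK\<close>, it extends to the HNN-extension by \<open>extension_exists\<close>, and the resulting pair is the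
  starting point for \<open>separate_reduced_word\<close>. Elements of the base group are separated by the extension itself.
\<close>

theorem HNN_residually:
  assumes U: "in_class (hnn_U B H K \<phi>) \<C>" and V: "in_class (hnn_V B (H \<inter> K) \<phi>) \<C>"
    and res: "residually B \<C>"
  shows "residually (HNN B H \<phi>) \<C>"
proof (rule residual_image[OF HNN_group])
  fix x assume x: "x \<in> carrier (HNN B H \<phi>)" "x \<noteq> \<one>\<^bsub>HNN B H \<phi>\<^esub>"
  obtain b ws where b: "b \<in> carrier B" and ws: "ws \<in> syllables B" and red: "reduced ws"
    and xw: "x = hnn_base B H \<phi> b \<otimes>\<^bsub>HNN B H \<phi>\<^esub> word_value (HNN B H \<phi>) (hnn_base B H \<phi>) (hnn_stable B H \<phi>) ws"
    using HNN_reduced_form[OF x(1)] .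
  have HKc: "x \<in> carrier B" if "x \<in> H <#> K" for x using that setmult_subset_G subgroup.subset sub by blast
  have oneHK: "{\<one>} \<subseteq> H <#> K" using H_HK subgroup.one_closed[OF sub(1)] by blast
  define F where "F = {(J, c). J \<in> {H, K, {\<one>}} \<and> c \<in> insert b (snd ` set ws) \<and> c \<notin> J}"
  have "F \<subseteq> {H, K, {\<one>}} \<times> insert b (snd ` set ws)" by (auto simp: F_def)
  then have finF: "finite F" by (rule finite_subset) auto
  have wsB: "snd ` set ws \<subseteq> carrier B" using ws by (auto simp: syllables_def lists_eq_set)
  have FF: "J \<subseteq> H <#> K \<and> c \<in> carrier B \<and> c \<notin> J" if "(J, c) \<in> F" for J c
    using that wsB b H_HK K_HK oneHK by (auto simp: F_def)
  obtain S' \<sigma>' where S': "S' \<in> \<C>" "\<sigma>' \<in> epi B S'"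
    and le: "\<And>b. b \<in> carrier B \<Longrightarrow> \<sigma>' b = \<one>\<^bsub>S'\<^esub> \<Longrightarrow> \<sigma> b = \<one>\<^bsub>S\<^esub>" and sep: "\<forall>(J, b)\<in>F. \<sigma>' b \<notin> \<sigma>' ` J"
    using separate_from_subsets[OF res finF FF] by blast
  interpret \<sigma>': group_hom B S' \<sigma>' using S' member_group[OF S'(1)]
  by (simp add: group_hom_def group_hom_axioms_def is_group epi_def)
  have "inj_on \<sigma>' (H <#> K)"
  proof (rule inj_onI)
    fix u w assume uw: "u \<in> H <#> K" "w \<in> H <#> K" "\<sigma>' u = \<sigma>' w"
    then have c: "u \<in> carrier B" "w \<in> carrier B" using HKc by auto
    have "\<sigma> u = \<sigma> w"
      using le[of "u \<otimes> inv w"] c uw(3) \<sigma>'.hom_eq_iff[OF c] \<sigma>.hom_eq_iff[OF c] by blast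
    then show "u = w" using inj_onD[OF inj] uw by blast
  qed
  then interpret fine: normal_hnn_epi \<C> B H K \<phi> S' \<sigma>'
    using S' by (intro normal_hnn_epi.intro normal_hnn_epi_axioms.intro normal_hnn_axioms)
  obtain G f s where G: "G \<in> \<C>" and f: "hnn_hom B H \<phi> G f s"
    and ker: "\<forall>b\<in>carrier B. f b = \<one>\<^bsub>G\<^esub> \<longleftrightarrow> \<sigma>' b = \<one>\<^bsub>S'\<^esub>" using fine.extension_exists[OF U V] by blast
  have apart: "\<sigma>' (y \<otimes> c) \<noteq> \<one>\<^bsub>S'\<^esub>" if J: "J \<in> {H, K, {\<one>}}"
    and c: "c \<in> insert b (snd ` set ws)" "c \<notin> J" and y: "y \<in> J" for J c y
  proof
    assume 1: "\<sigma>' (y \<otimes> c) = \<one>\<^bsub>S'\<^esub>"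
    have yc: "y \<in> carrier B" "c \<in> carrier B" using y J c b wsB by auto
    have "inv y \<in> J" using J y subgroup.m_inv_closed[OF sub(1)] subgroup.m_inv_closed[OF sub(2)] by auto
    have "\<sigma>' y \<otimes>\<^bsub>S'\<^esub> \<sigma>' c = \<one>\<^bsub>S'\<^esub>" using 1 yc by simp
    then have "\<sigma>' c \<otimes>\<^bsub>S'\<^esub> \<sigma>' y = \<one>\<^bsub>S'\<^esub>"
      by (rule \<sigma>'.H.inv_comm) (use yc in simp_all)
    then have "\<sigma>' c = \<sigma>' (inv y)" using yc \<sigma>'.H.inv_equality[of "\<sigma>' c" "\<sigma>' y"]
      by simp
    then have "\<sigma>' c \<in> \<sigma>' ` J" using imageI[OF \<open>inv y \<in> J\<close>, of \<sigma>'] by simp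
    moreover have "(J, c) \<in> F" using J c unfolding F_def by blast
    ultimately show False using bspec[OF sep, of "(J, c)"] by simp
  qed
  show "\<exists>G\<in>\<C>. \<exists>f\<in>hom (HNN B H \<phi>) G. f x \<noteq> \<one>\<^bsub>G\<^esub>"
  proof (cases "ws = []")
    case True
    obtain \<tau> where \<tau>: "\<tau> \<in> hom (HNN B H \<phi>) G"
      "\<And>b. b \<in> carrier B \<Longrightarrow> \<tau> (hnn_base B H \<phi> b) = f b"
      by (rule HNN_hom_ex[OF member_group[OF G] f]) blast
    have hb: "hnn_base B H \<phi> b \<in> carrier (HNN B H \<phi>)" using hnn_base_hom b by (auto simp: hom_def)
    then have xb: "x = hnn_base B H \<phi> b"
      using xw True by (simp add: monoid.r_one[OF group.is_monoid[OF HNN_group]])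
    have "b \<noteq> \<one>" using x(2) xb hom_one[OF hnn_base_hom is_group HNN_group] by auto
    then have "\<sigma>' b \<noteq> \<one>\<^bsub>S'\<^esub>" using apart[of "{\<one>}" b \<one>] b by simp
    then have "\<tau> x \<noteq> \<one>\<^bsub>G\<^esub>" using ker b \<tau>(2)[OF b] xb by simp
    then show ?thesis using G \<tau>(1) by blast
  next
    case False
    have "reduced_mod (\<lambda>b. f b = \<one>\<^bsub>G\<^esub>) ws"
      unfolding reduced_mod_def
    proof (intro allI impI ballI)
      fix i c assume i: "Suc i < length ws" "fst (ws ! i) \<noteq> fst (ws ! Suc i)"
        and c: "c \<in> (if fst (ws ! i) then K else H)"
      have "snd (ws ! i) \<notin> (if fst (ws ! i) then K else H)" using red i unfolding reduced_def by blast
      moreover have "snd (ws ! i) \<in> snd ` set ws" using i by simp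
      ultimately have "\<sigma>' (c \<otimes> snd (ws ! i)) \<noteq> \<one>\<^bsub>S'\<^esub>"
        using apart[of "if fst (ws ! i) then K else H" "snd (ws ! i)" c] c by auto
      moreover have "c \<in> carrier B" using c by (auto split: if_splits)
      ultimately show "f (c \<otimes> snd (ws ! i)) \<noteq> \<one>\<^bsub>G\<^esub>"
        using ker syllables_nth[OF ws, of i] i by auto
    qed
    from separate_reduced_word[OF G f ws False b this]
    obtain G' f' s' where G': "G' \<in> \<C>" "hnn_hom B H \<phi> G' f' s'"
      "f' b \<otimes>\<^bsub>G'\<^esub> word_value G' f' s' ws \<noteq> \<one>\<^bsub>G'\<^esub>" by blast
    obtain \<tau> where \<tau>: "\<tau> \<in> hom (HNN B H \<phi>) G'"
      "\<And>b ws. b \<in> carrier B \<Longrightarrow> ws \<in> syllables B \<Longrightarrow>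
       \<tau> (hnn_base B H \<phi> b \<otimes>\<^bsub>HNN B H \<phi>\<^esub> word_value (HNN B H \<phi>) (hnn_base B H \<phi>) (hnn_stable B H \<phi>) ws) = f' b \<otimes>\<^bsub>G'\<^esub> word_value G' f' s' ws"
      by (rule HNN_hom_ex[OF member_group[OF G'(1)] G'(2)]) blast
    then have "\<tau> x \<noteq> \<one>\<^bsub>G'\<^esub>" using b ws xw G'(3) by simp
    then show ?thesis using G'(1) \<tau>(1) by blast
  qed
qed

theorem extends_if_automorphism_groups_in_class:
  assumes U: "in_class (hnn_U B H K \<phi>) \<C>" and V: "in_class (hnn_V B (H \<inter> K) \<phi>) \<C>"
  shows "\<exists>G\<in>\<C>. \<exists>\<tau>\<in>epi (HNN B H \<phi>) G. hnn_extends B H \<phi> S \<sigma> G \<tau>"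
proof -
  obtain G f s where G: "G \<in> \<C>" and f: "hnn_hom B H \<phi> G f s"
    and ker: "\<forall>b\<in>carrier B. f b = \<one>\<^bsub>G\<^esub> \<longleftrightarrow> \<sigma> b = \<one>\<^bsub>S\<^esub>" using extension_exists[OF U V] by blast
  have fh: "f \<in> hom B G" using f by (simp add: hnn_hom_def)
  interpret f: group_hom B G f using fh member_group[OF G] by (simp add: group_hom_def group_hom_axioms_def is_group)
  obtain \<tau> where \<tau>: "\<tau> \<in> hom (HNN B H \<phi>) G"
    "\<And>b. b \<in> carrier B \<Longrightarrow> \<tau> (hnn_base B H \<phi> b) = f b"
    by (rule HNN_hom_ex[OF member_group[OF G] f]) blast
  interpret \<tau>: group_hom "HNN B H \<phi>" G \<tau>
    using \<tau>(1) member_group[OF G] HNN_group by (simp add: group_hom_def group_hom_axioms_def)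
  define G1 where "G1 = G\<lparr>carrier := \<tau> ` carrier (HNN B H \<phi>)\<rparr>"
  have G1: "G1 \<in> \<C>" unfolding G1_def
    using root G \<tau>.img_is_subgroup unfolding root_class_def subgroup_closed_def by blast
  have \<tau>1: "\<tau> \<in> epi (HNN B H \<phi>) G1" using \<tau>(1) by (auto simp: epi_def hom_def G1_def)
  define e where "e = (\<lambda>x. f (inv_into (carrier B) \<sigma> x))"
  have sur: "\<sigma> ` carrier B = carrier S" using \<sigma> by (simp add: epi_def)
  have cong: "f b = f c \<longleftrightarrow> \<sigma> b = \<sigma> c" if "b \<in> carrier B"
    "c \<in> carrier B" for b c
    unfolding f.hom_eq_iff[OF that] \<sigma>.hom_eq_iff[OF that] using ker that by blast
  have e\<sigma>: "e (\<sigma> b) = f b" if b: "b \<in> carrier B" for b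
  proof -
    have "\<sigma> b \<in> \<sigma> ` carrier B" using b by (rule imageI)
    then have "inv_into (carrier B) \<sigma> (\<sigma> b) \<in> carrier B"
      "\<sigma> (inv_into (carrier B) \<sigma> (\<sigma> b)) = \<sigma> b"
      by (rule inv_into_into, rule f_inv_into_f)
    then show ?thesis unfolding e_def using cong[OF _ b] by simp
  qed
  have rep: "\<exists>b\<in>carrier B. x = \<sigma> b" if "x \<in> carrier S" for x using sur that by blast
  have fG1: "f b \<in> carrier G1" if b: "b \<in> carrier B" for b
  proof -
    have "hnn_base B H \<phi> b \<in> carrier (HNN B H \<phi>)" using hnn_base_hom b by (auto simp: hom_def)
    then show ?thesis using imageI[of "hnn_base B H \<phi> b" _ \<tau>]
      by (simp add: G1_def \<tau>(2)[OF b, symmetric])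
  qed
  have "e \<in> mon S G1"
    unfolding mon_def
  proof (intro CollectI conjI homI inj_onI)
    fix x assume "x \<in> carrier S"
    then obtain b where "b \<in> carrier B" "x = \<sigma> b" using rep by blast
    then show "e x \<in> carrier G1" using e\<sigma> fG1 by simp
  next
    fix x y assume "x \<in> carrier S" "y \<in> carrier S"
    then obtain b c where bc: "b \<in> carrier B" "x = \<sigma> b" "c \<in> carrier B" "y = \<sigma> c" using rep
      by blast
    then have "e (x \<otimes>\<^bsub>S\<^esub> y) = f (b \<otimes> c)" using e\<sigma>[of "b \<otimes> c"] by simp
    then show "e (x \<otimes>\<^bsub>S\<^esub> y) = e x \<otimes>\<^bsub>G1\<^esub> e y" using bc e\<sigma>
      by (simp add: G1_def)
  next
    fix x y assume xy: "x \<in> carrier S" "y \<in> carrier S" "e x = e y"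
    then obtain b c where "b \<in> carrier B" "x = \<sigma> b" "c \<in> carrier B" "y = \<sigma> c" using rep by blast
    then show "x = y" using xy(3) e\<sigma> cong by simp
  qed
  then have "hnn_extends B H \<phi> S \<sigma> G1 \<tau>" unfolding hnn_extends_def using e\<sigma> \<tau>(2)
    by (intro bexI[of _ e]) simp_all
  then show ?thesis using G1 \<tau>1 by blast
qed

end

theorem theorem2:
  fixes B :: "'b monoid" and H K :: "'b set" and \<phi> :: "'b \<Rightarrow> 'b"
    and \<C> :: "'u monoid set" and S :: "'u monoid" and \<sigma> :: "'b \<Rightarrow> 'u"
  assumes universe: "infinite (UNIV :: 'u set)" "carrier B \<lesssim> (UNIV :: 'u set)"
    and B: "group B"
    and H: "H \<lhd> B"
    and K: "K \<lhd> B"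
    and \<phi>: "\<phi> \<in> iso (B\<lparr>carrier := H\<rparr>) (B\<lparr>carrier := K\<rparr>)"
    and L: "\<phi> ` (H \<inter> K) = H \<inter> K"
    and root: "root_class \<C>"
    and quot: "quotient_closed \<C>"
    and \<sigma>: "S \<in> \<C>" "\<sigma> \<in> epi B S"
    and inj: "inj_on \<sigma> (H <#>\<^bsub>B\<^esub> K)"
  shows "(in_class (hnn_U B H K \<phi>) \<C> \<and> in_class (hnn_V B (H \<inter> K) \<phi>) \<C> \<longleftrightarrow>
            (\<exists>G\<in>\<C>. \<exists>\<tau>\<in>epi (HNN B H \<phi>) G. hnn_extends B H \<phi> S \<sigma> G \<tau>))
       \<and> (in_class (hnn_U B H K \<phi>) \<C> \<and> in_class (hnn_V B (H \<inter> K) \<phi>) \<C> \<and> residually B \<C> \<longrightarrow>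
            residually (HNN B H \<phi>) \<C>)"
proof -
  interpret normal_hnn_epi \<C> B H K \<phi> S \<sigma>
    using assms by (simp add: normal_hnn_epi_def normal_hnn_epi_axioms_def normal_hnn_def normal_hnn_axioms_def quotient_closed_root_class_def)
  show ?thesis
    using extends_if_automorphism_groups_in_class automorphism_groups_in_class_if_extends HNN_residually by blast
qed

end
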